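(* Let $A:[0,\infty)\to\mathbb{R}^{d\times d}$ be continuous and bounded, and let the system $\dot x=A(t)x$ have Lyapunov exponents $\lambda_1>\dots>\lambda_q$ with multiplicities $d_1,\dots,d_q$. Assume the system is regular and $(d_1+\dots+d_l)$-dimensionally strongly fast invertible for every $l=1,\dots,q$. Let $\Phi$ be a one-step method for this system that is consistent of order $p>0$, and let $(h_n)_{n\ge1}$ be stepsizes with $0<h_n\le h_{\max}$ and $t_n=h_1+\dots+h_n\to\infty$. If $\sum_{n=1}^\infty h_n^{p+1}<\infty$, then for Lebesgue-almost every tuple of initial vectors $(v_1,\dots,v_d)\in(\mathbb{R}^d)^d$ the outputs $\mu_i(n)$ of Benettin's algorithm satisfy $$d_i\lambda_i=\limsup_{n\to\infty}\big(\mu_1(n)+\dots+\mu_{d_1+\dots+d_i}(n)\big)-\limsup_{n\to\infty}\big(\mu_1(n)+\dots+\mu_{d_1+\dots+d_{i-1}}(n)\big)$$ for all $i=1,\dots,q$ (the empty sum for $i=1$ being $0$). In particular, if the Lyapunov spectrum is simple (all $d_i=1$), then for Lebesgue-almost every tuple of initial vectors $$\lambda_i=\limsup_{n\to\infty}\big(\mu_1(n)+\dots+\mu_i(n)\big)-\limsup_{n\to\infty}\big(\mu_1(n)+\dots+\mu_{i-1}(n)\big)$$ for all $i$.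
   Context: Norms are Euclidean norms and associated operator norms. $X(t)$ denotes a fundamental matrix of $\dot x=A(t)x$ and $X(t,s)=X(t)X(s)^{-1}$ the Cauchy matrix. Lyapunov exponents: for a solution $x$ put $\chi[x]=\limsup_{t\to\infty}\frac1t\log\|x(t)\|$. The distinct values of $\chi$ on non-trivial solutions are $\lambda_1>\dots>\lambda_q$; with $V_i=\{x \text{ solution}:\chi[x]\le\lambda_i\}$, $V_{q+1}=\{0\}$, the multiplicity of $\lambda_i$ is $d_i=\dim V_i-\dim V_{i+1}$, so $d_1+\dots+d_q=d$. The system is regular if $\sum_{i=1}^q d_i\lambda_i=\liminf_{t\to\infty}\frac1t\log|\det X(t)|$. The system is $L$-dimensionally strongly fast invertible ($1\le L\le d$) if $\sup_{t\ge s\ge\tau\ge 0}\prod_{k=1}^L\frac{\sigma_k(X(t,s))\sigma_k(X(s,\tau))}{\sigma_k(X(t,\tau))}<\infty$, where $\sigma_1\ge\dots\ge\sigma_d$ denote singular values. One-step method: fix $0<h_{\max}<\infty$. A (linear) one-step method is a map $\Phi:[0,\infty)\times[0,h_{\max}]\to GL(d,\mathbb{R})$. It is consistent of order $p>0$ if there is a constant $c_\Phi>0$ with $\|\Phi(t,h)-X(t+h,t)\|\le c_\Phi h^{p+1}$ for all $t\ge0$, $0\le h\le h_{\max}$. Given stepsizes, put $t_0=0$, $t_n=h_1+\dots+h_n$, $\Phi_n=\Phi(t_{n-1},h_n)$. Benettin's algorithm: start with $V_0=[v_1,\dots,v_d]$ (invertible for almost every tuple). For $n\ge1$ compute the QR-decomposition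 $\Phi_nV_{n-1}=Q_nR_n$ ($Q_n$ orthogonal, $R_n$ upper triangular with positive diagonal) and set $V_n=Q_n$. The output after $n$ steps is $\mu_i(n)=\frac1{t_n}\sum_{k=1}^n\log (R_k)_{ii}$, $i=1,\dots,d$. *)

theory Defs
  imports "HOL-Analysis.Analysis" "HOL-Library.Function_Algebras"
begin

text \<open>Matrices are of type \<open>real^'n^'n\<close> with a finite linearly ordered index type \<open>'n\<close>, so
  \<open>d = CARD('n)\<close>; the order is needed for triangularity.
  The library norm on this type is the Frobenius norm, whereas \<open>opnorm\<close> is the operator norm
  associated with the Euclidean norm.\<close>

text \<open>Synonyms for \<open>real^'n^'n\<close>, usable with an ordered index type; the components
  \<open>v $ j\<close> of a tuple \<open>v\<close> are its vectors.\<close>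

type_synonym 'n sqmat = "((real, 'n) vec, 'n) vec"
type_synonym 'n tuple = "((real, 'n) vec, 'n) vec"

definition opnorm :: "real^'n^'n \<Rightarrow> real" where
  "opnorm M = onorm (\<lambda>x. M *v x)"

text \<open>The \<open>i\<close>-th index of \<open>'n\<close>, counting from 1.\<close>

definition nth_index :: "nat \<Rightarrow> 'n::{finite,linorder}" where
  "nth_index i = sorted_list_of_set UNIV ! (i - 1)"

subsection \<open>Singular values\<close>

definition sv_space :: "real^'n^'n \<Rightarrow> real \<Rightarrow> (real^'n) set" where
  "sv_space M s = {x. (transpose M ** M) *v x = s\<^sup>2 *\<^sub>R x}"

definition singular_value_set :: "real^'n^'n \<Rightarrow> real set" where
  "singular_value_set M = {s. s \<ge> 0 \<and> (\<exists>x. x \<noteq> 0 \<and> x \<in> sv_space M s)}"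

text \<open>The multiplicity of an eigenvalue of the symmetric matrix \<open>transpose M ** M\<close> is the
  dimension of its eigenspace.\<close>

definition singular_value_list :: "real^'n^'n \<Rightarrow> real list" where
  "singular_value_list M =
     concat (map (\<lambda>s. replicate (dim (sv_space M s)) s)
       (rev (sorted_list_of_set (singular_value_set M))))"

definition \<sigma> :: "nat \<Rightarrow> real^'n^'n \<Rightarrow> real" where
  "\<sigma> k M = singular_value_list M ! (k - 1)"

subsection \<open>Linear systems on the half-line\<close>

text \<open>A solution is a function on \<open>[0,\<infinity>)\<close>; it is represented by its extension by zero to
  the real line, so that distinct representatives are distinct solutions.\<close>

definition is_solution :: "(real \<Rightarrow> real^'n^'n) \<Rightarrow> (real \<Rightarrow> real^'n) \<Rightarrow> bool" where
  "is_solution A x \<longleftrightarrow>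
     (\<forall>t\<ge>0. (x has_vector_derivative (A t *v x t)) (at t within {0..})) \<and> (\<forall>t<0. x t = 0)"

definition is_fundamental_matrix :: "(real \<Rightarrow> real^'n^'n) \<Rightarrow> (real \<Rightarrow> real^'n^'n) \<Rightarrow> bool" where
  "is_fundamental_matrix A X \<longleftrightarrow>
     (\<forall>t\<ge>0. (X has_vector_derivative (A t ** X t)) (at t within {0..}) \<and> invertible (X t))"

definition cauchy_matrix :: "(real \<Rightarrow> real^'n^'n) \<Rightarrow> real \<Rightarrow> real \<Rightarrow> real^'n^'n" where
  "cauchy_matrix X t s = X t ** matrix_inv (X s)"

subsection \<open>Lyapunov exponents and multiplicities\<close>

text \<open>With \<open>log 0 = -\<infinity>\<close> the zero solution has exponent \<open>-\<infinity>\<close>.\<close>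

definition elog :: "real \<Rightarrow> ereal" where
  "elog r = (if r = 0 then -\<infinity> else ereal (ln r))"

definition lyapunov_exponent :: "(real \<Rightarrow> real^'n) \<Rightarrow> ereal" where
  "lyapunov_exponent x = Limsup at_top (\<lambda>t. ereal (1 / t) * elog (norm (x t)))"

definition lyap_filtration ::
    "(real \<Rightarrow> real^'n^'n) \<Rightarrow> nat \<Rightarrow> (nat \<Rightarrow> real) \<Rightarrow> nat \<Rightarrow> (real \<Rightarrow> real^'n) set" where
  "lyap_filtration A q lam i =
     (if i = q + 1 then {0}
      else {x. is_solution A x \<and> lyapunov_exponent x \<le> ereal (lam i)})"

text \<open>Vector-valued functions of time form a real vector space under pointwise operations
  (zero and addition come from \<open>Function_Algebras\<close>); \<open>solspace.dim\<close> is the dimension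
  in that space.\<close>

definition scale_fun :: "real \<Rightarrow> (real \<Rightarrow> 'a::real_vector) \<Rightarrow> real \<Rightarrow> 'a" where
  "scale_fun c f = (\<lambda>t. c *\<^sub>R f t)"

global_interpretation solspace: vector_space scale_fun
  by unfold_locales (auto simp: scale_fun_def fun_eq_iff algebra_simps)

text \<open>The system has Lyapunov exponents \<open>lam 1 > \<dots> > lam q\<close> with multiplicities
  \<open>m 1, \<dots>, m q\<close>.\<close>

definition has_lyapunov_spectrum ::
    "(real \<Rightarrow> real^'n^'n) \<Rightarrow> nat \<Rightarrow> (nat \<Rightarrow> real) \<Rightarrow> (nat \<Rightarrow> nat) \<Rightarrow> bool" where
  "has_lyapunov_spectrum A q lam m \<longleftrightarrow>
     (\<forall>i\<in>{1..q}. \<forall>j\<in>{1..q}. i < j \<longrightarrow> lam j < lam i) \<and>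
     {lyapunov_exponent x | x. is_solution A x \<and> x \<noteq> 0} = (\<lambda>i. ereal (lam i)) ` {1..q} \<and>
     (\<forall>i\<in>{1..q}. m i =
        solspace.dim (lyap_filtration A q lam i) - solspace.dim (lyap_filtration A q lam (i + 1)))"

definition regular_system ::
    "(real \<Rightarrow> real^'n^'n) \<Rightarrow> nat \<Rightarrow> (nat \<Rightarrow> real) \<Rightarrow> (nat \<Rightarrow> nat) \<Rightarrow> bool" where
  "regular_system X q lam m \<longleftrightarrow>
     ereal (\<Sum>i=1..q. real (m i) * lam i) =
       Liminf at_top (\<lambda>t. ereal (1 / t * ln \<bar>det (X t)\<bar>))"

definition strongly_fast_invertible :: "(real \<Rightarrow> real^'n^'n) \<Rightarrow> nat \<Rightarrow> bool" where
  "strongly_fast_invertible X L \<longleftrightarrow>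
     bdd_above {(\<Prod>k=1..L. \<sigma> k (cauchy_matrix X t s) * \<sigma> k (cauchy_matrix X s u)
                            / \<sigma> k (cauchy_matrix X t u))
                | t s u. t \<ge> s \<and> s \<ge> u \<and> u \<ge> 0}"

subsection \<open>One-step methods\<close>

definition one_step_method :: "real \<Rightarrow> (real \<Rightarrow> real \<Rightarrow> real^'n^'n) \<Rightarrow> bool" where
  "one_step_method hmax \<Phi> \<longleftrightarrow> (\<forall>t\<ge>0. \<forall>h\<in>{0..hmax}. invertible (\<Phi> t h))"

definition consistent_of_order ::
    "(real \<Rightarrow> real^'n^'n) \<Rightarrow> real \<Rightarrow> (real \<Rightarrow> real \<Rightarrow> real^'n^'n) \<Rightarrow> real \<Rightarrow> bool" where
  "consistent_of_order X hmax \<Phi> p \<longleftrightarrow>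
     (\<exists>c>0. \<forall>t\<ge>0. \<forall>h\<in>{0..hmax}.
        opnorm (\<Phi> t h - cauchy_matrix X (t + h) t) \<le> c * h powr (p + 1))"

text \<open>Stepsizes are \<open>h 1, h 2, \<dots>\<close>; the value \<open>h 0\<close> is never used.\<close>

definition grid :: "(nat \<Rightarrow> real) \<Rightarrow> nat \<Rightarrow> real" where
  "grid h n = (\<Sum>k=1..n. h k)"

definition step_matrix ::
    "(real \<Rightarrow> real \<Rightarrow> real^'n^'n) \<Rightarrow> (nat \<Rightarrow> real) \<Rightarrow> nat \<Rightarrow> real^'n^'n" where
  "step_matrix \<Phi> h n = \<Phi> (grid h (n - 1)) (h n)"

subsection \<open>Benettin's algorithm\<close>

definition is_qr :: "'n::{finite,linorder} sqmat \<Rightarrow> 'n sqmat \<Rightarrow> 'n sqmat \<Rightarrow> bool" where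
  "is_qr M Q R \<longleftrightarrow>
     M = Q ** R \<and> orthogonal_matrix Q \<and> (\<forall>i j. j < i \<longrightarrow> R $ i $ j = 0) \<and> (\<forall>i. R $ i $ i > 0)"

text \<open>Such a decomposition exists, and is then unique, exactly for invertible \<open>M\<close>; for singular
  \<open>M\<close> the value is unspecified.\<close>

definition qr :: "'n::{finite,linorder} sqmat \<Rightarrow> ('n sqmat) \<times> ('n sqmat)" where
  "qr M = (SOME (Q, R). is_qr M Q R)"

text \<open>The initial vectors \<open>v $ j\<close> become the columns of
  \<open>V\<^sub>0\<close>, hence the transpose.\<close>

fun benettin_V ::
    "(nat \<Rightarrow> 'n::{finite,linorder} sqmat) \<Rightarrow> 'n tuple \<Rightarrow> nat \<Rightarrow> 'n sqmat" where
  "benettin_V F v 0 = transpose v"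
| "benettin_V F v (Suc n) = fst (qr (F (Suc n) ** benettin_V F v n))"

definition benettin_R ::
    "(nat \<Rightarrow> 'n::{finite,linorder} sqmat) \<Rightarrow> 'n tuple \<Rightarrow> nat \<Rightarrow> 'n sqmat" where
  "benettin_R F v n = snd (qr (F n ** benettin_V F v (n - 1)))"

definition benettin_output ::
    "(real \<Rightarrow> real \<Rightarrow> 'n::{finite,linorder} sqmat) \<Rightarrow> (nat \<Rightarrow> real) \<Rightarrow> 'n tuple \<Rightarrow> nat \<Rightarrow> nat \<Rightarrow> real"
  where
  "benettin_output \<Phi> h v i n =
     1 / grid h n *
     (\<Sum>k=1..n. ln (benettin_R (step_matrix \<Phi> h) v k $ nth_index i $ nth_index i))"

end

theory Submission
  imports Defs "HOL-Library.Multiset"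
begin

text \<open>
  The sum of the first \<open>L\<close> outputs of Benettin's algorithm is, up to a bounded error divided by
  \<open>t\<^sub>n\<close>, the exponential growth rate of the \<open>L\<close>-volume spanned by the images of
  \<open>v\<^sub>1, \<dots>, v\<^sub>L\<close> under the numerical cocycle. For \<open>L = d\<^sub>1 + \<dots> + d\<^sub>l\<close>
  regularity makes the \<open>L\<close>-th exterior power of \<open>X(t)\<close> grow exactly like
  \<open>exp (t (d\<^sub>1 \<lambda>\<^sub>1 + \<dots> + d\<^sub>l \<lambda>\<^sub>l))\<close>. Strong fast invertibility allows the
  norms of exterior powers to be multiplied along the trajectory with only a bounded loss, so a
  telescoping sum shows that summable one-step errors change the norm of the exterior power by a
  bounded factor only. Finally, the tuples whose volume grows at a strictly smaller rate form a set
  that is a linear subspace in each vector separately, hence a null set.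
\<close>

section \<open>Alternating forms and volumes\<close>

text \<open>A limit superior appears in the statement because of the null set argument. Tuples whose
  volume obeys one bound \<open>K * exp (r * \<tau> n)\<close> for all \<open>n\<close> are closed
  under addition in each slot; tuples that are slow only along some subsequence need not be, since
  two summands may be slow along different subsequences. So for almost every tuple the full rate is
  known to be reached infinitely often, while the upper bound holds for every invertible tuple. The
  two perturbation bounds are not symmetric. Any finite accumulated error leaves the upper bound
  intact, but the lower bound needs a relative error below one. Finitely many initial steps are
  therefore split off; since they are invertible, this costs only a constant. Regularity supplies
  the lower growth bound of the exterior power: the determinant grows at the full sum of exponents,
  and the slow complementary directions can account only for their own share. Factors such as
  \<open>fact CARD('n)\<close> come from crude estimates and vanish in exponential rates.\<close>

text \<open>Exterior powers are handled through their duals: a form on families indexed by a type may use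
  only the slots in \<open>S\<close>, so that pulling back along a matrix is functorial without any
  Cauchy--Binet formula. Up to constants, \<open>wedge_norm S v\<close> is the volume spanned by
  the vectors \<open>v i\<close>, \<open>i \<in> S\<close>, and \<open>ext_norm S M\<close> is the norm of the
  exterior power of \<open>M\<close> of degree \<open>card S\<close>.\<close>

definition alternating_forms :: "'i set \<Rightarrow> (('i \<Rightarrow> real^'n) \<Rightarrow> real) set" where
  "alternating_forms S = {\<omega>.
     (\<forall>v w. (\<forall>i\<in>S. v i = w i) \<longrightarrow> \<omega> v = \<omega> w) \<and>
     (\<forall>v. \<forall>i\<in>S. linear (\<lambda>x. \<omega> (v(i := x)))) \<and>
     (\<forall>v. \<forall>i\<in>S. \<forall>j\<in>S. i \<noteq> j \<and> v i = v j \<longrightarrow> \<omega> v = 0)}"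

text \<open>The unit ball of the comass norm. The product of lengths is the easiest bound to verify;
  \<open>form_le_wedge_norm\<close> upgrades it to volumes.\<close>

definition unit_forms :: "'i set \<Rightarrow> (('i \<Rightarrow> real^'n) \<Rightarrow> real) set" where
  "unit_forms S = {\<omega> \<in> alternating_forms S. \<forall>v. \<bar>\<omega> v\<bar> \<le> (\<Prod>i\<in>S. norm (v i))}"

definition wedge_norm :: "'i set \<Rightarrow> ('i \<Rightarrow> real^'n) \<Rightarrow> real" where
  "wedge_norm S v = (SUP \<omega>\<in>unit_forms S. \<bar>\<omega> v\<bar>)"

definition ext_norm :: "'i set \<Rightarrow> real^'n^'n \<Rightarrow> real" where
  "ext_norm S M = (SUP v\<in>{v. \<forall>i. norm (v i) \<le> 1}. wedge_norm S (\<lambda>i. M *v v i))"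

lemma alternating_forms_cong:
  "\<omega> \<in> alternating_forms S \<Longrightarrow> (\<And>i. i \<in> S \<Longrightarrow> v i = w i) \<Longrightarrow> \<omega> v = \<omega> w"
  by (simp add: alternating_forms_def)

lemma alternating_forms_linear:
  "\<omega> \<in> alternating_forms S \<Longrightarrow> i \<in> S \<Longrightarrow> linear (\<lambda>x. \<omega> (v(i := x)))"
  by (simp add: alternating_forms_def)

lemma alternating_forms_eq_0:
  "\<omega> \<in> alternating_forms S \<Longrightarrow> \<not> inj_on v S \<Longrightarrow> \<omega> v = 0"
  unfolding alternating_forms_def inj_on_def by blast

lemma alternating_formsI:
  assumes "\<And>v w. (\<And>i. i \<in> S \<Longrightarrow> v i = w i) \<Longrightarrow> \<omega> v = \<omega> w"
    and "\<And>v i. i \<in> S \<Longrightarrow> linear (\<lambda>x. \<omega> (v(i := x)))"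
    and "\<And>v i j. i \<in> S \<Longrightarrow> j \<in> S \<Longrightarrow> i \<noteq> j \<Longrightarrow> v i = v j \<Longrightarrow> \<omega> v = 0"
  shows "\<omega> \<in> alternating_forms S"
  unfolding alternating_forms_def using assms by (intro CollectI conjI allI ballI impI) blast+

lemma fun_upd_apply_fun: "(\<lambda>i. g ((v(j := x)) i)) = (\<lambda>i. g (v i))(j := g x)"
  by auto

lemma alternating_forms_pullback:
  fixes M :: "real^'n^'n"
  assumes "\<omega> \<in> alternating_forms S"
  shows "(\<lambda>v. \<omega> (\<lambda>i. M *v v i)) \<in> alternating_forms S"
proof (rule alternating_formsI)
  fix v w :: "'a \<Rightarrow> real^'n" assume "\<And>i. i \<in> S \<Longrightarrow> v i = w i"
  then show "\<omega> (\<lambda>i. M *v v i) = \<omega> (\<lambda>i. M *v w i)"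
    by (intro alternating_forms_cong[OF assms]) auto
next
  fix v :: "'a \<Rightarrow> real^'n" and i assume i: "i \<in> S"
  have "linear ((\<lambda>x. \<omega> ((\<lambda>i. M *v v i)(i := x))) \<circ> (*v) M)"
    by (intro linear_compose matrix_vector_mul_linear alternating_forms_linear[OF assms i])
  then show "linear (\<lambda>x. \<omega> (\<lambda>j. M *v (v(i := x)) j))"
    by (simp add: o_def fun_upd_apply_fun del: fun_upd_apply)
next
  fix v :: "'a \<Rightarrow> real^'n" and i j assume "i \<in> S" "j \<in> S" "i \<noteq> j" "v i = v j"
  then have "\<not> inj_on (\<lambda>i. M *v v i) S" by (metis inj_onD)
  then show "\<omega> (\<lambda>i. M *v v i) = 0"
    by (rule alternating_forms_eq_0[OF assms])
qed

lemma alternating_forms_cmult: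
  assumes "\<omega> \<in> alternating_forms S"
  shows "(\<lambda>v. c * \<omega> v) \<in> alternating_forms S"
proof (rule alternating_formsI)
  show "linear (\<lambda>x. c * \<omega> (v(i := x)))" if "i \<in> S" for v i
    using linear_compose_scale_right[OF alternating_forms_linear[OF assms that], of c v] by simp
next
  show "c * \<omega> v = c * \<omega> w" if "\<And>i. i \<in> S \<Longrightarrow> v i = w i" for v w
    using that alternating_forms_cong[OF assms, of v w] by simp
next
  show "c * \<omega> v = 0" if "i \<in> S" "j \<in> S" "i \<noteq> j" "v i = v j" for v i j
  proof -
    have "\<not> inj_on v S" using that by (auto simp: inj_on_def)
    then show ?thesis using assms by (simp add: alternating_forms_eq_0)
  qed
qed

lemma alternating_forms_diff:
  assumes "\<omega> \<in> alternating_forms S" "\<eta> \<in> alternating_forms S"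
  shows "(\<lambda>v. \<omega> v - \<eta> v) \<in> alternating_forms S"
proof (rule alternating_formsI)
  show "linear (\<lambda>x. \<omega> (v(i := x)) - \<eta> (v(i := x)))" if "i \<in> S" for v i
    using assms that by (intro linear_compose_sub alternating_forms_linear)
next
  show "\<omega> v - \<eta> v = \<omega> w - \<eta> w" if "\<And>i. i \<in> S \<Longrightarrow> v i = w i" for v w
    using that alternating_forms_cong[OF assms(1), of v w] alternating_forms_cong[OF assms(2), of v w] by simp
next
  show "\<omega> v - \<eta> v = 0" if "i \<in> S" "j \<in> S" "i \<noteq> j" "v i = v j" for v i j
  proof -
    have "\<not> inj_on v S" using that by (auto simp: inj_on_def)
    then show ?thesis using assms by (simp add: alternating_forms_eq_0)
  qed
qed

lemma alternating_forms_scale: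
  fixes S :: "'i::finite set"
  assumes w: "\<omega> \<in> alternating_forms S"
  shows "\<omega> (\<lambda>i. c i *\<^sub>R v i) = (\<Prod>i\<in>S. c i) * \<omega> v"
proof -
  have "\<omega> (\<lambda>i. if i \<in> R then c i *\<^sub>R v i else v i) = (\<Prod>i\<in>R. c i) * \<omega> v" if "R \<subseteq> S" for R
    using finite_subset[OF that finite] that
  proof (induction R rule: finite_induct)
    case (insert j R)
    let ?u = "\<lambda>i. if i \<in> R then c i *\<^sub>R v i else v i"
    have "(\<lambda>i. if i \<in> insert j R then c i *\<^sub>R v i else v i) = ?u(j := c j *\<^sub>R ?u j)"
      using insert by auto
    then have "\<omega> (\<lambda>i. if i \<in> insert j R then c i *\<^sub>R v i else v i) = \<omega> (?u(j := c j *\<^sub>R ?u j))"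
      by (rule arg_cong)
    also have "\<dots> = c j *\<^sub>R \<omega> (?u(j := ?u j))"
      using insert.prems by (intro linear_cmul[OF alternating_forms_linear[OF w]]) auto
    also have "?u(j := ?u j) = ?u" by (auto simp: fun_eq_iff)
    also have "c j *\<^sub>R \<omega> ?u = c j * \<omega> ?u" by simp
    also have "\<dots> = c j * ((\<Prod>i\<in>R. c i) * \<omega> v)" by (subst insert.IH) (use insert.prems in auto)
    also have "\<dots> = (\<Prod>i\<in>insert j R. c i) * \<omega> v"
      using insert.hyps by simp
    finally show ?case .
  qed simp
  from this[of S] show ?thesis
    using alternating_forms_cong[OF w, of "\<lambda>i. if i \<in> S then c i *\<^sub>R v i else v i" "\<lambda>i. c i *\<^sub>R v i"] by simp
qed

text \<open>One factor of the sum is chosen in every slot. All choice functions occur, also the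
  non-injective ones; extensionality outside \<open>S\<close> makes each choice count exactly
  once.\<close>

lemma alternating_forms_expand:
  fixes S :: "'i::finite set" and b :: "'a \<Rightarrow> real^'n"
  assumes w: "\<omega> \<in> alternating_forms S" and A: "finite A"
  shows "\<omega> (\<lambda>i. \<Sum>a\<in>A. c i a *\<^sub>R b a)
     = (\<Sum>f\<in>S \<rightarrow>\<^sub>E A. (\<Prod>i\<in>S. c i (f i)) * \<omega> (\<lambda>i. b (f i)))"
proof -
  \<comment> \<open>The slots outside \<open>R\<close> hold an arbitrary family \<open>v\<close>, so
    that in the induction step the basis vector chosen for slot \<open>j\<close> can be stored in
    \<open>v(j := b a)\<close>.\<close>
  have "\<omega> (\<lambda>i. if i \<in> R then \<Sum>a\<in>A. c i a *\<^sub>R b a else v i)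
      = (\<Sum>f\<in>R \<rightarrow>\<^sub>E A. (\<Prod>i\<in>R. c i (f i)) * \<omega> (\<lambda>i. if i \<in> R then b (f i) else v i))"
    if "R \<subseteq> S" for R v
    using finite_subset[OF that finite] that
  proof (induction R arbitrary: v rule: finite_induct)
    case (insert j R)
    let ?F = "\<lambda>v i. if i \<in> R then \<Sum>a\<in>A. c i a *\<^sub>R b a else v i"
    have "(\<lambda>i. if i \<in> insert j R then \<Sum>a\<in>A. c i a *\<^sub>R b a else v i) =
       (?F v)(j := (\<Sum>a\<in>A. c j a *\<^sub>R b a))" using insert by auto
    then have "\<omega> (\<lambda>i. if i \<in> insert j R then \<Sum>a\<in>A. c i a *\<^sub>R b a else v i) =
       \<omega> ((?F v)(j := (\<Sum>a\<in>A. c j a *\<^sub>R b a)))" by (rule arg_cong)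
    also have "\<dots> = (\<Sum>a\<in>A. \<omega> ((?F v)(j := c j a *\<^sub>R b a)))"
      using insert.prems by (intro linear_sum[OF alternating_forms_linear[OF w]]) auto
    also have "\<dots> = (\<Sum>a\<in>A. c j a *\<^sub>R \<omega> ((?F v)(j := b a)))"
      using insert.prems by (intro sum.cong refl linear_cmul[OF alternating_forms_linear[OF w]]) auto
    also have "\<dots> = (\<Sum>a\<in>A. c j a * \<omega> ((?F v)(j := b a)))"
      by (simp only: real_scaleR_def)
    also have "\<dots> = (\<Sum>a\<in>A. c j a * \<omega> (?F (v(j := b a))))"
    proof -
      have "(?F v)(j := b a) = ?F (v(j := b a))" for a using insert by auto
      then show ?thesis by simp
    qed
    also have "\<dots> = (\<Sum>a\<in>A. c j a * (\<Sum>f\<in>R \<rightarrow>\<^sub>E A. (\<Prod>i\<in>R. c i (f i)) *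
         \<omega> (\<lambda>i. if i \<in> R then b (f i) else (v(j := b a)) i)))"
      using insert by simp
    also have "\<dots> = (\<Sum>(a,f)\<in>A \<times> (R \<rightarrow>\<^sub>E A). c j a * ((\<Prod>i\<in>R. c i (f i)) *
         \<omega> (\<lambda>i. if i \<in> R then b (f i) else (v(j := b a)) i)))"
      by (simp add: sum_distrib_left sum.cartesian_product)
    also have "\<dots> = (\<Sum>(a,f)\<in>A \<times> (R \<rightarrow>\<^sub>E A). (\<Prod>i\<in>insert j R. c i ((f(j := a)) i)) *
         \<omega> (\<lambda>i. if i \<in> insert j R then b ((f(j := a)) i) else v i))"
    proof (rule sum.cong[OF refl], clarify)
      fix a f
      have "(\<Prod>i\<in>R. c i ((f(j := a)) i)) = (\<Prod>i\<in>R. c i (f i))"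
        using insert by (intro prod.cong) auto
      moreover have "(\<lambda>i. if i \<in> insert j R then b ((f(j := a)) i) else v i) =
        (\<lambda>i. if i \<in> R then b (f i) else (v(j := b a)) i)" using insert by auto
      ultimately show "c j a * ((\<Prod>i\<in>R. c i (f i)) *
         \<omega> (\<lambda>i. if i \<in> R then b (f i) else (v(j := b a)) i)) = (\<Prod>i\<in>insert j R. c i ((f(j := a)) i)) *
         \<omega> (\<lambda>i. if i \<in> insert j R then b ((f(j := a)) i) else v i)"
        using insert by simp
    qed
    also have "\<dots> = (\<Sum>f\<in>insert j R \<rightarrow>\<^sub>E A. (\<Prod>i\<in>insert j R. c i (f i)) *
         \<omega> (\<lambda>i. if i \<in> insert j R then b (f i) else v i))"
      unfolding PiE_insert_eq using insert
      by (subst sum.reindex[OF inj_combinator]) (auto simp: case_prod_unfold o_def)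
    finally show ?case .
  qed (simp add: PiE_empty_domain)
  from this[of S "\<lambda>_. 0"] show ?thesis
    using alternating_forms_cong[OF w, of "\<lambda>i. if i \<in> S then \<Sum>a\<in>A. c i a *\<^sub>R b a else 0" "\<lambda>i. \<Sum>a\<in>A. c i a *\<^sub>R b a"]
      alternating_forms_cong[OF w, of "\<lambda>i. if i \<in> S then b (f i) else 0" "\<lambda>i. b (f i)" for f]
    by simp
qed

section \<open>Volumes of families and norms of exterior powers\<close>

lemma unit_formsD:
  assumes "\<omega> \<in> unit_forms S"
  shows "\<omega> \<in> alternating_forms S" "\<bar>\<omega> v\<bar> \<le> (\<Prod>i\<in>S. norm (v i))"
  using assms by (auto simp: unit_forms_def)

lemma zero_unit_form: "(\<lambda>_. 0) \<in> unit_forms S"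
  by (auto simp: unit_forms_def alternating_forms_def linear_zero prod_nonneg)

lemma unit_form_le_wedge_norm: "\<omega> \<in> unit_forms S \<Longrightarrow> \<bar>\<omega> v\<bar> \<le> wedge_norm S v"
  unfolding wedge_norm_def by (intro cSUP_upper bdd_aboveI2[where M = "\<Prod>i\<in>S. norm (v i)"] unit_formsD(2))

lemma wedge_norm_le: "(\<And>\<omega>. \<omega> \<in> unit_forms S \<Longrightarrow> \<bar>\<omega> v\<bar> \<le> c) \<Longrightarrow> wedge_norm S v \<le> c"
  unfolding wedge_norm_def using zero_unit_form by (intro cSUP_least) auto

lemma wedge_norm_nonneg: "0 \<le> wedge_norm S v"
  using unit_form_le_wedge_norm[OF zero_unit_form] by (metis abs_zero)

lemma wedge_norm_le_prod_norm: "wedge_norm S v \<le> (\<Prod>i\<in>S. norm (v i))"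
  by (intro wedge_norm_le unit_formsD)

lemma wedge_norm_le_iff: "wedge_norm S v \<le> c \<longleftrightarrow> (\<forall>\<omega>\<in>unit_forms S. \<bar>\<omega> v\<bar> \<le> c)"
  by (auto intro: wedge_norm_le order_trans[OF unit_form_le_wedge_norm])

lemma wedge_norm_eq_0: "\<not> inj_on v S \<Longrightarrow> wedge_norm S v = 0"
  by (intro antisym wedge_norm_nonneg wedge_norm_le)
     (simp add: alternating_forms_eq_0[OF unit_formsD(1)])

lemma wedge_norm_cong: "(\<And>i. i \<in> S \<Longrightarrow> v i = w i) \<Longrightarrow> wedge_norm S v = wedge_norm S w"
  unfolding wedge_norm_def
  by (intro SUP_cong refl arg_cong[where f = abs], rule alternating_forms_cong[OF unit_formsD(1)])

lemma wedge_norm_upd_add: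
  fixes v :: "'i \<Rightarrow> real^'n"
  assumes "i \<in> S"
  shows "wedge_norm S (v(i := x + y)) \<le> wedge_norm S (v(i := x)) + wedge_norm S (v(i := y))"
proof (rule wedge_norm_le)
  fix \<omega> :: "('i \<Rightarrow> real^'n) \<Rightarrow> real" assume w: "\<omega> \<in> unit_forms S"
  have "\<omega> (v(i := x + y)) = \<omega> (v(i := x)) + \<omega> (v(i := y))"
    by (rule linear_add[OF alternating_forms_linear[OF unit_formsD(1)[OF w] assms]])
  then show "\<bar>\<omega> (v(i := x + y))\<bar> \<le> wedge_norm S (v(i := x)) + wedge_norm S (v(i := y))"
    using unit_form_le_wedge_norm[OF w, of "v(i := x)"] unit_form_le_wedge_norm[OF w, of "v(i := y)"]
    by linarith
qed

lemma wedge_norm_upd_scaleR: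
  fixes v :: "'i \<Rightarrow> real^'n"
  assumes "i \<in> S"
  shows "wedge_norm S (v(i := c *\<^sub>R x)) \<le> \<bar>c\<bar> * wedge_norm S (v(i := x))"
proof (rule wedge_norm_le)
  fix \<omega> :: "('i \<Rightarrow> real^'n) \<Rightarrow> real" assume w: "\<omega> \<in> unit_forms S"
  have "\<omega> (v(i := c *\<^sub>R x)) = c *\<^sub>R \<omega> (v(i := x))"
    by (rule linear_cmul[OF alternating_forms_linear[OF unit_formsD(1)[OF w] assms]])
  then show "\<bar>\<omega> (v(i := c *\<^sub>R x))\<bar> \<le> \<bar>c\<bar> * wedge_norm S (v(i := x))"
    using unit_form_le_wedge_norm[OF w, of "v(i := x)"]
    by (simp add: abs_mult mult_left_mono)
qed

text \<open>Dividing by \<open>c\<close> produces a unit form, so an estimate by products of lengths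
  improves at no cost to an estimate by the spanned volume.\<close>

lemma form_le_wedge_norm:
  assumes w: "\<omega> \<in> alternating_forms S" and c: "0 \<le> c"
    and le: "\<And>v. \<bar>\<omega> v\<bar> \<le> c * (\<Prod>i\<in>S. norm (v i))"
  shows "\<bar>\<omega> v\<bar> \<le> c * wedge_norm S v"
proof (cases "c = 0")
  case True then show ?thesis using le[of v] by simp
next
  case False
  then have "(\<lambda>v. inverse c * \<omega> v) \<in> unit_forms S"
    using alternating_forms_cmult[OF w, of "inverse c"] c le
    by (auto simp: unit_forms_def abs_mult field_simps)
  from unit_form_le_wedge_norm[OF this, of v] show ?thesis
    using c False by (simp add: abs_mult field_simps)
qed

lemma norm_matrix_le_onorm: "norm (M *v x) \<le> onorm ((*v) M) * norm x"
  for M :: "real^'n^'n"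
  by (rule onorm) (rule matrix_vector_mul_bounded_linear)

lemma wedge_norm_image_le_onorm:
  fixes M :: "real^'n^'n" and S :: "'i::finite set"
  shows "wedge_norm S (\<lambda>i. M *v v i) \<le> onorm ((*v) M) ^ card S * (\<Prod>i\<in>S. norm (v i))"
proof -
  have "wedge_norm S (\<lambda>i. M *v v i) \<le> (\<Prod>i\<in>S. norm (M *v v i))"
    by (rule wedge_norm_le_prod_norm)
  also have "\<dots> \<le> (\<Prod>i\<in>S. onorm ((*v) M) * norm (v i))"
    by (intro prod_mono conjI norm_ge_zero norm_matrix_le_onorm)
  also have "\<dots> = onorm ((*v) M) ^ card S * (\<Prod>i\<in>S. norm (v i))"
    by (simp add: prod.distrib)
  finally show ?thesis .
qed

lemma onorm_matrix_nonneg: "0 \<le> onorm ((*v) M)" for M :: "real^'n^'n"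
  by (rule onorm_pos_le) (rule matrix_vector_mul_bounded_linear)

lemma wedge_norm_image_unit_le:
  fixes M :: "real^'n^'n" and S :: "'i::finite set"
  assumes "\<And>i. norm (v i) \<le> 1"
  shows "wedge_norm S (\<lambda>i. M *v v i) \<le> onorm ((*v) M) ^ card S"
proof -
  have "(\<Prod>i\<in>S. norm (v i)) \<le> 1" using assms by (intro prod_le_1) auto
  then have "onorm ((*v) M) ^ card S * (\<Prod>i\<in>S. norm (v i)) \<le> onorm ((*v) M) ^ card S"
    using onorm_matrix_nonneg[of M] by (intro mult_left_le) auto
  then show ?thesis using wedge_norm_image_le_onorm[of S M v] by linarith
qed

lemma ext_norm_le_onorm:
  fixes M :: "real^'n^'n" and S :: "'i::finite set"
  shows "ext_norm S M \<le> onorm ((*v) M) ^ card S"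
  unfolding ext_norm_def
  by (intro cSUP_least) (auto intro: wedge_norm_image_unit_le exI[of _ "\<lambda>_. 0"])

lemma wedge_norm_image_unit_le_ext_norm:
  fixes M :: "real^'n^'n" and S :: "'i::finite set"
  assumes "\<And>i. norm (v i) \<le> 1"
  shows "wedge_norm S (\<lambda>i. M *v v i) \<le> ext_norm S M"
  unfolding ext_norm_def using assms wedge_norm_image_unit_le
  by (intro cSUP_upper bdd_aboveI2[where M = "onorm ((*v) M) ^ card S"]) auto

lemma ext_norm_nonneg: "0 \<le> ext_norm S M" for M :: "real^'n^'n" and S :: "'i::finite set"
  using wedge_norm_image_unit_le_ext_norm[of "\<lambda>_. 0" S M] wedge_norm_nonneg[of S "\<lambda>i. M *v 0"] by simp

lemma ext_norm_leI:
  fixes M :: "real^'n^'n" and S :: "'i::finite set"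
  assumes "\<And>\<omega> v. \<omega> \<in> unit_forms S \<Longrightarrow> (\<And>i. norm (v i) \<le> 1) \<Longrightarrow> \<bar>\<omega> (\<lambda>i. M *v v i)\<bar> \<le> c"
  shows "ext_norm S M \<le> c"
  unfolding ext_norm_def using assms
  by (intro cSUP_least wedge_norm_le) (auto intro: exI[of _ "\<lambda>_. 0"])

lemma form_image_le_ext_norm:
  fixes M :: "real^'n^'n" and S :: "'i::finite set"
  assumes w: "\<omega> \<in> unit_forms S"
  shows "\<bar>\<omega> (\<lambda>i. M *v v i)\<bar> \<le> ext_norm S M * (\<Prod>i\<in>S. norm (v i))"
proof -
  \<comment> \<open>For \<open>v i = 0\<close> the convention for division by zero gives
    \<open>?u i = 0\<close>, so the rescaling works for zero vectors too.\<close>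
  let ?u = "\<lambda>i. v i /\<^sub>R norm (v i)"
  have "\<omega> (\<lambda>i. M *v v i) = \<omega> (\<lambda>i. norm (v i) *\<^sub>R (M *v ?u i))"
  proof -
    have "M *v v i = norm (v i) *\<^sub>R (M *v ?u i)" for i
      by (cases "v i = 0") (simp_all add: matrix_vector_mult_scaleR)
    then show ?thesis by simp
  qed
  also have "\<dots> = (\<Prod>i\<in>S. norm (v i)) * \<omega> (\<lambda>i. M *v ?u i)"
    by (rule alternating_forms_scale[OF unit_formsD(1)[OF w]])
  finally have eq: "\<omega> (\<lambda>i. M *v v i) = (\<Prod>i\<in>S. norm (v i)) * \<omega> (\<lambda>i. M *v ?u i)" .
  have u: "norm (?u i) \<le> 1" for i by (cases "v i = 0") auto
  have "\<bar>\<omega> (\<lambda>i. M *v ?u i)\<bar> \<le> ext_norm S M"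
    by (rule order_trans[OF unit_form_le_wedge_norm[OF w] wedge_norm_image_unit_le_ext_norm[OF u]])
  then have "\<bar>\<omega> (\<lambda>i. M *v ?u i)\<bar> * (\<Prod>i\<in>S. norm (v i)) \<le> ext_norm S M * (\<Prod>i\<in>S. norm (v i))"
    by (intro mult_right_mono prod_nonneg) auto
  then show ?thesis unfolding eq by (simp add: abs_mult prod_nonneg mult.commute)
qed

text \<open>The pullback of a unit form along \<open>M\<close> is bounded by
  \<open>ext_norm S M\<close> times the product of lengths, and \<open>form_le_wedge_norm\<close>
  replaces that product by the volume. Submultiplicativity of \<open>ext_norm\<close> rests on
  this.\<close>

lemma wedge_norm_image_le:
  fixes M :: "real^'n^'n" and S :: "'i::finite set"
  shows "wedge_norm S (\<lambda>i. M *v v i) \<le> ext_norm S M * wedge_norm S v"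
  by (intro wedge_norm_le form_le_wedge_norm[OF alternating_forms_pullback[OF unit_formsD(1)]]
      ext_norm_nonneg form_image_le_ext_norm)

lemma wedge_norm_image_le_prod:
  fixes M :: "real^'n^'n" and S :: "'i::finite set"
  shows "wedge_norm S (\<lambda>i. M *v v i) \<le> ext_norm S M * (\<Prod>i\<in>S. norm (v i))"
  by (intro wedge_norm_le form_image_le_ext_norm)

lemma ext_norm_mult:
  fixes M N :: "real^'n^'n" and S :: "'i::finite set"
  shows "ext_norm S (M ** N) \<le> ext_norm S M * ext_norm S N"
proof (rule ext_norm_leI)
  fix \<omega> :: "('i \<Rightarrow> real^'n) \<Rightarrow> real" and v :: "'i \<Rightarrow> real^'n"
  assume w: "\<omega> \<in> unit_forms S" and v: "\<And>i. norm (v i) \<le> 1"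
  have "\<bar>\<omega> (\<lambda>i. (M ** N) *v v i)\<bar> = \<bar>\<omega> (\<lambda>i. M *v (N *v v i))\<bar>"
    by (simp only: matrix_vector_mul_assoc)
  also have "\<dots> \<le> wedge_norm S (\<lambda>i. M *v (N *v v i))" by (rule unit_form_le_wedge_norm[OF w])
  also have "\<dots> \<le> ext_norm S M * wedge_norm S (\<lambda>i. N *v v i)" by (rule wedge_norm_image_le)
  also have "\<dots> \<le> ext_norm S M * ext_norm S N"
    by (intro mult_left_mono wedge_norm_image_unit_le_ext_norm v ext_norm_nonneg)
  finally show "\<bar>\<omega> (\<lambda>i. (M ** N) *v v i)\<bar> \<le> ext_norm S M * ext_norm S N" .
qed

section \<open>Determinants as alternating forms, and spanning families\<close>

lemma linear_det_upd:
  fixes v :: "'n \<Rightarrow> real^'n"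
  shows "linear (\<lambda>x. det (\<chi> i. (v(k := x)) i))"
proof (rule linearI)
  fix x y :: "real^'n" and c :: real
  have "(\<chi> i. (v(k := z)) i) = (\<chi> i. if i = k then z else v i)" for z by simp
  then show "det (\<chi> i. (v(k := x + y)) i) = det (\<chi> i. (v(k := x)) i) + det (\<chi> i. (v(k := y)) i)"
    and "det (\<chi> i. (v(k := c *\<^sub>R x)) i) = c *\<^sub>R det (\<chi> i. (v(k := x)) i)"
    using det_row_add[of k "\<lambda>_. x" "\<lambda>_. y" v] det_row_mul[of k c "\<lambda>_. x" v]
    by (simp_all add: scalar_mult_eq_scaleR[symmetric])
qed

text \<open>Each of the \<open>fact CARD('n)\<close> Leibniz terms is at most the product of the row
  lengths. Hadamard's inequality would give the constant 1, which makes no difference to exponential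
  rates.\<close>

lemma abs_det_le:
  fixes v :: "'n \<Rightarrow> real^'n"
  shows "\<bar>det (\<chi> i. v i)\<bar> \<le> fact CARD('n) * (\<Prod>i\<in>UNIV. norm (v i))"
proof -
  have "\<bar>det (\<chi> i. v i)\<bar> \<le> (\<Sum>p\<in>{p. p permutes (UNIV::'n set)}. \<bar>of_int (sign p) * (\<Prod>i\<in>UNIV. v i $ p i)\<bar>)"
    unfolding det_def by (simp add: sum_abs)
  also have "\<dots> \<le> (\<Sum>p\<in>{p. p permutes (UNIV::'n set)}. (\<Prod>i\<in>UNIV. norm (v i)))"
  proof (rule sum_mono)
    fix p :: "'n \<Rightarrow> 'n"
    have "\<bar>of_int (sign p) * (\<Prod>i\<in>UNIV. v i $ p i)\<bar> = (\<Prod>i\<in>UNIV. \<bar>v i $ p i\<bar>)"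
      by (simp add: abs_mult abs_prod sign_def)
    also have "\<dots> \<le> (\<Prod>i\<in>UNIV. norm (v i))"
      by (intro prod_mono) (auto simp: component_le_norm_cart)
    finally show "\<bar>of_int (sign p) * (\<Prod>i\<in>UNIV. v i $ p i)\<bar> \<le> (\<Prod>i\<in>UNIV. norm (v i))" .
  qed
  also have "\<dots> = fact CARD('n) * (\<Prod>i\<in>UNIV. norm (v i))"
    by (simp add: card_permutations)
  finally show ?thesis .
qed

text \<open>Freezing the rows outside \<open>S\<close> turns the determinant into a form of degree
  \<open>card S\<close>.\<close>

lemma det_alternating_form:
  fixes w :: "'n \<Rightarrow> real^'n"
  shows "(\<lambda>v. det (\<chi> i. if i \<in> S then v i else w i)) \<in> alternating_forms S"
proof (rule alternating_formsI)
  show "det (\<chi> i. if i \<in> S then v i else w i) = det (\<chi> i. if i \<in> S then u i else w i)"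
    if "\<And>i. i \<in> S \<Longrightarrow> v i = u i" for v u
    using that by (intro arg_cong[where f = det]) (simp add: vec_eq_iff)
  show "linear (\<lambda>x. det (\<chi> i. if i \<in> S then (v(k := x)) i else w i))" if "k \<in> S" for v k
  proof -
    have "(\<lambda>i. if i \<in> S then (v(k := x)) i else w i) = (\<lambda>i. if i \<in> S then v i else w i)(k := x)" for x
      using that by (auto simp: fun_eq_iff)
    then show ?thesis by (simp only: linear_det_upd)
  qed
  show "det (\<chi> i. if i \<in> S then v i else w i) = 0"
    if "i \<in> S" "j \<in> S" "i \<noteq> j" "v i = v j" for v i j
    by (rule det_identical_rows[OF \<open>i \<noteq> j\<close>]) (use that in \<open>simp add: row_def vec_eq_iff\<close>)
qed

text \<open>As a form in the rows of \<open>S\<close>, the determinant is bounded by a multiple of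
  the product of their lengths, hence by the same multiple of their volume. This is Fischer's
  inequality up to a constant.\<close>

lemma det_le_wedge_norm:
  fixes v :: "'n \<Rightarrow> real^'n"
  shows "\<bar>det (\<chi> i. v i)\<bar> \<le> fact CARD('n) * (\<Prod>i\<in>-S. norm (v i)) * wedge_norm S v"
proof -
  have "\<bar>det (\<chi> i. if i \<in> S then v i else v i)\<bar> \<le> fact CARD('n) * (\<Prod>i\<in>-S. norm (v i)) * wedge_norm S v"
  proof (rule form_le_wedge_norm[OF det_alternating_form[of S v], of _ v])
    fix u :: "'n \<Rightarrow> real^'n"
    have "(\<Prod>i\<in>UNIV. norm (if i \<in> S then u i else v i)) = (\<Prod>i\<in>S. norm (u i)) * (\<Prod>i\<in>-S. norm (v i))"
      by (simp add: if_distrib[of norm] prod.If_cases)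
    then show "\<bar>det (\<chi> i. if i \<in> S then u i else v i)\<bar>
        \<le> fact CARD('n) * (\<Prod>i\<in>-S. norm (v i)) * (\<Prod>i\<in>S. norm (u i))"
      using abs_det_le[of "\<lambda>i. if i \<in> S then u i else v i"] by (simp add: mult_ac)
  qed (simp add: prod_nonneg)
  then show ?thesis by simp
qed

text \<open>Serves as a lower bound for \<open>ext_norm\<close>: a large determinant together with
  short images of the complementary vectors forces the exterior power to be large.\<close>

lemma det_le_ext_norm:
  fixes M :: "real^'n^'n" and b :: "'n \<Rightarrow> real^'n"
  shows "\<bar>det (\<chi> i. M *v b i)\<bar>
    \<le> fact CARD('n) * (\<Prod>i\<in>-S. norm (M *v b i)) * (ext_norm S M * (\<Prod>i\<in>S. norm (b i)))"
  by (rule order_trans[OF det_le_wedge_norm[where S = S]])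
    (intro mult_left_mono wedge_norm_image_le_prod mult_nonneg_nonneg prod_nonneg, auto)

lemma wedge_norm_image_le_sum:
  fixes M :: "real^'n^'n" and S :: "'i::finite set" and b :: "'a::finite \<Rightarrow> real^'n"
  assumes v: "\<And>i. v i = (\<Sum>a\<in>UNIV. c i a *\<^sub>R b a)" and c: "\<And>i a. \<bar>c i a\<bar> \<le> K"
  shows "wedge_norm S (\<lambda>i. M *v v i) \<le> K ^ card S * (\<Sum>f\<in>S \<rightarrow>\<^sub>E UNIV. wedge_norm S (\<lambda>i. M *v b (f i)))"
proof (rule wedge_norm_le)
  fix \<omega> :: "('i \<Rightarrow> real^'n) \<Rightarrow> real" assume w: "\<omega> \<in> unit_forms S"
  have "(\<lambda>i. M *v v i) = (\<lambda>i. \<Sum>a\<in>UNIV. c i a *\<^sub>R (M *v b a))"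
    by (simp add: v matrix_vector_mult_scaleR fun_eq_iff linear_sum[OF matrix_vector_mul_linear])
  then have "\<omega> (\<lambda>i. M *v v i) = (\<Sum>f\<in>S \<rightarrow>\<^sub>E UNIV. (\<Prod>i\<in>S. c i (f i)) * \<omega> (\<lambda>i. M *v b (f i)))"
    by (simp only: alternating_forms_expand[OF unit_formsD(1)[OF w] finite])
  also have "\<bar>\<dots>\<bar> \<le> (\<Sum>f\<in>S \<rightarrow>\<^sub>E UNIV. K ^ card S * wedge_norm S (\<lambda>i. M *v b (f i)))"
  proof (rule order_trans[OF sum_abs sum_mono])
    fix f :: "'i \<Rightarrow> 'a"
    have "\<bar>\<Prod>i\<in>S. c i (f i)\<bar> \<le> (\<Prod>i\<in>S. K)"
      unfolding abs_prod using c by (intro prod_mono) auto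
    then show "\<bar>(\<Prod>i\<in>S. c i (f i)) * \<omega> (\<lambda>i. M *v b (f i))\<bar> \<le> K ^ card S * wedge_norm S (\<lambda>i. M *v b (f i))"
      unfolding abs_mult using unit_form_le_wedge_norm[OF w]
      by (intro mult_mono) auto
  qed
  finally show "\<bar>\<omega> (\<lambda>i. M *v v i)\<bar> \<le> K ^ card S * (\<Sum>f\<in>S \<rightarrow>\<^sub>E UNIV. wedge_norm S (\<lambda>i. M *v b (f i)))"
    by (simp add: sum_distrib_left)
qed

text \<open>The matching upper bound: multilinear expansion in \<open>b\<close> leaves only the
  finitely many families drawn from \<open>b\<close>, at the price of one coefficient bound
  \<open>K\<close> per slot.\<close>

lemma ext_norm_le_sum:
  fixes M :: "real^'n^'n" and S :: "'i::finite set" and b :: "'a::finite \<Rightarrow> real^'n"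
  assumes "\<And>x. norm x \<le> 1 \<Longrightarrow> \<exists>c. x = (\<Sum>a\<in>UNIV. c a *\<^sub>R b a) \<and> (\<forall>a. \<bar>c a\<bar> \<le> K)"
  shows "ext_norm S M \<le> K ^ card S * (\<Sum>f\<in>S \<rightarrow>\<^sub>E UNIV. wedge_norm S (\<lambda>i. M *v b (f i)))"
proof (rule ext_norm_leI)
  fix \<omega> :: "('i \<Rightarrow> real^'n) \<Rightarrow> real" and v :: "'i \<Rightarrow> real^'n"
  assume w: "\<omega> \<in> unit_forms S" and v: "\<And>i. norm (v i) \<le> 1"
  obtain c where c: "\<And>i. v i = (\<Sum>a\<in>UNIV. c i a *\<^sub>R b a)" "\<And>i a. \<bar>c i a\<bar> \<le> K"
    using assms[OF v] by metis
  show "\<bar>\<omega> (\<lambda>i. M *v v i)\<bar> \<le> K ^ card S * (\<Sum>f\<in>S \<rightarrow>\<^sub>E UNIV. wedge_norm S (\<lambda>i. M *v b (f i)))"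
    by (rule order_trans[OF unit_form_le_wedge_norm[OF w] wedge_norm_image_le_sum[OF c]])
qed

text \<open>The slots are switched from \<open>P\<close> to \<open>T\<close> one at a time. Each
  switch contributes one factor \<open>e\<close> and \<open>card S - 1\<close> factors
  \<open>a\<close>; the assumption \<open>1 \<le> a\<close> permits rounding the exponent up to
  \<open>card S\<close>.\<close>

lemma abs_form_image_diff_le:
  fixes T P :: "real^'n^'n" and S :: "'i::finite set" and a e :: real
  assumes w: "\<omega> \<in> unit_forms S" and T: "onorm ((*v) T) \<le> a" and P: "onorm ((*v) P) \<le> a"
    and TP: "onorm ((*v) (T - P)) \<le> e" and a: "1 \<le> a"
  shows "\<bar>\<omega> (\<lambda>i. T *v u i) - \<omega> (\<lambda>i. P *v u i)\<bar> \<le> card S * a ^ card S * e * (\<Prod>i\<in>S. norm (u i))"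
proof -
  let ?h = "\<lambda>R i. if i \<in> R then T *v u i else P *v u i"
  note alt = unit_formsD(1)[OF w]
  have e0: "0 \<le> e" using onorm_matrix_nonneg[of "T - P"] TP by linarith
  have Tn: "norm (T *v x) \<le> a * norm x" for x
    using norm_matrix_le_onorm[of T x] mult_right_mono[OF T norm_ge_zero[of x]] by linarith
  have Pn: "norm (P *v x) \<le> a * norm x" for x
    using norm_matrix_le_onorm[of P x] mult_right_mono[OF P norm_ge_zero[of x]] by linarith
  have TPn: "norm ((T - P) *v x) \<le> e * norm x" for x
    using norm_matrix_le_onorm[of "T - P" x] mult_right_mono[OF TP norm_ge_zero[of x]] by linarith
  have "\<bar>\<omega> (?h R) - \<omega> (?h {})\<bar> \<le> card R * a ^ card S * e * (\<Prod>i\<in>S. norm (u i))"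
    if "R \<subseteq> S" for R
    using finite_subset[OF that finite] that
  proof (induction R rule: finite_induct)
    case (insert j R)
    have j: "j \<in> S" using insert by auto
    have 1: "?h (insert j R) = (?h R)(j := T *v u j)" by (auto simp: fun_eq_iff)
    have 2: "?h R = (?h R)(j := P *v u j)" using insert by (auto simp: fun_eq_iff)
    have "\<omega> (?h (insert j R)) - \<omega> (?h R) = \<omega> ((?h R)(j := T *v u j)) - \<omega> ((?h R)(j := P *v u j))"
      by (simp only: 1 flip: 2)
    also have "\<dots> = \<omega> ((?h R)(j := (T - P) *v u j))"
      unfolding matrix_vector_mult_diff_rdistrib
      by (rule linear_diff[OF alternating_forms_linear[OF alt j], symmetric])
    finally have "\<bar>\<omega> (?h (insert j R)) - \<omega> (?h R)\<bar> = \<bar>\<omega> ((?h R)(j := (T - P) *v u j))\<bar>"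
      by (rule arg_cong)
    also have "\<dots> \<le> (\<Prod>i\<in>S. norm (((?h R)(j := (T - P) *v u j)) i))"
      by (rule unit_formsD(2)[OF w])
    also have "\<dots> = norm ((T - P) *v u j) * (\<Prod>i\<in>S - {j}. norm (?h R i))"
      using j by (subst prod.remove[of S j]) (auto intro!: prod.cong)
    also have "\<dots> \<le> (e * norm (u j)) * (\<Prod>i\<in>S - {j}. a * norm (u i))"
      using e0 Tn Pn TPn by (intro mult_mono prod_mono prod_nonneg mult_nonneg_nonneg) auto
    also have "\<dots> = a ^ (card S - 1) * (e * (\<Prod>i\<in>S. norm (u i)))"
      using j by (subst prod.remove[of S j]) (auto simp: prod.distrib)
    also have "\<dots> \<le> a ^ card S * (e * (\<Prod>i\<in>S. norm (u i)))"
      using a e0 by (intro mult_right_mono power_increasing mult_nonneg_nonneg prod_nonneg) auto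
    finally show ?case using insert by (simp add: algebra_simps)
  qed simp
  from this[of S] have "\<bar>\<omega> (?h S) - \<omega> (\<lambda>i. P *v u i)\<bar> \<le> card S * a ^ card S * e * (\<Prod>i\<in>S. norm (u i))"
    by simp
  moreover have "\<omega> (?h S) = \<omega> (\<lambda>i. T *v u i)" by (rule alternating_forms_cong[OF alt]) simp
  ultimately show ?thesis by simp
qed

section \<open>Perturbed products\<close>

lemma unit_form_of_bounded_form:
  assumes w: "\<omega> \<in> alternating_forms S" and g: "0 \<le> g"
    and le: "\<And>v. \<bar>\<omega> v\<bar> \<le> g * (\<Prod>i\<in>S. norm (v i))"
  obtains \<eta> where "\<eta> \<in> unit_forms S" "\<And>v. \<omega> v = g * \<eta> v"
proof (cases "g = 0")
  case True
  show ?thesis by (rule that[OF zero_unit_form]) (use le True in auto)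
next
  case False
  have "(\<lambda>v. inverse g * \<omega> v) \<in> unit_forms S"
    using alternating_forms_cmult[OF w, of "inverse g"] g le False
    by (auto simp: unit_forms_def abs_mult field_simps)
  then show ?thesis by (rule that) (use False in auto)
qed

text \<open>Telescoping over the hybrid products \<open>U n k ** Y k\<close>; the error made at step \<open>k\<close> is
  measured by the volume of the already perturbed vectors, which the induction hypothesis controls.\<close>

lemma form_perturbed_product_le:
  fixes U :: "nat \<Rightarrow> nat \<Rightarrow> real^'n^'n" and P T Y :: "nat \<Rightarrow> real^'n^'n" and S :: "'i::finite set"
    and e :: "nat \<Rightarrow> real" and C :: real
  assumes U1: "\<And>n. U n n = mat 1"
    and UP: "\<And>n k. k < n \<Longrightarrow> U n k = U n (Suc k) ** P (Suc k)"
    and Y0: "Y 0 = mat 1" and YS: "\<And>n. Y (Suc n) = T (Suc n) ** Y n"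
    and diff: "\<And>\<omega> k u. \<omega> \<in> unit_forms S \<Longrightarrow>
      \<bar>\<omega> (\<lambda>i. T (Suc k) *v u i) - \<omega> (\<lambda>i. P (Suc k) *v u i)\<bar> \<le> e (Suc k) * (\<Prod>i\<in>S. norm (u i))"
    and e: "\<And>k. 0 \<le> e k" and C0: "0 \<le> C"
    and C: "\<And>n k. k < n \<Longrightarrow> ext_norm S (U n (Suc k)) * ext_norm S (U k 0) \<le> C * ext_norm S (U n 0)"
    and w: "\<omega> \<in> unit_forms S" and v: "\<And>i. norm (v i) \<le> 1"
  shows "\<bar>\<omega> (\<lambda>i. Y n *v v i) - \<omega> (\<lambda>i. U n 0 *v v i)\<bar>
    \<le> ((\<Prod>k<n. 1 + C * e (Suc k)) - 1) * ext_norm S (U n 0)"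
  using w v
proof (induction n arbitrary: \<omega> v rule: less_induct)
  case (less n)
  note w = less.prems(1) and v = less.prems(2)
  \<comment> \<open>The product of a discrete Gronwall argument:
    \<open>?K (Suc k) - ?K k = C * e (Suc k) * ?K k\<close>, so that the bounds for the single
    errors telescope as well.\<close>
  let ?K = "\<lambda>n. \<Prod>k<n. 1 + C * e (Suc k)"
  have Yk: "ext_norm S (Y k) \<le> ?K k * ext_norm S (U k 0)" if "k < n" for k
  proof (rule ext_norm_leI)
    fix \<eta> :: "('i \<Rightarrow> real^'n) \<Rightarrow> real" and u :: "'i \<Rightarrow> real^'n"
    assume eta: "\<eta> \<in> unit_forms S" and u: "\<And>i. norm (u i) \<le> 1"
    have "\<bar>\<eta> (\<lambda>i. U k 0 *v u i)\<bar> \<le> ext_norm S (U k 0)"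
      by (rule order_trans[OF unit_form_le_wedge_norm[OF eta] wedge_norm_image_unit_le_ext_norm[OF u]])
    moreover have "\<bar>\<eta> (\<lambda>i. Y k *v u i) - \<eta> (\<lambda>i. U k 0 *v u i)\<bar> \<le> (?K k - 1) * ext_norm S (U k 0)"
      by (rule less.IH[OF that eta u])
    ultimately show "\<bar>\<eta> (\<lambda>i. Y k *v u i)\<bar> \<le> ?K k * ext_norm S (U k 0)"
      by (simp add: left_diff_distrib)
  qed
  let ?f = "\<lambda>k. \<omega> (\<lambda>i. (U n k ** Y k) *v v i)"
  have step: "\<bar>?f (Suc k) - ?f k\<bar> \<le> (?K (Suc k) - ?K k) * ext_norm S (U n 0)" if k: "k < n" for k
  proof -
    let ?g = "ext_norm S (U n (Suc k))"
    \<comment> \<open>Pulling \<open>\<omega>\<close> back along the exact remaining product and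
      normalising splits off the factor \<open>?g\<close> and leaves a unit form, to which
      \<open>diff\<close> applies.\<close>
    obtain \<eta> where eta: "\<eta> \<in> unit_forms S" and eta_eq: "\<And>u. \<omega> (\<lambda>i. U n (Suc k) *v u i) = ?g * \<eta> u"
      using unit_form_of_bounded_form[OF alternating_forms_pullback[OF unit_formsD(1)[OF w], of "U n (Suc k)"]
          ext_norm_nonneg form_image_le_ext_norm[OF w]] by blast
    define u where "u i = Y k *v v i" for i
    have f1: "?f (Suc k) = ?g * \<eta> (\<lambda>i. T (Suc k) *v u i)"
      unfolding eta_eq[symmetric] u_def by (simp only: YS matrix_vector_mul_assoc matrix_mul_assoc)
    have f2: "?f k = ?g * \<eta> (\<lambda>i. P (Suc k) *v u i)"
      unfolding eta_eq[symmetric] u_def UP[OF k] by (simp only: matrix_vector_mul_assoc matrix_mul_assoc)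
    have "\<bar>\<eta> (\<lambda>i. T (Suc k) *v u i) - \<eta> (\<lambda>i. P (Suc k) *v u i)\<bar> \<le> e (Suc k) * wedge_norm S u"
      by (rule form_le_wedge_norm[OF alternating_forms_diff[OF alternating_forms_pullback[OF unit_formsD(1)[OF eta]]
              alternating_forms_pullback[OF unit_formsD(1)[OF eta]]] e diff[OF eta]])
    also have "\<dots> \<le> e (Suc k) * (?K k * ext_norm S (U k 0))"
    proof (intro mult_left_mono e)
      have "wedge_norm S u \<le> ext_norm S (Y k)"
        unfolding u_def by (rule wedge_norm_image_unit_le_ext_norm[OF v])
      then show "wedge_norm S u \<le> ?K k * ext_norm S (U k 0)" using Yk[OF k] by linarith
    qed
    finally have "\<bar>?f (Suc k) - ?f k\<bar> \<le> ?g * (e (Suc k) * (?K k * ext_norm S (U k 0)))"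
      unfolding f1 f2 right_diff_distrib[symmetric] abs_mult abs_of_nonneg[OF ext_norm_nonneg]
      by (intro mult_left_mono ext_norm_nonneg)
    also have "\<dots> = e (Suc k) * ?K k * (?g * ext_norm S (U k 0))" by simp
    \<comment> \<open>Here \<open>C\<close> recombines the norms after and before step
      \<open>k\<close>, which makes the error relative to the whole exact product.\<close>
    also have "\<dots> \<le> e (Suc k) * ?K k * (C * ext_norm S (U n 0))"
      using e C0 by (intro mult_left_mono C k mult_nonneg_nonneg prod_nonneg) auto
    also have "\<dots> = (?K (Suc k) - ?K k) * ext_norm S (U n 0)"
      by (simp add: algebra_simps)
    finally show ?thesis .
  qed
  have "\<omega> (\<lambda>i. Y n *v v i) - \<omega> (\<lambda>i. U n 0 *v v i) = ?f n - ?f 0"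
    by (simp add: U1 Y0)
  also have "\<dots> = (\<Sum>k<n. ?f (Suc k) - ?f k)"
    by (rule sum_lessThan_telescope[symmetric])
  also have "\<bar>\<dots>\<bar> \<le> (\<Sum>k<n. (?K (Suc k) - ?K k) * ext_norm S (U n 0))"
    by (rule order_trans[OF sum_abs sum_mono]) (use step in auto)
  also have "\<dots> = (?K n - 1) * ext_norm S (U n 0)"
  proof -
    have "(\<Sum>k<n. ?K (Suc k) - ?K k) = ?K n - ?K 0" by (rule sum_lessThan_telescope)
    then show ?thesis by (simp only: sum_distrib_right[symmetric]) simp
  qed
  finally show ?case .
qed

section \<open>Null sets\<close>

text \<open>The translates of a bounded piece of \<open>D\<close> by \<open>u / (n + 1)\<close> are
  pairwise disjoint, have equal measure and lie in one ball. Infinitely many of them fit only if the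
  measure is zero.\<close>

lemma negligible_disjoint_translates:
  fixes D :: "'a::euclidean_space set"
  assumes D: "D \<in> sets lebesgue" and disj: "\<And>x s. x \<in> D \<Longrightarrow> s \<noteq> 0 \<Longrightarrow> x + s *\<^sub>R u \<notin> D"
  shows "negligible D"
proof -
  have "negligible (D \<inter> cball 0 r)" for r :: real
  proof -
    let ?E = "D \<inter> cball 0 r"
    let ?F = "\<lambda>n. (+) (inverse (real (Suc n)) *\<^sub>R u) ` ?E"
    have E: "?E \<in> lmeasurable"
      using fmeasurable_Int_fmeasurable[OF lmeasurable_cball D, of 0 r] by (simp add: Int_commute)
    have F: "?F n \<in> lmeasurable" for n using E by (rule measurable_translation)
    have disjF: "disjoint_family_on ?F {..<N}" for N
    proof (unfold disjoint_family_on_def, intro ballI impI)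
      fix i j :: nat assume "i \<noteq> j"
      show "?F i \<inter> ?F j = {}"
      proof (rule ccontr)
        assume "?F i \<inter> ?F j \<noteq> {}"
        then obtain x y where xy: "x \<in> D" "y \<in> D"
          "inverse (real (Suc i)) *\<^sub>R u + x = inverse (real (Suc j)) *\<^sub>R u + y" by auto
        then have "y = x + (inverse (real (Suc i)) - inverse (real (Suc j))) *\<^sub>R u"
          by (simp add: algebra_simps)
        moreover have "inverse (real (Suc i)) - inverse (real (Suc j)) \<noteq> 0"
          using \<open>i \<noteq> j\<close> by simp
        ultimately show False using disj xy(1,2) by metis
      qed
    qed
    have sub: "(\<Union>n<N. ?F n) \<subseteq> cball 0 (r + norm u)" for N
    proof clarify
      fix n x assume "x \<in> D" "x \<in> cball 0 r"
      have "norm (inverse (real (Suc n)) *\<^sub>R u) \<le> 1 * norm u"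
        unfolding norm_scaleR by (intro mult_right_mono) (auto simp: field_simps)
      then show "inverse (real (Suc n)) *\<^sub>R u + x \<in> cball 0 (r + norm u)"
        using \<open>x \<in> cball 0 r\<close> norm_triangle_ineq[of "inverse (real (Suc n)) *\<^sub>R u" x] by simp
    qed
    have bound: "real N * measure lebesgue ?E \<le> measure lebesgue (cball (0::'a) (r + norm u))" for N
    proof -
      have "real N * measure lebesgue ?E = (\<Sum>n<N. measure lebesgue (?F n))"
        by (simp add: measure_translation)
      also have "\<dots> = measure lebesgue (\<Union>n<N. ?F n)"
        using fmeasurableD[OF F] fmeasurableD2[OF F]
        by (intro measure_finite_Union[symmetric] disjF) (simp_all only: image_subset_iff ball_simps finite_lessThan infinity_ennreal_def not_False_eq_True, simp_all)
      also have "\<dots> \<le> measure lebesgue (cball (0::'a) (r + norm u))"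
        using F by (intro measure_mono_fmeasurable sub) (auto intro!: fmeasurableD)
      finally show ?thesis .
    qed
    have "measure lebesgue ?E = 0"
    proof (rule ccontr)
      assume "measure lebesgue ?E \<noteq> 0"
      then have "0 < measure lebesgue ?E" by (simp add: zero_less_measure_iff)
      then obtain N where "measure lebesgue (cball (0::'a) (r + norm u)) < real N * measure lebesgue ?E"
        using reals_Archimedean3 by blast
      then show False using bound[of N] by linarith
    qed
    then show ?thesis using E by (simp add: negligible_iff_measure0)
  qed
  then have "negligible (\<Union>r::nat. D \<inter> cball 0 (real r))"
    by (intro negligible_countable_Union) auto
  moreover have "D \<subseteq> (\<Union>r::nat. D \<inter> cball 0 (real r))"
    using real_arch_simple by fastforce
  ultimately show ?thesis by (rule negligible_subset)
qed

text \<open>Replacing the rows of \<open>v\<close> one after the other by those of a fixed \<open>w \<notin> B\<close>, each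
  line in the direction of the new row of \<open>w\<close> meets the newly acquired points at most once.\<close>

lemma negligible_slotwise_subspace:
  fixes B :: "(real^'n^'m) set"
  assumes B: "B \<in> sets borel"
    and sub: "\<And>v k. v \<in> B \<Longrightarrow> subspace {x. (\<chi> j. if j = k then x else v $ j) \<in> B}"
    and w: "w \<notin> B"
  shows "negligible B"
proof -
  define H where "H R v = (\<chi> j. if j \<in> R then v $ j else w $ j)" for R :: "'m set" and v
  have cont: "continuous_on UNIV (H R)" for R
  proof -
    have "continuous_on UNIV (\<lambda>v. if j \<in> R then v $ j else w $ j)" for j
      by (cases "j \<in> R") (auto intro!: continuous_intros)
    then show ?thesis unfolding H_def by (rule continuous_on_vec_lambda)
  qed
  have meas: "H R -` B \<in> sets borel" for R
    using measurable_sets[OF borel_measurable_continuous_onI[OF cont] B] by simp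
  have "negligible (H R -` B)" for R
    using finite[of R]
  proof (induction R rule: finite_induct)
    case empty
    have "H {} v = w" for v by (simp add: H_def vec_eq_iff)
    then show ?case using w by simp
  next
    case (insert k R)
    let ?D = "H (insert k R) -` B - H R -` B"
    have "negligible ?D"
    proof (rule negligible_disjoint_translates)
      show "?D \<in> sets lebesgue" using meas by (intro sets.Diff) (auto intro: lborelD)
      fix v and s :: real assume v: "v \<in> ?D" and s: "s \<noteq> 0"
      let ?u = "\<chi> j. if j = k then w $ k else 0"
      let ?Z = "{x. (\<chi> j. if j = k then x else H R v $ j) \<in> B}"
      show "v + s *\<^sub>R ?u \<notin> ?D"
      proof
        assume "v + s *\<^sub>R ?u \<in> ?D"
        moreover have "H (insert k R) (v + s *\<^sub>R ?u) = (\<chi> j. if j = k then v $ k + s *\<^sub>R w $ k else H R v $ j)"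
          using insert by (auto simp: H_def vec_eq_iff)
        ultimately have 1: "v $ k + s *\<^sub>R w $ k \<in> ?Z" by simp
        have "H (insert k R) v = (\<chi> j. if j = k then v $ k else H R v $ j)"
          using insert by (auto simp: H_def vec_eq_iff)
        then have 2: "v $ k \<in> ?Z" using v by simp
        have "subspace {x. (\<chi> j. if j = k then x else H (insert k R) v $ j) \<in> B}"
          using v by (intro sub) simp
        moreover have "(\<chi> j. if j = k then x else H (insert k R) v $ j) = (\<chi> j. if j = k then x else H R v $ j)" for x
          by (auto simp: H_def vec_eq_iff)
        ultimately have Z: "subspace ?Z" by simp
        \<comment> \<open>Two points of the subspace \<open>?Z\<close> on a line in direction
          \<open>w $ k\<close> put \<open>w $ k\<close> itself into \<open>?Z\<close>. This says
          \<open>H R v \<in> B\<close>, so \<open>v\<close> was not newly acquired.\<close>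
        have "inverse s *\<^sub>R ((v $ k + s *\<^sub>R w $ k) - v $ k) \<in> ?Z"
          by (intro subspace_scale[OF Z] subspace_diff[OF Z] 1 2)
        then have "w $ k \<in> ?Z" using s by simp
        moreover have "(\<chi> j. if j = k then w $ k else H R v $ j) = H R v"
          using insert by (auto simp: H_def vec_eq_iff)
        ultimately show False using v by simp
      qed
    qed
    then show ?case using insert.IH by (rule negligible_subset[OF negligible_Un]) auto
  qed
  from this[of UNIV] show ?thesis by (simp add: H_def vimage_def)
qed

section \<open>The QR-decomposition and Benettin's algorithm\<close>

text \<open>The least moved point \<open>j\<close> goes to the smaller \<open>f j\<close>, which
  lies in \<open>S\<close> and by injectivity is moved too.\<close>

lemma triangular_inj_eq_id:
  fixes f :: "'n::{finite,linorder} \<Rightarrow> 'n"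
  assumes low: "\<forall>i\<in>S. \<forall>j\<le>i. j \<in> S" and inj: "inj_on f S"
    and le: "\<And>i. i \<in> S \<Longrightarrow> f i \<le> i" and i: "i \<in> S"
  shows "f i = i"
proof (rule ccontr)
  assume "f i \<noteq> i"
  let ?E = "{j \<in> S. f j \<noteq> j}"
  define j where "j = Min ?E"
  have ne: "?E \<noteq> {}" using i \<open>f i \<noteq> i\<close> by auto
  have j: "j \<in> S" "f j \<noteq> j" using Min_in[OF finite ne] by (auto simp: j_def)
  then have "f j < j" using le by (simp add: order_less_le)
  then have "f j \<in> S" using low j(1) by auto
  moreover have "f (f j) \<noteq> f j" using inj_onD[OF inj] j \<open>f j \<in> S\<close> by blast
  ultimately have "j \<le> f j" unfolding j_def by (intro Min_le) auto
  then show False using \<open>f j < j\<close> by simp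
qed

text \<open>In the multilinear expansion a term survives only if it meets no zero below the diagonal
  and uses no column of \<open>Q\<close> twice. On a lower set of indices this leaves the identity
  choice alone.\<close>

lemma form_column_triangular:
  fixes Q R :: "'n::{finite,linorder} sqmat"
  assumes w: "\<omega> \<in> alternating_forms S"
    and low: "\<forall>i\<in>S. \<forall>j\<le>i. j \<in> S"
    and R: "\<And>i j. j < i \<Longrightarrow> R $ i $ j = 0"
  shows "\<omega> (\<lambda>j. column j (Q ** R)) = (\<Prod>i\<in>S. R $ i $ i) * \<omega> (\<lambda>j. column j Q)"
proof -
  let ?g = "restrict id S :: 'n \<Rightarrow> 'n"
  have "(\<lambda>j. column j (Q ** R)) = (\<lambda>j. \<Sum>a\<in>UNIV. R $ a $ j *\<^sub>R column a Q)"
    by (auto simp: fun_eq_iff vec_eq_iff column_def matrix_matrix_mult_def mult.commute)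
  then have "\<omega> (\<lambda>j. column j (Q ** R)) =
      (\<Sum>f\<in>S \<rightarrow>\<^sub>E UNIV. (\<Prod>i\<in>S. R $ f i $ i) * \<omega> (\<lambda>i. column (f i) Q))"
    by (simp only: alternating_forms_expand[OF w finite])
  also have "\<dots> = (\<Sum>f\<in>{?g}. (\<Prod>i\<in>S. R $ f i $ i) * \<omega> (\<lambda>i. column (f i) Q))"
  proof (rule sum.mono_neutral_right)
    show "\<forall>f\<in>(S \<rightarrow>\<^sub>E UNIV) - {?g}. (\<Prod>i\<in>S. R $ f i $ i) * \<omega> (\<lambda>i. column (f i) Q) = 0"
    proof (rule ballI, rule ccontr)
      fix f assume f: "f \<in> (S \<rightarrow>\<^sub>E UNIV) - {?g}"
        and "(\<Prod>i\<in>S. R $ f i $ i) * \<omega> (\<lambda>i. column (f i) Q) \<noteq> 0"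
      then have nz: "\<And>i. i \<in> S \<Longrightarrow> R $ f i $ i \<noteq> 0" "\<omega> (\<lambda>i. column (f i) Q) \<noteq> 0" by auto
      have le: "f i \<le> i" if "i \<in> S" for i using R[of i "f i"] nz(1)[OF that] by force
      have "inj_on (\<lambda>i. column (f i) Q) S" using alternating_forms_eq_0[OF w] nz(2) by blast
      then have "inj_on f S" by (auto simp: inj_on_def)
      then have "f i = i" if "i \<in> S" for i using triangular_inj_eq_id[OF low _ le that] by simp
      then have "f = ?g" using f by (auto simp: fun_eq_iff PiE_def extensional_def restrict_def)
      then show False using f by simp
    qed
  qed auto
  also have "\<dots> = (\<Prod>i\<in>S. R $ i $ i) * \<omega> (\<lambda>i. column i Q)"
    using alternating_forms_cong[OF w, of "\<lambda>i. column (?g i) Q" "\<lambda>i. column i Q"] by simp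
  finally show ?thesis .
qed

text \<open>Gram-Schmidt without recursion: \<open>z j\<close> is the component of column
  \<open>j\<close> orthogonal to the span of all earlier columns, and \<open>R\<close> is read off
  afterwards as \<open>transpose Q ** M\<close>.\<close>

lemma qr_exists:
  fixes M :: "'n::{finite,linorder} sqmat"
  assumes M: "invertible M"
  obtains Q R where "is_qr M Q R"
proof -
  let ?W = "\<lambda>j. (\<lambda>i. column i M) ` {..<j}"
  have "\<exists>z. (\<forall>w\<in>span (?W j). orthogonal z w) \<and> column j M - z \<in> span (?W j)" for j
  proof -
    obtain y z where "y \<in> span (?W j)" "\<And>w. w \<in> span (?W j) \<Longrightarrow> orthogonal z w" "column j M = y + z"
      using orthogonal_subspace_decomp_exists[of "?W j" "column j M"] by metis
    then show ?thesis by (intro exI[of _ z]) auto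
  qed
  then obtain z where orth: "\<And>j w. w \<in> span (?W j) \<Longrightarrow> orthogonal (z j) w"
    and diff: "\<And>j. column j M - z j \<in> span (?W j)" by metis
  have z0: "z j \<noteq> 0" for j
  proof
    assume "z j = 0"
    then have mem: "column j M \<in> span (?W j)" using diff[of j] by simp
    have det: "det M \<noteq> 0" using M by (simp add: invertible_det_nz)
    \<comment> \<open>\<open>columns M\<close> is a set, so removing column \<open>j\<close> could
      also remove an equal earlier column; the nonzero determinant excludes repeated
      columns.\<close>
    have "?W j \<subseteq> columns M - {column j M}"
    proof clarify
      fix i assume "i < j"
      then show "column i M \<in> columns M - {column j M}"
        using det_identical_columns[of i j M] det by (auto simp: columns_def)
    qed
    then have "column j M \<in> span (columns M - {column j M})" using mem span_mono by blast
    then have "dependent (columns M)" unfolding dependent_def by (auto simp: columns_def)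
    then show False using det_dependent_columns[of M] det by (simp add: dependent_vec_eq)
  qed
  have zin: "z i \<in> span (?W j)" if "i < j" for i j
  proof -
    have "column i M \<in> span (?W j)" using that by (intro span_base) auto
    moreover have "span (?W i) \<subseteq> span (?W j)" using that by (intro span_mono) auto
    ultimately have "column i M - (column i M - z i) \<in> span (?W j)" using diff[of i] by (blast intro: span_diff)
    then show ?thesis by simp
  qed
  define q where "q j = z j /\<^sub>R norm (z j)" for j
  define Q where "Q = (\<chi> r c. q c $ r)"
  have col: "column j Q = q j" for j by (simp add: Q_def column_def vec_eq_iff)
  have "orthogonal (q i) (q j)" if "i \<noteq> j" for i j
  proof (cases "i < j")
    case True then show ?thesis using orth[OF zin[OF True]] by (simp add: q_def orthogonal_def inner_commute)
  next
    case False then have "j < i" using that by simp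
    then show ?thesis using orth[OF zin[of j i]] by (simp add: q_def orthogonal_def)
  qed
  then have Q: "orthogonal_matrix Q"
    unfolding orthogonal_matrix_orthonormal_columns col using z0 by (simp add: q_def)
  have entry: "(transpose Q ** M) $ i $ j = q i \<bullet> column j M" for i j
    by (simp add: matrix_matrix_mult_def transpose_def inner_vec_def Q_def column_def)
  have "is_qr M Q (transpose Q ** M)"
    unfolding is_qr_def
  proof (intro conjI allI impI Q)
    show "M = Q ** (transpose Q ** M)" using Q by (simp add: matrix_mul_assoc orthogonal_matrix_def)
    show "(transpose Q ** M) $ i $ j = 0" if "j < i" for i j
      using orth[of "column j M" i] that unfolding entry q_def orthogonal_def
      by (simp add: span_base)
    show "(transpose Q ** M) $ i $ i > 0" for i
    proof -
      have "z i \<bullet> column i M = z i \<bullet> z i + z i \<bullet> (column i M - z i)" by (simp add: inner_diff_right)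
      also have "\<dots> = z i \<bullet> z i" using orth[OF diff] by (simp add: orthogonal_def)
      finally show ?thesis unfolding entry using z0 by (simp add: q_def)
    qed
  qed
  then show ?thesis by (rule that)
qed

lemma is_qr_qr:
  fixes M :: "'n::{finite,linorder} sqmat"
  assumes "invertible M" shows "is_qr M (fst (qr M)) (snd (qr M))"
proof -
  obtain Q R where "is_qr M Q R" by (rule qr_exists[OF assms])
  then have "\<exists>p. case p of (Q, R) \<Rightarrow> is_qr M Q R" by auto
  from someI_ex[OF this] show ?thesis unfolding qr_def by (simp add: case_prod_unfold)
qed

lemma orthogonal_matrix_invertible: "orthogonal_matrix Q \<Longrightarrow> invertible Q"
  for Q :: "real^'n^'n"
  unfolding orthogonal_matrix_def invertible_def by blast

lemma le_mult_of_le_mult: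
  fixes f c r w :: real
  assumes "1 \<le> f * c" "0 \<le> r" "c * r \<le> w" "0 \<le> f"
  shows "r \<le> f * w"
proof -
  have "1 * r \<le> f * c * r" by (rule mult_right_mono[OF assms(1,2)])
  then show ?thesis using mult_left_mono[OF assms(3,4)] by (simp add: mult.assoc)
qed

fun step_product :: "(nat \<Rightarrow> real^'n^'n) \<Rightarrow> nat \<Rightarrow> real^'n^'n" where
  "step_product F 0 = mat 1"
| "step_product F (Suc n) = F (Suc n) ** step_product F n"

context
  fixes F :: "nat \<Rightarrow> 'n::{finite,linorder} sqmat" and v :: "'n tuple"
  assumes F: "\<And>n. invertible (F (Suc n))" and v: "invertible v"
begin

lemma benettin_V_invertible: "invertible (benettin_V F v n)"
proof (induction n)
  case (Suc n)
  have "invertible (F (Suc n) ** benettin_V F v n)" by (intro invertible_mult F Suc)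
  from is_qr_qr[OF this] show ?case by (auto simp: is_qr_def intro: orthogonal_matrix_invertible)
qed (simp add: v transpose_invertible)

lemma benettin_is_qr:
  "is_qr (F (Suc n) ** benettin_V F v n) (benettin_V F v (Suc n)) (benettin_R F v (Suc n))"
  using is_qr_qr[OF invertible_mult[OF F benettin_V_invertible]] by (simp add: benettin_R_def)

lemma benettin_R_pos: "0 < benettin_R F v (Suc n) $ i $ i"
  using benettin_is_qr[of n] unfolding is_qr_def by blast

text \<open>On a lower set \<open>S\<close> only the diagonals of the triangular factors matter. The
  induction runs over arbitrary \<open>\<omega>\<close>, since the newest factor
  \<open>F (Suc n)\<close> is moved into the form by a pullback.\<close>

lemma form_step_product:
  assumes low: "\<forall>i\<in>S. \<forall>j\<le>i. j \<in> S" and w: "\<omega> \<in> alternating_forms S"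
  shows "\<omega> (\<lambda>j. step_product F n *v v $ j) =
    (\<Prod>k<n. \<Prod>i\<in>S. benettin_R F v (Suc k) $ i $ i) * \<omega> (\<lambda>j. column j (benettin_V F v n))"
  using w
proof (induction n arbitrary: \<omega>)
  case 0
  have "column j (transpose v) = v $ j" for j by (simp add: column_def transpose_def vec_eq_iff)
  then show ?case by simp
next
  case (Suc n)
  let ?r = "\<Prod>k<n. \<Prod>i\<in>S. benettin_R F v (Suc k) $ i $ i"
  have "\<omega> (\<lambda>j. step_product F (Suc n) *v v $ j) = \<omega> (\<lambda>j. F (Suc n) *v (step_product F n *v v $ j))"
    by (simp add: matrix_vector_mul_assoc)
  also have "\<dots> = ?r * \<omega> (\<lambda>j. F (Suc n) *v column j (benettin_V F v n))"
    by (rule Suc.IH[OF alternating_forms_pullback[OF Suc.prems]])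
  also have "(\<lambda>j. F (Suc n) *v column j (benettin_V F v n)) =
      (\<lambda>j. column j (benettin_V F v (Suc n) ** benettin_R F v (Suc n)))"
  proof -
    have "F (Suc n) ** benettin_V F v n = benettin_V F v (Suc n) ** benettin_R F v (Suc n)"
      using benettin_is_qr[of n] unfolding is_qr_def by (rule conjunct1)
    moreover have "F (Suc n) *v column j V = column j (F (Suc n) ** V)" for j V
      by (simp add: vec_eq_iff column_def matrix_vector_mult_def matrix_matrix_mult_def)
    ultimately show ?thesis by metis
  qed
  also have "\<omega> \<dots> = (\<Prod>i\<in>S. benettin_R F v (Suc n) $ i $ i) * \<omega> (\<lambda>j. column j (benettin_V F v (Suc n)))"
    using benettin_is_qr[of n] unfolding is_qr_def by (intro form_column_triangular Suc.prems low) blast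
  finally show ?case by (simp add: mult_ac)
qed

text \<open>Orthonormal columns have a volume between \<open>1 / fact CARD('n)\<close> and 1 here,
  so the accumulated diagonal entries equal the image volume up to this factor. The index
  \<open>Suc n\<close> matters: before the first step the columns are those of
  \<open>transpose v\<close> and need not be orthonormal.\<close>

lemma wedge_norm_step_product:
  assumes low: "\<forall>i\<in>S. \<forall>j\<le>i. j \<in> S"
    and r_def: "r = (\<Prod>k<Suc n. \<Prod>i\<in>S. benettin_R F v (Suc k) $ i $ i)"
  shows "wedge_norm S (\<lambda>j. step_product F (Suc n) *v v $ j) \<le> r"
    and "r \<le> fact CARD('n) * wedge_norm S (\<lambda>j. step_product F (Suc n) *v v $ j)"
proof -
  let ?V = "benettin_V F v (Suc n)"
  have r0: "0 \<le> r" unfolding r_def by (intro prod_nonneg less_imp_le benettin_R_pos)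
  have orth: "orthogonal_matrix ?V" using benettin_is_qr[of n] unfolding is_qr_def by blast
  then have norm1: "norm (column j ?V) = 1" for j by (simp add: orthogonal_matrix_orthonormal_columns)
  note eq = form_step_product[OF low, where n = "Suc n", folded r_def]
  show "wedge_norm S (\<lambda>j. step_product F (Suc n) *v v $ j) \<le> r"
  proof (rule wedge_norm_le)
    fix \<omega> :: "('n \<Rightarrow> (real, 'n) vec) \<Rightarrow> real" assume w: "\<omega> \<in> unit_forms S"
    have "\<bar>\<omega> (\<lambda>j. column j ?V)\<bar> \<le> 1" using unit_formsD(2)[OF w, of "\<lambda>j. column j ?V"] norm1 by simp
    then show "\<bar>\<omega> (\<lambda>j. step_product F (Suc n) *v v $ j)\<bar> \<le> r"
      unfolding eq[OF unit_formsD(1)[OF w]] abs_mult using r0 by (simp add: mult_left_le)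
  qed
  define c where "c = wedge_norm S (\<lambda>j. column j ?V)"
  have cw: "c * r \<le> wedge_norm S (\<lambda>j. step_product F (Suc n) *v v $ j)"
    (is "_ \<le> ?w")
  proof (cases "r = 0")
    case False
    then have r: "0 < r" using r0 by simp
    have "wedge_norm S (\<lambda>j. column j ?V) \<le> ?w / r"
    proof (rule wedge_norm_le)
      fix \<omega> :: "('n \<Rightarrow> (real, 'n) vec) \<Rightarrow> real" assume w: "\<omega> \<in> unit_forms S"
      show "\<bar>\<omega> (\<lambda>j. column j ?V)\<bar> \<le> ?w / r"
        using unit_form_le_wedge_norm[OF w, of "\<lambda>j. step_product F (Suc n) *v v $ j"] r
        unfolding eq[OF unit_formsD(1)[OF w]] abs_mult by (simp add: field_simps)
    qed
    then show ?thesis unfolding c_def using r by (simp add: field_simps)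
  qed (simp add: wedge_norm_nonneg)
  have f0: "(0::real) \<le> fact CARD('n)" by (rule fact_ge_zero)
  \<comment> \<open>An orthogonal matrix has determinant 1 or -1 and unit columns, so its columns in
    \<open>S\<close> cannot span too small a volume.\<close>
  have "1 \<le> fact CARD('n) * c"
  proof -
    have "(\<chi> j. column j ?V) = transpose ?V" by (simp add: column_def transpose_def vec_eq_iff)
    then have "1 = \<bar>det (\<chi> j. column j ?V)\<bar>"
      using det_orthogonal_matrix[OF orth] by (simp only: det_transpose) fastforce
    also have "\<dots> \<le> fact CARD('n) * (\<Prod>j\<in>-S. norm (column j ?V)) * c"
      unfolding c_def by (rule det_le_wedge_norm)
    also have "\<dots> = fact CARD('n) * c" by (simp only: norm1 prod.neutral_const mult_1_right)
    finally show ?thesis .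
  qed
  then show "r \<le> fact CARD('n) * ?w"
    by (rule le_mult_of_le_mult[OF _ r0 cw f0])
qed

end

section \<open>Singular values\<close>

text \<open>After division by \<open>\<tau>\<close> the factors in \<open>S\<close> are at least 1
  and the others at most 1. Passing from the image of \<open>S\<close> under \<open>f\<close> to
  \<open>S\<close> drops factors of the second kind and adds factors of the first.\<close>

lemma prod_image_le_prod_threshold:
  fixes s :: "'n::finite \<Rightarrow> real"
  assumes pos: "\<And>i. 0 < s i" and tau: "0 < \<tau>"
    and ge: "\<And>i. i \<in> S \<Longrightarrow> \<tau> \<le> s i" and le: "\<And>i. i \<notin> S \<Longrightarrow> s i \<le> \<tau>" and inj: "inj_on f S"
  shows "(\<Prod>i\<in>S. s (f i)) \<le> (\<Prod>i\<in>S. s i)"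
proof -
  let ?r = "\<lambda>i. s i / \<tau>" and ?T = "f ` S"
  have r: "0 < ?r i" for i using pos tau by simp
  have "(\<Prod>i\<in>?T. ?r i) = (\<Prod>i\<in>?T \<inter> S. ?r i) * (\<Prod>i\<in>?T - S. ?r i)"
    by (subst prod.union_disjoint[symmetric]) (auto intro!: prod.cong)
  also have "\<dots> \<le> (\<Prod>i\<in>?T \<inter> S. ?r i) * 1"
    using r le tau by (intro mult_left_mono prod_le_1 prod_nonneg) (auto simp: less_imp_le)
  also have "\<dots> \<le> (\<Prod>i\<in>S. ?r i)"
    using ge tau r by (simp, intro prod_mono2) (auto simp: less_imp_le)
  finally have "(\<Prod>i\<in>S. ?r (f i)) \<le> (\<Prod>i\<in>S. ?r i)" by (simp add: prod.reindex[OF inj])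
  then show ?thesis using tau by (simp add: prod_dividef divide_le_cancel)
qed

lemma prod_image_le_prod_antimono:
  fixes s :: "'n::{finite,linorder} \<Rightarrow> real"
  assumes pos: "\<And>i. 0 < s i" and anti: "\<And>i j. i \<le> j \<Longrightarrow> s j \<le> s i"
    and low: "\<forall>i\<in>S. \<forall>j\<le>i. j \<in> S" and inj: "inj_on f S"
  shows "(\<Prod>i\<in>S. s (f i)) \<le> (\<Prod>i\<in>S. s i)"
proof (cases "S = {}")
  case False
  show ?thesis
  proof (rule prod_image_le_prod_threshold[where \<tau> = "s (Max S)"])
    show "s (Max S) \<le> s i" if "i \<in> S" for i using that by (intro anti) simp
    show "s i \<le> s (Max S)" if "i \<notin> S" for i
      using that low Max_in[OF finite False] by (intro anti) (metis linear)
  qed (use pos inj in auto)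
qed simp

definition rank_of :: "'n::{finite,linorder} \<Rightarrow> nat" where
  "rank_of i = card {j. j < i}"

text \<open>Ranks count from zero and outputs from one: for \<open>L \<le> CARD('n)\<close> this is
  the image of \<open>{1..L}\<close> under \<open>nth_index\<close>, that is, the slots of the first
  \<open>L\<close> outputs.\<close>

definition initial_segment :: "nat \<Rightarrow> 'n::{finite,linorder} set" where
  "initial_segment L = {i. rank_of i < L}"

lemma rank_of_mono: "i \<le> j \<Longrightarrow> rank_of i \<le> rank_of j"
  unfolding rank_of_def by (intro card_mono) auto

lemma rank_of_less: "i < j \<Longrightarrow> rank_of i < rank_of j"
  unfolding rank_of_def by (intro psubset_card_mono) auto

lemma inj_rank_of: "inj rank_of"
proof (rule injI)
  fix i j :: 'a assume "rank_of i = rank_of j"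
  then show "i = j" using rank_of_less[of i j] rank_of_less[of j i] by (cases i j rule: linorder_cases) auto
qed

lemma rank_of_bound: "rank_of (i::'n::{finite,linorder}) < CARD('n)"
  unfolding rank_of_def by (intro psubset_card_mono) auto

lemma bij_betw_rank_of: "bij_betw rank_of (UNIV :: 'n::{finite,linorder} set) {..<CARD('n)}"
proof -
  have "rank_of ` (UNIV::'n set) = {..<CARD('n)}"
    using rank_of_bound by (intro card_subset_eq) (auto simp: card_image[OF inj_rank_of])
  then show ?thesis using inj_rank_of by (simp add: bij_betw_def)
qed

lemma initial_segment_lower: "\<forall>i\<in>initial_segment L. \<forall>j\<le>i. j \<in> initial_segment L"
  unfolding initial_segment_def using rank_of_mono order_le_less_trans by blast

lemma rank_of_nth_index:
  assumes "1 \<le> k" "k \<le> CARD('n)"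
  shows "rank_of (nth_index k :: 'n::{finite,linorder}) = k - 1"
proof -
  let ?xs = "sorted_list_of_set (UNIV :: 'n set)"
  have len: "length ?xs = CARD('n)" by simp
  have k: "k - 1 < length ?xs" using assms len by linarith
  have sorted: "sorted_wrt (<) ?xs" by (rule strict_sorted_list_of_set)
  have "{j. j < ?xs ! (k - 1)} = (!) ?xs ` {..<k - 1}"
  proof (intro set_eqI iffI)
    fix j assume "j \<in> {j. j < ?xs ! (k - 1)}"
    then have j: "j < ?xs ! (k - 1)" by simp
    have "j \<in> set ?xs" by simp
    then obtain m where m: "m < length ?xs" "j = ?xs ! m" by (metis in_set_conv_nth)
    have "m < k - 1"
    proof (rule ccontr)
      assume "\<not> m < k - 1"
      then have "?xs ! (k - 1) \<le> ?xs ! m" using m(1) by (intro sorted_nth_mono) auto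
      then show False using j m(2) by simp
    qed
    then show "j \<in> (!) ?xs ` {..<k - 1}" using m by auto
  next
    fix j assume "j \<in> (!) ?xs ` {..<k - 1}"
    then show "j \<in> {j. j < ?xs ! (k - 1)}" using sorted_wrt_nth_less[OF sorted _ k] by auto
  qed
  moreover have "inj_on ((!) ?xs) {..<k - 1}"
    using k by (intro inj_on_nth) auto
  ultimately show ?thesis by (simp add: rank_of_def nth_index_def card_image)
qed

lemma bij_betw_nth_index:
  assumes "L \<le> CARD('n)"
  shows "bij_betw nth_index {1..L} (initial_segment L :: 'n::{finite,linorder} set)"
proof (rule bij_betwI')
  fix x y assume "x \<in> {1..L}" "y \<in> {1..L}"
  then show "(nth_index x = (nth_index y :: 'n)) = (x = y)"
    using rank_of_nth_index[of x, where 'n = 'n] rank_of_nth_index[of y, where 'n = 'n] assms by force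
next
  fix x assume "x \<in> {1..L}"
  then show "nth_index x \<in> (initial_segment L :: 'n set)"
    using rank_of_nth_index[of x, where 'n = 'n] assms by (auto simp: initial_segment_def)
next
  fix i :: 'n assume "i \<in> initial_segment L"
  then have "rank_of i < L" by (simp add: initial_segment_def)
  moreover have "rank_of (nth_index (rank_of i + 1) :: 'n) = rank_of i"
    using rank_of_nth_index[of "rank_of i + 1", where 'n = 'n] rank_of_bound[of i] by simp
  then have "i = nth_index (rank_of i + 1)" using injD[OF inj_rank_of] by metis
  ultimately show "\<exists>x\<in>{1..L}. i = nth_index x" by (intro bexI[of _ "rank_of i + 1"]) auto
qed

lemma card_initial_segment:
  "L \<le> CARD('n) \<Longrightarrow> card (initial_segment L :: 'n::{finite,linorder} set) = L"
  using bij_betw_same_card[OF bij_betw_nth_index] by fastforce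

text \<open>Eigenbases and filtration bases arise as unordered sets. Labelling them by the ordered
  index type makes initial segments pick the dominant vectors.\<close>

lemma sorted_indexing:
  fixes B :: "'b set" and key :: "'b \<Rightarrow> 'k::linorder"
  assumes B: "finite B" "card B = CARD('n)"
  obtains g :: "'n::{finite,linorder} \<Rightarrow> 'b"
    where "bij_betw g UNIV B" "\<And>i j. i \<le> j \<Longrightarrow> key (g i) \<le> key (g j)"
proof -
  obtain zs where zs: "set zs = B" "distinct zs" using finite_distinct_list[OF B(1)] by auto
  define ys where "ys = sort_key key zs"
  have ys: "set ys = B" "distinct ys" "sorted (map key ys)" using zs by (auto simp: ys_def)
  have len: "length ys = CARD('n)" using ys B(2) distinct_card by metis
  define g where "g = (\<lambda>i::'n. ys ! rank_of i)"
  have "bij_betw ((!) ys) {..<length ys} (set ys)" using ys(2) by (rule bij_betw_nth) auto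
  then have "bij_betw ((!) ys \<circ> rank_of) (UNIV::'n set) B"
    using bij_betw_trans[OF bij_betw_rank_of] ys len by metis
  moreover have "key (g i) \<le> key (g j)" if "i \<le> j" for i j
    using sorted_nth_mono[OF ys(3) rank_of_mono[OF that]] rank_of_bound[of j] rank_of_bound[of i] len
    by (simp add: g_def)
  ultimately show ?thesis by (intro that[of g]) (auto simp: g_def o_def)
qed

section \<open>The spectral theorem for symmetric matrices\<close>

lemma symmetric_eigenvector_exists:
  fixes N :: "real^'n^'n"
  assumes N: "transpose N = N" and V: "subspace V" and inv: "\<And>x. x \<in> V \<Longrightarrow> N *v x \<in> V"
    and V0: "x0 \<in> V" "x0 \<noteq> 0"
  obtains x c where "x \<in> V" "norm x = 1" "N *v x = c *\<^sub>R x"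
proof -
  let ?Q = "\<lambda>x. x \<bullet> (N *v x)"
  let ?K = "V \<inter> sphere 0 1"
  have sym: "x \<bullet> (N *v y) = (N *v x) \<bullet> y" for x y
    using dot_lmul_matrix[of x N y] N by (metis transpose_matrix_vector)
  have "compact ?K" using closed_subspace[OF V] by (intro closed_Int_compact) auto
  moreover have "x0 /\<^sub>R norm x0 \<in> ?K" using V0 V by (auto simp: subspace_scale)
  moreover have "continuous_on ?K ?Q"
    by (intro continuous_intros linear_continuous_on_compose[OF continuous_on_id] matrix_vector_mul_linear)
  \<comment> \<open>A maximiser of the Rayleigh quotient on the unit sphere of \<open>V\<close>; the
    rest shows that its residual \<open>r\<close> vanishes.\<close>
  ultimately obtain x where x: "x \<in> ?K" and max: "\<And>y. y \<in> ?K \<Longrightarrow> ?Q y \<le> ?Q x"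
    using continuous_attains_sup[of ?K ?Q] by blast
  have xV: "x \<in> V" and x1: "norm x = 1" using x by auto
  have le: "?Q y \<le> ?Q x * (norm y)\<^sup>2" if "y \<in> V" for y
  proof (cases "y = 0")
    case False
    then have "?Q (y /\<^sub>R norm y) \<le> ?Q x" using that V by (intro max) (auto simp: subspace_scale)
    then show ?thesis using False
      by (simp add: matrix_vector_mult_scaleR field_simps power2_eq_square)
  qed simp
  let ?c = "?Q x"
  define r where "r = N *v x - ?c *\<^sub>R x"
  have rV: "r \<in> V" using inv[OF xV] xV V by (simp add: r_def subspace_diff subspace_scale)
  have xr: "x \<bullet> r = 0" using x1 by (simp add: r_def inner_diff_right norm_eq_1)
  have Nxr: "r \<bullet> (N *v x) = r \<bullet> r"
    using xr by (simp add: r_def inner_diff_right inner_diff_left inner_commute)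
  \<comment> \<open>Moving from \<open>x\<close> along \<open>r\<close> would raise the quotient to
    first order in \<open>t\<close>; maximality lets the second-order term compensate for this at
    every \<open>t\<close>.\<close>
  have "2 * t * (r \<bullet> r) \<le> t\<^sup>2 * (?c * (r \<bullet> r) - ?Q r)" for t
  proof -
    have "?Q (x + t *\<^sub>R r) \<le> ?c * (norm (x + t *\<^sub>R r))\<^sup>2"
      using xV rV V by (intro le) (simp add: subspace_add subspace_scale)
    moreover have "(norm (x + t *\<^sub>R r))\<^sup>2 = 1 + t\<^sup>2 * (r \<bullet> r)"
      using xr x1 unfolding power2_norm_eq_inner
      by (simp add: inner_add_left inner_add_right inner_commute norm_eq_1 power2_eq_square)
    moreover have "?Q (x + t *\<^sub>R r) = ?c + 2 * t * (r \<bullet> r) + t\<^sup>2 * ?Q r"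
    proof -
      have "x \<bullet> (N *v r) = r \<bullet> r" using sym[of x r] Nxr by (simp add: inner_commute)
      then show ?thesis using Nxr
        by (simp add: matrix_vector_right_distrib matrix_vector_mult_scaleR
          inner_add_left inner_add_right power2_eq_square algebra_simps)
    qed
    ultimately show ?thesis by (simp add: algebra_simps)
  qed
  then have key: "2 * t * (r \<bullet> r) \<le> t\<^sup>2 * d" if "d = ?c * (r \<bullet> r) - ?Q r" for t d
    using that by simp
  have "r \<bullet> r = 0"
  proof (rule ccontr)
    assume "r \<bullet> r \<noteq> 0"
    then have rr: "0 < r \<bullet> r" by (simp add: order_less_le)
    \<comment> \<open>\<open>d\<close> is positive and exceeds the second-order coefficient. At
      \<open>?t = (r \<bullet> r) / d\<close> the quadratic term is at most half of the linear one,
      which is the contradiction.\<close>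
    define d where "d = \<bar>?c * (r \<bullet> r) - ?Q r\<bar> + 1"
    have d: "0 < d" by (simp add: d_def)
    let ?t = "(r \<bullet> r) / d"
    have t: "0 < ?t" using rr d by simp
    have "2 * ?t * (r \<bullet> r) \<le> ?t\<^sup>2 * (?c * (r \<bullet> r) - ?Q r)" by (rule key[OF refl])
    also have "\<dots> \<le> ?t\<^sup>2 * d" unfolding d_def by (intro mult_left_mono) auto
    also have "\<dots> = ?t * (r \<bullet> r)" using d by (simp add: power2_eq_square)
    finally have "2 * (?t * (r \<bullet> r)) \<le> ?t * (r \<bullet> r)" by (simp only: mult.assoc)
    then show False using mult_pos_pos[OF t rr] by linarith
  qed
  then have "N *v x = ?c *\<^sub>R x" by (simp add: r_def)
  then show ?thesis using that xV x1 by blast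
qed

text \<open>One eigenvector is split off at a time; by symmetry \<open>N\<close> preserves its
  orthogonal complement in \<open>V\<close>, where the dimension is one less.\<close>

lemma symmetric_eigenbasis_exists:
  fixes N :: "real^'n^'n"
  assumes N: "transpose N = N" and V: "subspace V" and inv: "\<And>x. x \<in> V \<Longrightarrow> N *v x \<in> V"
  shows "\<exists>B. B \<subseteq> V \<and> finite B \<and> card B = dim V \<and> pairwise orthogonal B \<and>
     (\<forall>x\<in>B. norm x = 1 \<and> (\<exists>c. N *v x = c *\<^sub>R x))"
  using V inv
proof (induction "dim V" arbitrary: V)
  case 0
  then show ?case by (intro exI[of _ "{}"]) auto
next
  case (Suc k)
  have sym: "x \<bullet> (N *v y) = (N *v x) \<bullet> y" for x y
    using dot_lmul_matrix[of x N y] N by (metis transpose_matrix_vector)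
  have "\<not> V \<subseteq> {0}" using Suc.hyps(2) dim_eq_0[of V] by (metis nat.distinct(1))
  then obtain x0 where "x0 \<in> V" "x0 \<noteq> 0" by blast
  then obtain x c where x: "x \<in> V" "norm x = 1" "N *v x = c *\<^sub>R x"
    using symmetric_eigenvector_exists[OF N Suc.prems] by blast
  let ?W = "{y \<in> V. orthogonal x y}"
  have W: "subspace ?W"
    using Suc.prems(1) by (auto simp: subspace_def orthogonal_def inner_add_right)
  have "N *v y \<in> ?W" if "y \<in> ?W" for y
    using that Suc.prems(2) sym[of x y] x(3) by (auto simp: orthogonal_def)
  moreover have dimW: "dim V = Suc (dim ?W)"
  proof -
    have "V = {a + b | a b. a \<in> span {x} \<and> b \<in> ?W}"
    proof (intro set_eqI iffI)
      fix y assume y: "y \<in> V"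
      have "y = (x \<bullet> y) *\<^sub>R x + (y - (x \<bullet> y) *\<^sub>R x)" by simp
      moreover have "(x \<bullet> y) *\<^sub>R x \<in> span {x}" by (intro span_scale span_base) simp
      moreover have "y - (x \<bullet> y) *\<^sub>R x \<in> ?W" using y x Suc.prems(1)
        by (simp add: orthogonal_def inner_diff_right subspace_diff subspace_scale norm_eq_1)
      ultimately show "y \<in> {a + b | a b. a \<in> span {x} \<and> b \<in> ?W}" by blast
    next
      fix y assume "y \<in> {a + b | a b. a \<in> span {x} \<and> b \<in> ?W}"
      then show "y \<in> V" using x(1) Suc.prems(1)
        by (auto simp: span_singleton subspace_add subspace_scale)
    qed
    moreover have "dim {a + b | a b. a \<in> span {x} \<and> b \<in> ?W} + dim (span {x} \<inter> ?W) = dim (span {x}) + dim ?W"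
      by (rule dim_sums_Int[OF subspace_span W])
    moreover have "span {x} \<inter> ?W \<subseteq> {0}"
      using x(2) by (auto simp: span_singleton orthogonal_def norm_eq_1)
    then have "dim (span {x} \<inter> ?W) = 0" by (simp add: dim_eq_0)
    moreover have "dim {x} = 1" using x(2) by (cases "x = 0") auto
    ultimately show ?thesis by simp
  qed
  ultimately obtain B where B: "B \<subseteq> ?W" "finite B" "card B = dim ?W" "pairwise orthogonal B"
      "\<forall>x\<in>B. norm x = 1 \<and> (\<exists>c. N *v x = c *\<^sub>R x)"
    using Suc.hyps(1)[of ?W] Suc.hyps(2) W by auto
  have "x \<notin> B" using B(1) x(2) by (auto simp: orthogonal_def norm_eq_1)
  then show ?case using B x dimW
    by (intro exI[of _ "insert x B"]) (auto simp: pairwise_insert orthogonal_commute)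
qed

lemma symmetric_diagonalisation:
  fixes N :: "'n::{finite,linorder} sqmat"
  assumes N: "transpose N = N"
  obtains b :: "'n \<Rightarrow> (real, 'n) vec" and \<mu> :: "'n \<Rightarrow> real"
    where "\<And>i j. b i \<bullet> b j = (if i = j then 1 else 0)" "\<And>i. N *v b i = \<mu> i *\<^sub>R b i"
      "\<And>i j. i \<le> j \<Longrightarrow> \<mu> j \<le> \<mu> i" "span (range b) = UNIV"
proof -
  obtain B where B: "finite B" "card B = dim (UNIV :: (real, 'n) vec set)" "pairwise orthogonal B"
      "\<And>x. x \<in> B \<Longrightarrow> norm x = 1" "\<And>x. x \<in> B \<Longrightarrow> \<exists>c. N *v x = c *\<^sub>R x"
    using symmetric_eigenbasis_exists[OF N subspace_UNIV] by auto
  \<comment> \<open>A unit eigenvector has its Rayleigh quotient as eigenvalue, so sorting by the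
    negated quotient makes the eigenvalues decrease along \<open>'n\<close>.\<close>
  obtain b :: "'n \<Rightarrow> (real, 'n) vec" where b: "bij_betw b UNIV B"
    and mono: "\<And>i j. i \<le> j \<Longrightarrow> - (b i \<bullet> (N *v b i)) \<le> - (b j \<bullet> (N *v b j))"
    using sorted_indexing[of B "\<lambda>x. - (x \<bullet> (N *v x))"] B(1,2) by (auto simp: dim_UNIV)
  have bB: "b i \<in> B" for i using b by (auto simp: bij_betw_def)
  have orth: "b i \<bullet> b j = (if i = j then 1 else 0)" for i j
  proof (cases "i = j")
    case False
    then have "b i \<noteq> b j" using b by (auto simp: bij_betw_def inj_def)
    then show ?thesis using B(3) bB False by (auto simp: pairwise_def orthogonal_def)
  qed (use B(4)[OF bB] in \<open>simp add: norm_eq_1\<close>)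
  have eig: "N *v b i = (b i \<bullet> (N *v b i)) *\<^sub>R b i" for i
  proof -
    obtain c where "N *v b i = c *\<^sub>R b i" using B(5)[OF bB] by blast
    then show ?thesis using orth[of i i] by simp
  qed
  have "0 \<notin> B" using B(4) by force
  then have "independent B" using B(3) by (rule pairwise_orthogonal_independent[rotated])
  then have "span B = UNIV" using B(1,2) by (metis card_eq_dim subset_UNIV top.extremum_uniqueI)
  then have "span (range b) = UNIV" using b by (simp add: bij_betw_def)
  then show ?thesis using that[OF orth eig] mono by auto
qed

lemma orthonormal_expand:
  fixes b :: "'i::finite \<Rightarrow> real^'n"
  assumes orth: "\<And>i j. b i \<bullet> b j = (if i = j then 1 else 0)" and span: "span (range b) = UNIV"
  shows "x = (\<Sum>i\<in>UNIV. (x \<bullet> b i) *\<^sub>R b i)"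
proof -
  have "x \<in> span (range b)" by (simp add: span)
  then show ?thesis
  proof (induction rule: span_induct_alt)
    case base show ?case by simp
  next
    case (step c y z)
    then obtain k where k: "y = b k" by auto
    have "(\<Sum>i\<in>UNIV. ((c *\<^sub>R b k + z) \<bullet> b i) *\<^sub>R b i) =
      (\<Sum>i\<in>UNIV. (if i = k then c *\<^sub>R b i else 0) + (z \<bullet> b i) *\<^sub>R b i)"
      by (intro sum.cong refl) (auto simp: inner_add_left orth algebra_simps)
    then show ?case using step k by (simp add: sum.distrib)
  qed
qed

section \<open>Singular values as a sorted list with multiplicities\<close>

lemma sorted_concat_replicate:
  "sorted zs \<Longrightarrow> sorted (concat (map (\<lambda>r. replicate (d r) r) zs))"
  by (induction zs) (auto simp: sorted_append sorted_replicate)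

lemma count_concat_replicate:
  "distinct zs \<Longrightarrow> count (mset (concat (map (\<lambda>r. replicate (d r) r) zs))) r = (if r \<in> set zs then d r else 0)"
  by (induction zs) auto

lemma rev_concat_replicate:
  "rev (concat (map (\<lambda>r. replicate (d r) r) (rev zs))) = concat (map (\<lambda>r. replicate (d r) r) zs)"
  by (induction zs) auto

text \<open>The dimension of \<open>sv_space M r\<close> is the number of indices with
  \<open>s i = r\<close>. Hence both lists have the same multiset of entries, and both are
  decreasing.\<close>

lemma singular_value_list_eq:
  fixes M :: "'n::{finite,linorder} sqmat" and b :: "'n \<Rightarrow> (real, 'n) vec" and s :: "'n \<Rightarrow> real"
  assumes orth: "\<And>i j. b i \<bullet> b j = (if i = j then 1 else 0)" and span: "span (range b) = UNIV"
    and eig: "\<And>i. (transpose M ** M) *v b i = (s i)\<^sup>2 *\<^sub>R b i" and s0: "\<And>i. 0 \<le> s i"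
    and anti: "\<And>i j. i \<le> j \<Longrightarrow> s j \<le> s i"
  shows "singular_value_list M = map s (sorted_list_of_set UNIV)"
proof -
  \<comment> \<open>An eigenvector has coordinates only on eigenvectors with the same eigenvalue.
    Nonnegativity of \<open>r\<close> and \<open>s i\<close> turns equality of squares into
    equality.\<close>
  have mem: "x \<in> sv_space M r \<longleftrightarrow> (\<forall>i. x \<bullet> b i \<noteq> 0 \<longrightarrow> s i = r)" if r: "0 \<le> r" for x r
  proof -
    have "(transpose M ** M) *v x = (\<Sum>i\<in>UNIV. (x \<bullet> b i) *\<^sub>R ((s i)\<^sup>2 *\<^sub>R b i))"
      by (subst orthonormal_expand[OF orth span, of x])
        (simp only: linear_sum[OF matrix_vector_mul_linear] matrix_vector_mult_scaleR eig)
    then have inner: "((transpose M ** M) *v x) \<bullet> b i = (x \<bullet> b i) * (s i)\<^sup>2" for i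
      by (simp add: inner_sum_left orth if_distrib cong: if_cong)
    have "x \<in> sv_space M r \<longleftrightarrow> (\<forall>i. ((transpose M ** M) *v x) \<bullet> b i = (r\<^sup>2 *\<^sub>R x) \<bullet> b i)"
    proof
      assume R: "\<forall>i. ((transpose M ** M) *v x) \<bullet> b i = (r\<^sup>2 *\<^sub>R x) \<bullet> b i"
      have "(transpose M ** M) *v x = r\<^sup>2 *\<^sub>R x"
        using orthonormal_expand[OF orth span, of "(transpose M ** M) *v x"]
          orthonormal_expand[OF orth span, of "r\<^sup>2 *\<^sub>R x"] R by simp
      then show "x \<in> sv_space M r" by (simp add: sv_space_def)
    qed (simp add: sv_space_def)
    also have "\<dots> \<longleftrightarrow> (\<forall>i. x \<bullet> b i \<noteq> 0 \<longrightarrow> s i = r)"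
      unfolding inner using s0 r by (auto simp: power2_eq_iff_nonneg)
    finally show ?thesis .
  qed
  have nz: "b i \<noteq> 0" for i using orth[of i i] by auto
  have set: "singular_value_set M = range s"
  proof (intro set_eqI iffI)
    fix r assume "r \<in> singular_value_set M"
    then obtain x where x: "0 \<le> r" "x \<noteq> 0" "x \<in> sv_space M r" by (auto simp: singular_value_set_def)
    have "\<exists>i. x \<bullet> b i \<noteq> 0"
    proof (rule ccontr)
      assume "\<not> ?thesis"
      then have "(\<Sum>i\<in>UNIV. (x \<bullet> b i) *\<^sub>R b i) = 0" by simp
      then show False using orthonormal_expand[OF orth span, of x] x(2) by metis
    qed
    then show "r \<in> range s" using mem[OF x(1)] x(3) by auto
  next
    fix r assume "r \<in> range s"
    then obtain i where i: "r = s i" by auto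
    have "b i \<in> sv_space M r" using mem[of r "b i"] s0 i orth by simp
    then show "r \<in> singular_value_set M" using s0 i nz by (auto simp: singular_value_set_def)
  qed
  have dim: "dim (sv_space M r) = card {i. s i = r}" if r: "0 \<le> r" for r
  proof -
    have inj: "inj b" using orth by (metis injI zero_neq_one)
    have "sv_space M r \<subseteq> span (b ` {i. s i = r})"
    proof
      fix x assume "x \<in> sv_space M r"
      then have "(x \<bullet> b i) *\<^sub>R b i \<in> span (b ` {i. s i = r})" for i
        using mem[OF r] by (cases "x \<bullet> b i = 0") (auto intro!: span_scale intro: span_base span_zero)
      then show "x \<in> span (b ` {i. s i = r})"
        by (subst orthonormal_expand[OF orth span, of x]) (intro span_sum)
    qed
    moreover have "b ` {i. s i = r} \<subseteq> sv_space M r" using mem[OF r] orth by auto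
    moreover have "independent (b ` {i. s i = r})"
    proof (rule pairwise_orthogonal_independent)
      show "pairwise orthogonal (b ` {i. s i = r})"
        using orth by (auto simp: pairwise_def orthogonal_def)
    qed (use nz in \<open>metis image_iff\<close>)
    ultimately have "dim (sv_space M r) = card (b ` {i. s i = r})" by (intro dim_unique[of "b ` {i. s i = r}"]) auto
    then show ?thesis using inj by (simp add: card_image inj_on_def)
  qed
  let ?zs = "sorted_list_of_set (range s)"
  let ?c = "\<lambda>zs. concat (map (\<lambda>r. replicate (dim (sv_space M r)) r) zs)"
  let ?xs = "sorted_list_of_set (UNIV :: 'n set)"
  have "mset (map s ?xs) = mset (?c ?zs)"
  proof (rule multiset_eqI)
    fix r
    have "mset ?xs = mset_set UNIV"
      using mset_set_set[of ?xs] by (simp only: distinct_sorted_list_of_set set_sorted_list_of_set finite simp_thms)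
    then have "count (mset (map s ?xs)) r = count (image_mset s (mset_set UNIV)) r"
      by (simp only: mset_map)
    also have "\<dots> = card {i. s i = r}"
    proof -
      have "{i. r = s i} = {i. s i = r}" by auto
      then show ?thesis by (simp add: count_image_mset')
    qed
    also have "\<dots> = (if r \<in> range s then dim (sv_space M r) else 0)"
      using dim[of r] s0 by (auto simp: card_eq_0_iff)
    also have "\<dots> = count (mset (?c ?zs)) r"
      by (simp add: count_concat_replicate)
    finally show "count (mset (map s ?xs)) r = count (mset (?c ?zs)) r" .
  qed
  then have "sort (map s ?xs) = ?c ?zs"
    by (intro properties_for_sort sorted_concat_replicate) simp_all
  moreover have "sorted (rev (map s ?xs))"
    unfolding sorted_wrt_rev sorted_wrt_map
    by (rule sorted_wrt_mono_rel[OF anti sorted_sorted_list_of_set])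
  then have "sort (map s ?xs) = rev (map s ?xs)" by (intro properties_for_sort) simp_all
  ultimately have "rev (map s ?xs) = ?c ?zs" by (rule trans[OF sym, rotated])
  also have "\<dots> = rev (?c (rev ?zs))" by (rule rev_concat_replicate[symmetric])
  finally have "map s ?xs = ?c (rev ?zs)" by (rule rev_is_rev_conv[THEN iffD1])
  then show ?thesis by (simp add: singular_value_list_def set)
qed

text \<open>Classically the norm of the exterior power equals the product of the largest singular
  values. The lower bound splits the determinant, which is the product of all singular values up to
  sign; the upper bound expands in the eigenbasis, where no injective choice beats the first
  \<open>L\<close> vectors.\<close>

lemma prod_singular_values_ext_norm:
  fixes M :: "'n::{finite,linorder} sqmat"
  assumes M: "invertible M" and L: "L \<le> CARD('n)"
  defines "S \<equiv> initial_segment L :: 'n set"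
  shows "0 < (\<Prod>k=1..L. \<sigma> k M)"
    and "(\<Prod>k=1..L. \<sigma> k M) \<le> fact CARD('n) * ext_norm S M"
    and "ext_norm S M \<le> real (card (S \<rightarrow>\<^sub>E (UNIV :: 'n set))) * (\<Prod>k=1..L. \<sigma> k M)"
proof -
  let ?N = "transpose M ** M"
  have "transpose ?N = ?N" by (simp add: matrix_transpose_mul)
  then obtain b :: "'n \<Rightarrow> (real, 'n) vec" and \<mu> where orth: "\<And>i j. b i \<bullet> b j = (if i = j then 1 else 0)"
    and eig: "\<And>i. ?N *v b i = \<mu> i *\<^sub>R b i" and anti: "\<And>i j. i \<le> j \<Longrightarrow> \<mu> j \<le> \<mu> i"
    and span: "span (range b) = UNIV"
    using symmetric_diagonalisation[of ?N] by metis
  define s where "s i = norm (M *v b i)" for i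
  have inner: "(M *v b i) \<bullet> (M *v b j) = (if i = j then \<mu> i else 0)" for i j
  proof -
    have "(M *v b i) \<bullet> (M *v b j) = (?N *v b i) \<bullet> b j"
      by (metis dot_lmul_matrix matrix_vector_mul_assoc transpose_matrix_vector transpose_transpose)
    then show ?thesis using orth[of i j] by (simp add: eig)
  qed
  have mu: "\<mu> i = (s i)\<^sup>2" for i using inner[of i i] by (simp add: s_def power2_norm_eq_inner)
  have s0: "0 < s i" for i
  proof -
    have "b i \<noteq> 0" using orth[of i i] by auto
    then have "M *v b i \<noteq> 0"
      using M by (metis invertible_def matrix_left_invertible_ker)
    then show ?thesis by (simp add: s_def)
  qed
  have s_anti: "s j \<le> s i" if "i \<le> j" for i j
    using anti[OF that] s0[of i] unfolding mu by (simp add: power2_le_iff_abs_le less_imp_le)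
  have sigma: "\<sigma> k M = s (nth_index k)" if "k \<in> {1..L}" for k
  proof -
    have "singular_value_list M = map s (sorted_list_of_set UNIV)"
      by (rule singular_value_list_eq[OF orth span]) (auto simp: eig mu s0 less_imp_le s_anti)
    moreover have "k - 1 < length (sorted_list_of_set (UNIV :: 'n set))" using that L by simp linarith
    ultimately show ?thesis by (simp add: \<sigma>_def nth_index_def)
  qed
  have prod: "(\<Prod>k=1..L. \<sigma> k M) = (\<Prod>i\<in>S. s i)"
    unfolding S_def using bij_betw_nth_index[OF L]
    by (subst prod.reindex_bij_betw[symmetric]) (auto simp: sigma intro!: prod.cong)
  show "0 < (\<Prod>k=1..L. \<sigma> k M)" unfolding prod using s0 by (intro prod_pos) auto
  have norm_b: "norm (b i) = 1" for i using orth[of i i] by (simp add: norm_eq_1)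
  \<comment> \<open>The Gram matrix of the images \<open>M *v b i\<close> is diagonal with entries
    \<open>(s i)\<^sup>2\<close>, and its determinant is the square of the one sought.\<close>
  have "\<bar>det (\<chi> i. M *v b i)\<bar> = (\<Prod>i\<in>UNIV. s i)"
  proof -
    let ?A = "(\<chi> i. M *v b i) :: 'n sqmat"
    have entry: "(?A ** transpose ?A) $ i $ j = (if i = j then (s i)\<^sup>2 else 0)" for i j
      using inner[of i j] by (simp add: matrix_matrix_mult_def transpose_def inner_vec_def mu)
    have "(det ?A)\<^sup>2 = det (?A ** transpose ?A)" by (simp add: det_mul power2_eq_square)
    also have "\<dots> = (\<Prod>i\<in>UNIV. (?A ** transpose ?A) $ i $ i)"
      by (rule det_diagonal) (simp only: entry if_False)
    also have "\<dots> = (\<Prod>i\<in>UNIV. s i)\<^sup>2" by (simp only: entry simp_thms if_True prod_power_distrib)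
    finally have "\<bar>det ?A\<bar>\<^sup>2 = (\<Prod>i\<in>UNIV. s i)\<^sup>2" by (simp only: power2_abs)
    then show ?thesis
      by (rule power2_eq_imp_eq) (intro abs_ge_zero prod_nonneg less_imp_le s0)+
  qed
  then have "(\<Prod>i\<in>UNIV. s i) \<le> fact CARD('n) * (\<Prod>i\<in>-S. s i) * ext_norm S M"
    using det_le_ext_norm[of M b S] by (simp add: norm_b s_def)
  moreover have "(\<Prod>i\<in>UNIV. s i) = (\<Prod>i\<in>-S. s i) * (\<Prod>i\<in>S. s i)"
    by (subst prod.union_disjoint[symmetric]) (auto simp: Compl_partition2)
  \<comment> \<open>The complementary factor stands on both sides and cancels.\<close>
  moreover have "0 < (\<Prod>i\<in>-S. s i)" using s0 by (intro prod_pos) auto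
  ultimately show "(\<Prod>k=1..L. \<sigma> k M) \<le> fact CARD('n) * ext_norm S M"
    unfolding prod by (simp add: mult_ac)
  have "ext_norm S M \<le> 1 ^ card S * (\<Sum>f\<in>S \<rightarrow>\<^sub>E UNIV. wedge_norm S (\<lambda>i. M *v b (f i)))"
  proof (rule ext_norm_le_sum)
    fix x :: "(real, 'n) vec" assume "norm x \<le> 1"
    then have "\<bar>x \<bullet> b a\<bar> \<le> 1" for a using Cauchy_Schwarz_ineq2[of x "b a"] norm_b[of a] by simp
    then show "\<exists>c. x = (\<Sum>a\<in>UNIV. c a *\<^sub>R b a) \<and> (\<forall>a. \<bar>c a\<bar> \<le> 1)"
      by (intro exI[of _ "\<lambda>a. x \<bullet> b a"] conjI allI orthonormal_expand[OF orth span])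
  qed
  also have "\<dots> \<le> (\<Sum>f\<in>S \<rightarrow>\<^sub>E (UNIV::'n set). (\<Prod>i\<in>S. s i))"
  proof (simp only: power_one mult_1, rule sum_mono)
    fix f :: "'n \<Rightarrow> 'n"
    have P0: "0 \<le> (\<Prod>i\<in>S. s i)" using s0 by (intro prod_nonneg less_imp_le)
    show "wedge_norm S (\<lambda>i. M *v b (f i)) \<le> (\<Prod>i\<in>S. s i)"
    proof (cases "inj_on f S")
      case True
      have "wedge_norm S (\<lambda>i. M *v b (f i)) \<le> (\<Prod>i\<in>S. s (f i))"
        unfolding s_def by (rule wedge_norm_le_prod_norm)
      also have "\<dots> \<le> (\<Prod>i\<in>S. s i)"
        unfolding S_def
        by (intro prod_image_le_prod_antimono s0 s_anti True[unfolded S_def] initial_segment_lower)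
      finally show ?thesis .
    next
      case False
      then have "\<not> inj_on (\<lambda>i. M *v b (f i)) S" unfolding inj_on_def by metis
      then show ?thesis using P0 by (simp add: wedge_norm_eq_0)
    qed
  qed
  also have "\<dots> = real (card (S \<rightarrow>\<^sub>E (UNIV :: 'n set))) * (\<Prod>k=1..L. \<sigma> k M)" by (simp only: sum_constant prod)
  finally show "ext_norm S M \<le> real (card (S \<rightarrow>\<^sub>E (UNIV :: 'n set))) * (\<Prod>k=1..L. \<sigma> k M)" .
qed

section \<open>Bases adapted to a filtration\<close>

text \<open>An independent set is extended from the smallest space upwards, so that it contains a
  basis of every \<open>E j\<close>. Ordering by \<open>lev\<close> puts the vectors of the
  outermost level first; for Lyapunov filtrations these are the fastest growing ones.\<close>

lemma filtration_adapted_basis: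
  fixes E :: "nat \<Rightarrow> (real, 'n::{finite,linorder}) vec set"
  assumes sub: "\<And>k. k \<in> {1..q+1} \<Longrightarrow> subspace (E k)"
    and dec: "\<And>k. k \<in> {1..q} \<Longrightarrow> E (k + 1) \<subseteq> E k"
    and E1: "E 1 = UNIV" and Eq: "E (q + 1) = {0}"
  obtains b :: "'n \<Rightarrow> (real, 'n) vec" and lev :: "'n \<Rightarrow> nat"
    where "inj b" "independent (range b)" "\<And>i j. i \<le> j \<Longrightarrow> lev i \<le> lev j"
      "\<And>i. lev i \<in> {1..q}" "\<And>i. b i \<in> E (lev i)"
      "\<And>j. j \<in> {1..q} \<Longrightarrow> card {i. lev i = j} = dim (E j) - dim (E (j + 1))"
proof -
  have anti: "E k \<subseteq> E j" if "j \<le> k" "1 \<le> j" "k \<le> q + 1" for j k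
    using that
  proof (induction k rule: dec_induct)
    case (step n)
    have "E (n + 1) \<subseteq> E n" using step by (intro dec) simp
    then show ?case using step by auto
  qed simp
  have "\<exists>B. B \<subseteq> E 1 \<and> independent B \<and> (\<forall>j\<in>{1..q+1}. E j \<subseteq> span (B \<inter> E j))"
  proof -
    \<comment> \<open>Downward induction on \<open>k\<close>: the set built so far is adapted to all
      spaces from \<open>E k\<close> inwards, and enlarging it does not spoil this.\<close>
    have "\<exists>B. B \<subseteq> E k \<and> independent B \<and> (\<forall>j\<in>{k..q+1}. E j \<subseteq> span (B \<inter> E j))" if "1 \<le> k" "k \<le> q + 1" for k
      using that(2,1)
    proof (induction k rule: inc_induct)
      case base
      show ?case using Eq by (intro exI[of _ "{}"]) (auto intro: span_zero simp: independent_empty)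
    next
      case (step n)
      obtain B where B: "B \<subseteq> E (Suc n)" "independent B" "\<forall>j\<in>{Suc n..q+1}. E j \<subseteq> span (B \<inter> E j)"
        using step by auto
      have "E (Suc n) \<subseteq> E n" using dec[of n] step by simp
      then have "B \<subseteq> E n" using B(1) by blast
      then obtain B' where B': "B \<subseteq> B'" "B' \<subseteq> E n" "independent B'" "E n \<subseteq> span B'"
        using maximal_independent_subset_extend[OF _ B(2)] by metis
      have "E j \<subseteq> span (B' \<inter> E j)" if "j \<in> {n..q+1}" for j
      proof (cases "j = n")
        case True then show ?thesis using B' by (simp add: Int_absorb2)
      next
        case False
        then have "j \<in> {Suc n..q+1}" using that by auto
        then have "E j \<subseteq> span (B \<inter> E j)" using B(3) by blast
        also have "\<dots> \<subseteq> span (B' \<inter> E j)" using B'(1) by (intro span_mono) auto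
        finally show ?thesis .
      qed
      then show ?case using B' by blast
    qed
    from this[of 1] show ?thesis by simp
  qed
  then obtain B where B: "independent B" "\<And>j. j \<in> {1..q+1} \<Longrightarrow> E j \<subseteq> span (B \<inter> E j)" by auto
  have finB: "finite B" using B(1) by (rule independent_imp_finite)
  have cardE: "card (B \<inter> E j) = dim (E j)" if "j \<in> {1..q+1}" for j
    using B(2)[OF that] B(1) by (intro basis_card_eq_dim independent_mono[OF B(1)]) auto
  have cardB: "card B = CARD('n)" using cardE[of 1] E1 by (simp add: dim_UNIV)
  \<comment> \<open>The deepest space containing the vector. Level \<open>q + 1\<close> is left out
    of the maximum because basis vectors are nonzero.\<close>
  define lv where "lv x = Max {k \<in> {1..q}. x \<in> E k}" for x
  have q: "1 \<le> q"
  proof (rule ccontr)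
    assume "\<not> 1 \<le> q"
    then have "E 1 = {0}" using Eq by (simp add: not_le)
    then have "(axis undefined 1 :: (real, 'n) vec) = 0" using E1 by auto
    then show False by (simp add: axis_eq_0_iff)
  qed
  have lv_iff: "k \<le> lv x \<longleftrightarrow> x \<in> E k" and lv_mem: "lv x \<in> {1..q}" "x \<in> E (lv x)" if "x \<in> B" "k \<in> {1..q}" for x k
  proof -
    have ne: "{k \<in> {1..q}. x \<in> E k} \<noteq> {}" using E1 q by auto
    have mem: "lv x \<in> {k \<in> {1..q}. x \<in> E k}" unfolding lv_def by (rule Max_in[OF _ ne]) simp
    then show "lv x \<in> {1..q}" "x \<in> E (lv x)" by auto
    show "k \<le> lv x \<longleftrightarrow> x \<in> E k"
    proof
      assume "k \<le> lv x"
      then have "E (lv x) \<subseteq> E k" using mem that by (intro anti) auto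
      then show "x \<in> E k" using mem by auto
    next
      assume "x \<in> E k"
      then show "k \<le> lv x" unfolding lv_def using that by (intro Max_ge) auto
    qed
  qed
  have nz: "x \<noteq> 0" if "x \<in> B" for x using B(1) dependent_zero that by blast
  have lv_eq: "{x \<in> B. lv x = j} = B \<inter> E j - B \<inter> E (j + 1)" if j: "j \<in> {1..q}" for j
  proof (intro set_eqI)
    fix x
    show "x \<in> {x \<in> B. lv x = j} \<longleftrightarrow> x \<in> B \<inter> E j - B \<inter> E (j + 1)"
    proof (cases "x \<in> B")
      case True
      have "x \<in> E (j + 1) \<longleftrightarrow> j + 1 \<le> lv x"
      proof (cases "j = q")
        case True
        then show ?thesis using Eq nz \<open>x \<in> B\<close> lv_mem[OF \<open>x \<in> B\<close> j] by auto
      next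
        case False
        then show ?thesis using lv_iff[OF True, of "j + 1"] j by auto
      qed
      then show ?thesis using lv_iff[OF True j] True by auto
    qed auto
  qed
  obtain b :: "'n \<Rightarrow> (real, 'n) vec" where b: "bij_betw b UNIV B" and mono: "\<And>i j. i \<le> j \<Longrightarrow> lv (b i) \<le> lv (b j)"
    using sorted_indexing[OF finB cardB, of lv] by metis
  have bB: "b i \<in> B" for i using b by (auto simp: bij_betw_def)
  have one: "1 \<in> {1..q}" using q by simp
  show ?thesis
  proof (rule that[of b "\<lambda>i. lv (b i)"])
    show "inj b" "independent (range b)" using b B(1) by (auto simp: bij_betw_def)
    show "lv (b i) \<in> {1..q}" "b i \<in> E (lv (b i))" for i using lv_mem[OF bB one] by auto
    fix j assume j: "j \<in> {1..q}"
    have "card {i. lv (b i) = j} = card (b ` {i. lv (b i) = j})"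
      using b by (intro card_image[symmetric]) (auto simp: bij_betw_def inj_on_def)
    also have "b ` {i. lv (b i) = j} = {x \<in> B. lv x = j}" using b by (auto simp: bij_betw_def)
    also have "card \<dots> = card (B \<inter> E j) - card (B \<inter> E (j + 1))"
      unfolding lv_eq[OF j] using dec[OF j] finB by (intro card_Diff_subset) auto
    also have "\<dots> = dim (E j) - dim (E (j + 1))" using cardE[of j] cardE[of "j + 1"] j by simp
    finally show "card {i. lv (b i) = j} = dim (E j) - dim (E (j + 1))" .
  qed (rule mono)
qed

lemma lower_set_eq_initial_segment:
  fixes T :: "'n::{finite,linorder} set"
  assumes "\<forall>i\<in>T. \<forall>j\<le>i. j \<in> T"
  shows "T = initial_segment (card T)"
proof (rule card_subset_eq)
  show "T \<subseteq> initial_segment (card T)"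
  proof
    fix i assume "i \<in> T"
    then have "{j. j < i} \<subset> T" using assms by auto
    then show "i \<in> initial_segment (card T)"
      unfolding initial_segment_def rank_of_def by (simp add: psubset_card_mono)
  qed
  show "card T = card (initial_segment (card T) :: 'n set)"
    by (intro card_initial_segment[symmetric] card_mono) auto
qed simp

text \<open>The coefficients are obtained by applying the inverse of the matrix with rows
  \<open>b i\<close>, hence are linear in \<open>x\<close> and bounded on the unit ball.\<close>

lemma basis_coefficients_bounded:
  fixes b :: "'n \<Rightarrow> real^'n"
  assumes inj: "inj b" and ind: "independent (range b)"
  obtains K where "\<And>x. norm x \<le> 1 \<Longrightarrow> \<exists>c. x = (\<Sum>a\<in>UNIV. c a *\<^sub>R b a) \<and> (\<forall>a. \<bar>c a\<bar> \<le> K)"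
    and "det (\<chi> i. b i) \<noteq> 0"
proof -
  let ?B = "\<chi> i. b i"
  have rows: "rows ?B = range b" by (auto simp: rows_def row_def vec_lambda_eta)
  have "\<exists>B'. ?B ** B' = mat 1"
    unfolding matrix_right_invertible_independent_rows
  proof (intro allI impI)
    fix c i assume "(\<Sum>i\<in>UNIV. c i *s row i ?B) = 0"
    then have "(\<Sum>i\<in>UNIV. c i *\<^sub>R b i) = 0" by (simp add: row_def vec_lambda_eta scalar_mult_eq_scaleR)
    then have "(\<Sum>v\<in>range b. c (inv b v) *\<^sub>R v) = 0" using inj by (simp add: sum.reindex)
    then have "c (inv b (b i)) = 0"
      by (intro independentD[OF ind, of "range b" "\<lambda>v. c (inv b v)" "b i"]) auto
    then show "c i = 0" using inj by simp
  qed
  then have inv: "invertible ?B" using invertible_right_inverse by blast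
  then obtain B' where B': "B' ** ?B = mat 1" "?B ** B' = mat 1" unfolding invertible_def by blast
  have expand: "x = (\<Sum>a\<in>UNIV. (x v* B') $ a *\<^sub>R b a)" for x
  proof -
    have "x = x v* (B' ** ?B)" by (simp add: B' vector_matrix_mul_rid)
    also have "\<dots> = (x v* B') v* ?B" by (simp add: vector_matrix_mul_assoc)
    also have "\<dots> = (\<Sum>a\<in>UNIV. (x v* B') $ a *\<^sub>R b a)"
      by (simp add: vec_eq_iff vector_matrix_mult_def mult.commute)
    finally show ?thesis .
  qed
  have bound: "\<bar>(x v* B') $ a\<bar> \<le> onorm ((*v) (transpose B'))" if "norm x \<le> 1" for x a
  proof -
    have "\<bar>(x v* B') $ a\<bar> \<le> norm (transpose B' *v x)"
      by (metis component_le_norm_cart transpose_matrix_vector)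
    also have "\<dots> \<le> onorm ((*v) (transpose B')) * norm x" by (rule norm_matrix_le_onorm)
    also have "\<dots> \<le> onorm ((*v) (transpose B'))"
      using that onorm_matrix_nonneg by (rule mult_left_le)
    finally show ?thesis .
  qed
  show ?thesis
  proof (rule that)
    show "\<exists>c. x = (\<Sum>a\<in>UNIV. c a *\<^sub>R b a) \<and> (\<forall>a. \<bar>c a\<bar> \<le> onorm ((*v) (transpose B')))"
      if "norm x \<le> 1" for x
      using that by (intro exI[of _ "\<lambda>a. (x v* B') $ a"] conjI allI expand bound)
    show "det ?B \<noteq> 0" using inv by (simp add: invertible_det_nz)
  qed
qed

section \<open>Growth of solutions\<close>

lemma bounded_linear_matrix_vector_left: "bounded_linear (\<lambda>M::real^'n^'n. M *v c)"
  unfolding linear_conv_bounded_linear[symmetric]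
  by (rule linearI) (simp_all add: matrix_vector_mult_add_rdistrib scaleR_matrix_vector_assoc)

text \<open>Trades the extended-real limit superior for eventual bounds. The convention
  \<open>elog 0 = -\<infinity>\<close> fits, as a vanishing norm satisfies every exponential
  bound.\<close>

lemma lyapunov_exponent_le_iff:
  "lyapunov_exponent x \<le> ereal l \<longleftrightarrow> (\<forall>e>0. eventually (\<lambda>t. norm (x t) \<le> exp ((l + e) * t)) at_top)"
proof
  assume le: "lyapunov_exponent x \<le> ereal l"
  show "\<forall>e>0. eventually (\<lambda>t. norm (x t) \<le> exp ((l + e) * t)) at_top"
  proof (intro allI impI)
    fix e :: real assume "0 < e"
    then have "ereal l < ereal (l + e)" by simp
    then have "eventually (\<lambda>t. ereal (1 / t) * elog (norm (x t)) < ereal (l + e)) at_top"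
      using le unfolding lyapunov_exponent_def Limsup_le_iff by blast
    then show "eventually (\<lambda>t. norm (x t) \<le> exp ((l + e) * t)) at_top"
      using eventually_gt_at_top[of 0]
    proof eventually_elim
      case (elim t)
      show ?case
      proof (cases "x t = 0")
        case False
        then have "ln (norm (x t)) / t < l + e" using elim by (simp add: elog_def)
        then have "ln (norm (x t)) < (l + e) * t" using elim(2) by (simp add: field_simps)
        then show ?thesis using False by (metis exp_le_cancel_iff exp_ln less_imp_le zero_less_norm_iff)
      qed simp
    qed
  qed
next
  assume R: "\<forall>e>0. eventually (\<lambda>t. norm (x t) \<le> exp ((l + e) * t)) at_top"
  show "lyapunov_exponent x \<le> ereal l"
    unfolding lyapunov_exponent_def Limsup_le_iff
  proof (intro allI impI)
    fix y assume "ereal l < y"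
    then obtain r where r: "ereal l < ereal r" "ereal r < y" using ereal_dense2 by blast
    then have "0 < r - l" by simp
    then have "eventually (\<lambda>t. norm (x t) \<le> exp ((l + (r - l)) * t)) at_top" using R by blast
    then show "eventually (\<lambda>t. ereal (1 / t) * elog (norm (x t)) < y) at_top"
      using eventually_gt_at_top[of 0]
    proof eventually_elim
      case (elim t)
      show ?case
      proof (cases "x t = 0")
        case True
        then show ?thesis using elim r(2) by (auto simp: elog_def)
      next
        case False
        then have "ln (norm (x t)) \<le> ln (exp (r * t))" using elim by (subst ln_le_cancel_iff) auto
        then have "ln (norm (x t)) \<le> r * t" by simp
        then have "ln (norm (x t)) / t \<le> r" using elim(2) by (simp add: field_simps)
        then have "ereal (1 / t) * elog (norm (x t)) \<le> ereal r" using False by (simp add: elog_def)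
        then show ?thesis using r(2) by (rule order_le_less_trans)
      qed
    qed
  qed
qed

text \<open>The reason why multiplicative constants may be given away throughout: any strictly
  larger rate pays for them.\<close>

lemma eventually_exp_absorbs:
  fixes l l' K :: real
  assumes "l < l'"
  shows "eventually (\<lambda>t. K * exp (l * t) \<le> exp (l' * t)) at_top"
proof -
  have "filterlim (\<lambda>t. exp ((l' - l) * t)) at_top at_top"
    using assms by (intro filterlim_compose[OF exp_at_top] filterlim_tendsto_pos_mult_at_top[OF tendsto_const])
      (auto simp: filterlim_ident)
  then have "eventually (\<lambda>t. K \<le> exp ((l' - l) * t)) at_top" by (simp add: filterlim_at_top)
  then show ?thesis
  proof eventually_elim
    case (elim t)
    have "K * exp (l * t) \<le> exp ((l' - l) * t) * exp (l * t)" using elim by (intro mult_right_mono) auto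
    then show ?case by (simp add: left_diff_distrib flip: exp_add)
  qed
qed

locale bounded_linear_system =
  fixes A X :: "real \<Rightarrow> real^'n^'n" and a :: real
  assumes fundamental: "is_fundamental_matrix A X"
    and A_bound: "\<And>t x. 0 \<le> t \<Longrightarrow> norm (A t *v x) \<le> a * norm x"
begin

lemma X_invertible: "0 \<le> t \<Longrightarrow> invertible (X t)"
  using fundamental by (simp add: is_fundamental_matrix_def)

lemma X_solves: "0 \<le> t \<Longrightarrow> ((\<lambda>t. X t *v c) has_vector_derivative A t *v (X t *v c)) (at t within {0..})"
  using fundamental bounded_linear.has_vector_derivative[OF bounded_linear_matrix_vector_left, of X "A t ** X t" _ c]
  by (simp add: is_fundamental_matrix_def matrix_vector_mul_assoc)

text \<open>Gronwall in both time directions: with weight \<open>exp (- 2 * a * t)\<close> the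
  squared norm decreases, with weight \<open>exp (2 * a * t)\<close> it increases. The backward
  bound controls inverses of one-step matrices.\<close>

lemma solution_norm_growth:
  assumes u: "\<And>t. 0 \<le> t \<Longrightarrow> (u has_vector_derivative A t *v u t) (at t within {0..})"
    and s: "0 \<le> s" and st: "s \<le> t"
  shows "norm (u t) \<le> exp (a * (t - s)) * norm (u s)" and "norm (u s) \<le> exp (a * (t - s)) * norm (u t)"
proof -
  have "continuous_on {0..} u" using u by (intro continuous_on_vector_derivative) auto
  then have cont: "continuous_on {s..t} u" using s by (elim continuous_on_subset) auto
  have der: "((\<lambda>\<tau>. exp (c * \<tau>) * (u \<tau> \<bullet> u \<tau>)) has_real_derivative
      exp (c * \<tau>) * (c * (u \<tau> \<bullet> u \<tau>) + 2 * (u \<tau> \<bullet> (A \<tau> *v u \<tau>)))) (at \<tau>)"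
    if "s < \<tau>" for c \<tau>
  proof -
    \<comment> \<open>The derivative is two-sided only away from the boundary point 0; the strict
      inequality \<open>s < \<tau>\<close> ensures this.\<close>
    have "at \<tau> within {0..} = at \<tau>" using that s by (intro at_within_interior) (simp add: interior_real_atLeast)
    then have "(u has_vector_derivative A \<tau> *v u \<tau>) (at \<tau>)" using u[of \<tau>] that s by simp
    from bounded_bilinear.has_vector_derivative[OF bounded_bilinear_inner this this]
    have "((\<lambda>\<tau>. u \<tau> \<bullet> u \<tau>) has_real_derivative 2 * (u \<tau> \<bullet> (A \<tau> *v u \<tau>))) (at \<tau>)"
      by (simp add: has_real_derivative_iff_has_vector_derivative inner_commute)
    moreover have "((\<lambda>\<tau>. exp (c * \<tau>)) has_real_derivative c * exp (c * \<tau>)) (at \<tau>)"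
      by (auto intro!: derivative_eq_intros)
    ultimately show ?thesis using DERIV_mult by (fastforce simp: algebra_simps)
  qed
  have inner: "\<bar>u \<tau> \<bullet> (A \<tau> *v u \<tau>)\<bar> \<le> a * (u \<tau> \<bullet> u \<tau>)" if "s < \<tau>" for \<tau>
  proof -
    have "\<bar>u \<tau> \<bullet> (A \<tau> *v u \<tau>)\<bar> \<le> norm (u \<tau>) * norm (A \<tau> *v u \<tau>)" by (rule Cauchy_Schwarz_ineq2)
    also have "\<dots> \<le> norm (u \<tau>) * (a * norm (u \<tau>))" using A_bound that s by (intro mult_left_mono) auto
    finally show ?thesis by (simp add: dot_square_norm power2_eq_square mult_ac)
  qed
  have "exp (-(2 * a) * t) * (u t \<bullet> u t) \<le> exp (-(2 * a) * s) * (u s \<bullet> u s)"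
  proof (rule DERIV_nonpos_imp_decreasing_open[OF st])
    fix \<tau> assume "s < \<tau>" "\<tau> < t"
    then show "\<exists>y. ((\<lambda>\<tau>. exp (-(2 * a) * \<tau>) * (u \<tau> \<bullet> u \<tau>)) has_real_derivative y) (at \<tau>) \<and> y \<le> 0"
      using inner[of \<tau>] by (intro exI[of _ "exp (-(2 * a) * \<tau>) * (-(2 * a) * (u \<tau> \<bullet> u \<tau>) + 2 * (u \<tau> \<bullet> (A \<tau> *v u \<tau>)))"]
        conjI der) (auto simp: mult_le_0_iff)
  qed (intro continuous_intros cont)
  then have "(norm (u t))\<^sup>2 \<le> (exp (a * (t - s)) * norm (u s))\<^sup>2"
    by (simp add: power2_norm_eq_inner power_mult_distrib exp_double[symmetric] mult_ac)
      (simp add: exp_minus exp_diff right_diff_distrib field_simps flip: exp_add exp_of_nat_mult)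
  then show "norm (u t) \<le> exp (a * (t - s)) * norm (u s)" by (rule power2_le_imp_le) simp
  have "exp (2 * a * s) * (u s \<bullet> u s) \<le> exp (2 * a * t) * (u t \<bullet> u t)"
  proof (rule DERIV_nonneg_imp_increasing_open[OF st])
    fix \<tau> assume "s < \<tau>" "\<tau> < t"
    then show "\<exists>y. ((\<lambda>\<tau>. exp (2 * a * \<tau>) * (u \<tau> \<bullet> u \<tau>)) has_real_derivative y) (at \<tau>) \<and> 0 \<le> y"
      using inner[of \<tau>] by (intro exI[of _ "exp (2 * a * \<tau>) * (2 * a * (u \<tau> \<bullet> u \<tau>) + 2 * (u \<tau> \<bullet> (A \<tau> *v u \<tau>)))"]
        conjI der) (auto simp: zero_le_mult_iff)
  qed (intro continuous_intros cont)
  then have "(norm (u s))\<^sup>2 \<le> (exp (a * (t - s)) * norm (u t))\<^sup>2"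
    by (simp add: power2_norm_eq_inner power_mult_distrib exp_double[symmetric] mult_ac)
      (simp add: exp_minus exp_diff right_diff_distrib field_simps flip: exp_add exp_of_nat_mult)
  then show "norm (u s) \<le> exp (a * (t - s)) * norm (u t)" by (rule power2_le_imp_le) simp
qed

section \<open>The Cauchy matrix and the solution space\<close>

lemma matrix_inv_X: "0 \<le> t \<Longrightarrow> X t ** matrix_inv (X t) = mat 1" "0 \<le> t \<Longrightarrow> matrix_inv (X t) ** X t = mat 1"
  using someI_ex[OF X_invertible[unfolded invertible_def]] unfolding matrix_inv_def by blast+

lemma cauchy_self: "0 \<le> t \<Longrightarrow> cauchy_matrix X t t = mat 1"
  by (simp add: cauchy_matrix_def matrix_inv_X)

lemma cauchy_cocycle:
  assumes "0 \<le> s" shows "cauchy_matrix X t s ** cauchy_matrix X s r = cauchy_matrix X t r"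
proof -
  have "cauchy_matrix X t s ** cauchy_matrix X s r = X t ** ((matrix_inv (X s) ** X s) ** matrix_inv (X r))"
    by (simp only: cauchy_matrix_def matrix_mul_assoc)
  then show ?thesis using assms by (simp add: matrix_inv_X cauchy_matrix_def)
qed

lemma cauchy_invertible: "0 \<le> s \<Longrightarrow> 0 \<le> t \<Longrightarrow> invertible (cauchy_matrix X t s)"
  unfolding invertible_def using cauchy_cocycle[of s t t] cauchy_cocycle[of t s s] cauchy_self by metis

lemma onorm_cauchy_le:
  assumes s: "0 \<le> s" and t: "0 \<le> t"
  shows "onorm ((*v) (cauchy_matrix X t s)) \<le> exp (a * \<bar>t - s\<bar>)"
proof (rule onorm_le)
  fix x
  let ?u = "\<lambda>\<tau>. X \<tau> *v (matrix_inv (X s) *v x)"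
  have us: "?u s = x" using s by (simp add: matrix_vector_mul_assoc matrix_inv_X)
  have ut: "?u t = cauchy_matrix X t s *v x" by (simp add: matrix_vector_mul_assoc cauchy_matrix_def)
  show "norm (cauchy_matrix X t s *v x) \<le> exp (a * \<bar>t - s\<bar>) * norm x"
  proof (cases "s \<le> t")
    case True
    then show ?thesis using solution_norm_growth(1)[OF X_solves[where c = "matrix_inv (X s) *v x"] s True] us ut by simp
  next
    case False
    then show ?thesis using solution_norm_growth(2)[OF X_solves[where c = "matrix_inv (X s) *v x"] t, of s] us ut by simp
  qed
qed

text \<open>The value 0 at negative times matches \<open>is_solution\<close>, so that this becomes a
  linear bijection from coefficient vectors onto solutions.\<close>

definition solution_of :: "real^'n \<Rightarrow> real \<Rightarrow> real^'n" where
  "solution_of c = (\<lambda>t. if 0 \<le> t then X t *v c else 0)"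

lemma solution_of_is_solution: "is_solution A (solution_of c)"
  unfolding is_solution_def
proof (intro conjI allI impI)
  fix t :: real assume t: "0 \<le> t"
  show "(solution_of c has_vector_derivative A t *v solution_of c t) (at t within {0..})"
    using t X_solves[OF t, of c]
    by (intro has_vector_derivative_transform[of t "{0..}" "solution_of c" "\<lambda>t. X t *v c"]) (auto simp: solution_of_def)
qed (simp add: solution_of_def)

lemma inj_solution_of: "inj solution_of"
proof (rule injI)
  fix c d assume "solution_of c = solution_of d"
  then have "X 0 *v c = X 0 *v d" by (auto simp: solution_of_def dest!: fun_cong[of _ _ 0])
  then show "c = d" using inj_matrix_vector_mult[OF X_invertible[of 0]] by (simp add: inj_def)
qed

lemma solution_is_solution_of:
  assumes x: "is_solution A x"
  obtains c where "x = solution_of c"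
proof -
  define c where "c = matrix_inv (X 0) *v x 0"
  let ?u = "\<lambda>t. x t - X t *v c"
  have u: "(?u has_vector_derivative A t *v ?u t) (at t within {0..})" if "0 \<le> t" for t
    using x that X_solves[OF that, of c]
    by (auto simp: is_solution_def matrix_vector_mult_diff_distrib intro!: derivative_eq_intros)
  have "?u 0 = 0" by (simp add: c_def matrix_vector_mul_assoc matrix_inv_X)
  then have "?u t = 0" if "0 \<le> t" for t
    using solution_norm_growth(1)[OF u order_refl that] by simp
  then have "x = solution_of c" using x by (auto simp: solution_of_def is_solution_def fun_eq_iff)
  then show ?thesis by (rule that)
qed

lemma linear_solution_of: "Vector_Spaces.linear scaleR scale_fun solution_of"
  by unfold_locales
    (auto simp: solution_of_def scale_fun_def fun_eq_iff plus_fun_def matrix_vector_right_distrib matrix_vector_mult_scaleR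
      scaleR_add_right scaleR_add_left)

text \<open>Moves the multiplicities, defined by dimensions in a function space, to dimensions of
  subspaces of coefficient vectors.\<close>

lemma solspace_dim_image: "solspace.dim (solution_of ` S) = dim S"
proof -
  interpret finite_dimensional_vector_space_pair_1 "scaleR :: real \<Rightarrow> real^'n \<Rightarrow> real^'n" Basis
    "scale_fun :: real \<Rightarrow> (real \<Rightarrow> real^'n) \<Rightarrow> real \<Rightarrow> real^'n"
    by unfold_locales
  show ?thesis using dim_image_eq[OF linear_solution_of inj_on_subset[OF inj_solution_of]] by (simp add: dim_raw_def)
qed

definition growth_space :: "real \<Rightarrow> (real^'n) set" where
  "growth_space l = {c. \<forall>e>0. eventually (\<lambda>t. norm (X t *v c) \<le> exp ((l + e) * t)) at_top}"

lemma lyapunov_exponent_solution_of: "lyapunov_exponent (solution_of c) \<le> ereal l \<longleftrightarrow> c \<in> growth_space l"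
proof -
  have "eventually (\<lambda>t. solution_of c t = X t *v c) at_top"
    using eventually_ge_at_top[of 0] by eventually_elim (simp add: solution_of_def)
  then have "eventually (\<lambda>t. norm (solution_of c t) \<le> exp ((l + e) * t)) at_top \<longleftrightarrow>
      eventually (\<lambda>t. norm (X t *v c) \<le> exp ((l + e) * t)) at_top" for e
    by (intro eventually_subst) (auto elim: eventually_mono)
  then show ?thesis by (simp add: lyapunov_exponent_le_iff growth_space_def)
qed

lemma subspace_growth_space: "subspace (growth_space l)"
proof (rule subspaceI)
  show "0 \<in> growth_space l" by (simp add: growth_space_def)
next
  have absorb: "eventually (\<lambda>t. K * exp ((l + e / 2) * t) \<le> exp ((l + e) * t)) at_top" if "0 < e" for e K :: real
    using that by (intro eventually_exp_absorbs) simp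
  fix c d assume c: "c \<in> growth_space l" and d: "d \<in> growth_space l"
  show "c + d \<in> growth_space l"
    unfolding growth_space_def
  proof (intro CollectI allI impI)
    fix e :: real assume e: "0 < e"
    then have "eventually (\<lambda>t. norm (X t *v c) \<le> exp ((l + e / 2) * t)) at_top"
      "eventually (\<lambda>t. norm (X t *v d) \<le> exp ((l + e / 2) * t)) at_top"
      using c d half_gt_zero[OF e] by (auto simp only: growth_space_def mem_Collect_eq)
    then show "eventually (\<lambda>t. norm (X t *v (c + d)) \<le> exp ((l + e) * t)) at_top"
      using absorb[OF e, of 2]
    proof eventually_elim
      case (elim t)
      then show ?case using norm_triangle_ineq[of "X t *v c" "X t *v d"]
        by (simp add: matrix_vector_right_distrib)
    qed
  qed
next
  have absorb: "eventually (\<lambda>t. K * exp ((l + e / 2) * t) \<le> exp ((l + e) * t)) at_top" if "0 < e" for e K :: real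
    using that by (intro eventually_exp_absorbs) simp
  fix r :: real and c assume c: "c \<in> growth_space l"
  show "r *\<^sub>R c \<in> growth_space l"
    unfolding growth_space_def
  proof (intro CollectI allI impI)
    fix e :: real assume e: "0 < e"
    have "eventually (\<lambda>t. norm (X t *v c) \<le> exp ((l + e / 2) * t)) at_top"
      using c half_gt_zero[OF e] by (auto simp only: growth_space_def mem_Collect_eq)
    then show "eventually (\<lambda>t. norm (X t *v (r *\<^sub>R c)) \<le> exp ((l + e) * t)) at_top"
      using absorb[OF e, of "\<bar>r\<bar>"]
    proof eventually_elim
      case (elim t)
      have "\<bar>r\<bar> * norm (X t *v c) \<le> \<bar>r\<bar> * exp ((l + e / 2) * t)" using elim by (intro mult_left_mono) auto
      then show ?case using elim by (simp add: matrix_vector_mult_scaleR)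
    qed
  qed
qed

end

section \<open>Exponential growth of the exterior powers of a fundamental matrix\<close>

lemma det_image_family:
  fixes M :: "real^'n^'n"
  shows "det (\<chi> i. M *v b i) = det M * det (\<chi> i. b i)"
proof -
  have "(\<chi> i. M *v b i) = (\<chi> i. b i) ** transpose M"
    by (simp add: vec_eq_iff matrix_vector_mult_def matrix_matrix_mult_def transpose_def mult.commute)
  then show ?thesis by (simp add: det_mul)
qed

lemma prod_exp_growth: "(\<Prod>i\<in>T. exp ((g i + e) * t)) = exp (((\<Sum>i\<in>T. g i) + real (card T) * e) * t)"
proof (cases "finite T")
  case True
  then have "(\<Prod>i\<in>T. exp ((g i + e) * t)) = exp (\<Sum>i\<in>T. (g i + e) * t)" by (rule exp_sum[symmetric])
  then show ?thesis by (simp add: sum_distrib_right[symmetric] sum.distrib)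
qed simp

lemma exp_mono_arg: "(\<mu>::real) \<le> \<nu> \<Longrightarrow> 0 \<le> t \<Longrightarrow> exp (\<mu> * t) \<le> exp (\<nu> * t)"
  by (simp add: mult_right_mono)

lemma adapted_basis_exists:
  fixes A X :: "real \<Rightarrow> 'n::{finite,linorder} sqmat"
  assumes sys: "bounded_linear_system A X a" and spec: "has_lyapunov_spectrum A q lam m"
    and q: "1 \<le> q"
  obtains b :: "'n \<Rightarrow> (real, 'n) vec" and lev :: "'n \<Rightarrow> nat"
  where "inj b" "independent (range b)" "\<And>i j. i \<le> j \<Longrightarrow> lev i \<le> lev j"
      "\<And>i. lev i \<in> {1..q}"
      "\<And>i e. 0 < e \<Longrightarrow> eventually (\<lambda>t. norm (X t *v b i) \<le> exp ((lam (lev i) + e) * t)) at_top"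
      "\<And>j. j \<in> {1..q} \<Longrightarrow> card {i. lev i = j} = m j"
proof -
  interpret bounded_linear_system A X a by (rule sys)
  have lam: "lam j < lam i" if "i \<in> {1..q}" "j \<in> {1..q}" "i < j" for i j
    using spec that by (auto simp: has_lyapunov_spectrum_def)
  have zero: "solution_of 0 = 0" by (simp add: solution_of_def fun_eq_iff)
  define E where "E k = (if k = q + 1 then {0} else growth_space (lam k))" for k
  have filt: "lyap_filtration A q lam k = solution_of ` E k" for k
  proof (cases "k = q + 1")
    case True then show ?thesis by (simp add: E_def lyap_filtration_def zero)
  next
    case False
    have "{x. is_solution A x \<and> lyapunov_exponent x \<le> ereal (lam k)} = solution_of ` growth_space (lam k)"
    proof (intro set_eqI iffI)
      fix x assume x: "x \<in> {x. is_solution A x \<and> lyapunov_exponent x \<le> ereal (lam k)}"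
      then obtain c where "x = solution_of c" using solution_is_solution_of by blast
      then show "x \<in> solution_of ` growth_space (lam k)" using x lyapunov_exponent_solution_of by auto
    next
      fix x assume "x \<in> solution_of ` growth_space (lam k)"
      then show "x \<in> {x. is_solution A x \<and> lyapunov_exponent x \<le> ereal (lam k)}"
        using lyapunov_exponent_solution_of solution_of_is_solution by auto
    qed
    then show ?thesis using False by (simp add: E_def lyap_filtration_def)
  qed
  have mult: "m i = dim (E i) - dim (E (i + 1))" if "i \<in> {1..q}" for i
    using spec that by (simp add: has_lyapunov_spectrum_def filt solspace_dim_image del: One_nat_def)
  have sub: "subspace (E k)" for k by (simp add: E_def subspace_growth_space)
  have dec: "E (k + 1) \<subseteq> E k" if k: "k \<in> {1..q}" for k
  proof (cases "k = q")
    case True then show ?thesis using subspace_0[OF sub[of q]] by (simp add: E_def)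
  next
    case False
    then have "lam (k + 1) < lam k" using k by (intro lam) auto
    then have "c \<in> growth_space (lam k)" if "c \<in> growth_space (lam (k + 1))" for c
      using that unfolding lyapunov_exponent_solution_of[symmetric]
      by (elim order_trans) simp
    then show ?thesis using False k by (auto simp: E_def)
  qed
  \<comment> \<open>Every nonzero solution has one of the listed exponents, and \<open>lam 1\<close>
    is the largest of them.\<close>
  have E1: "E 1 = UNIV"
  proof -
    have "c \<in> growth_space (lam 1)" for c
    proof (cases "c = 0")
      case True then show ?thesis by (simp add: subspace_0[OF subspace_growth_space])
    next
      case False
      then have "solution_of c \<noteq> 0" using inj_solution_of zero by (metis injD)
      then have "lyapunov_exponent (solution_of c) \<in> (\<lambda>i. ereal (lam i)) ` {1..q}"
        using spec solution_of_is_solution unfolding has_lyapunov_spectrum_def by blast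
      then obtain i where i: "i \<in> {1..q}" "lyapunov_exponent (solution_of c) = ereal (lam i)" by auto
      have "lam i \<le> lam 1" using i(1) lam[of 1 i] q by (cases "i = 1") (auto intro: less_imp_le)
      then show ?thesis using i(2) by (simp add: lyapunov_exponent_solution_of[symmetric])
    qed
    then show ?thesis using q by (auto simp: E_def)
  qed
  obtain b :: "'n \<Rightarrow> (real, 'n) vec" and lev :: "'n \<Rightarrow> nat"
    where b: "inj b" "independent (range b)" "\<And>i j. i \<le> j \<Longrightarrow> lev i \<le> lev j"
      "\<And>i. lev i \<in> {1..q}" "\<And>i. b i \<in> E (lev i)"
      "\<And>j. j \<in> {1..q} \<Longrightarrow> card {i. lev i = j} = dim (E j) - dim (E (j + 1))"
    using filtration_adapted_basis[of q E] sub dec E1 by (auto simp: E_def)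
  show ?thesis
  proof (rule that[OF b(1,2,3,4)])
    show "eventually (\<lambda>t. norm (X t *v b i) \<le> exp ((lam (lev i) + e) * t)) at_top" if "0 < e" for i e
      using b(5)[of i] b(4)[of i] that by (auto simp: E_def growth_space_def)
    show "card {i. lev i = j} = m j" if "j \<in> {1..q}" for j using b(6)[OF that] mult[OF that] by simp
  qed
qed

text \<open>Upper bound: among injective choices of adapted basis vectors the first \<open>L\<close>
  have the largest product of growth bounds. Lower bound: by regularity the determinant eventually
  grows almost at the sum of all exponents; removing the share of the slow vectors outside
  \<open>S\<close> leaves \<Lambda> for the exterior power.\<close>

lemma ext_norm_growth:
  fixes A X :: "real \<Rightarrow> 'n::{finite,linorder} sqmat"
  assumes sys: "bounded_linear_system A X a" and spec: "has_lyapunov_spectrum A q lam m"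
    and reg: "regular_system X q lam m" and l: "l \<in> {1..q}"
    and L: "L = (\<Sum>j=1..l. m j)" and \<Lambda>: "\<Lambda> = (\<Sum>j=1..l. real (m j) * lam j)"
    and S: "S = (initial_segment L :: 'n set)"
  shows "L \<le> CARD('n)"
    and "\<And>e. 0 < e \<Longrightarrow> eventually (\<lambda>t. ext_norm S (X t) \<le> exp ((\<Lambda> + e) * t)) at_top"
    and "\<And>e. 0 < e \<Longrightarrow> eventually (\<lambda>t. exp ((\<Lambda> - e) * t) \<le> ext_norm S (X t)) at_top"
proof -
  interpret bounded_linear_system A X a by (rule sys)
  have q: "1 \<le> q" using l by simp
  obtain b :: "'n \<Rightarrow> (real, 'n) vec" and lev :: "'n \<Rightarrow> nat"
    where b: "inj b" "independent (range b)" and mono: "\<And>i j. i \<le> j \<Longrightarrow> lev i \<le> lev j"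
      and lev: "\<And>i. lev i \<in> {1..q}"
      and growth: "\<And>i e. 0 < e \<Longrightarrow> eventually (\<lambda>t. norm (X t *v b i) \<le> exp ((lam (lev i) + e) * t)) at_top"
      and card: "\<And>j. j \<in> {1..q} \<Longrightarrow> card {i. lev i = j} = m j"
    by (rule adapted_basis_exists[OF sys spec q]) (rule that; assumption)
  have lam: "lam j \<le> lam i" if "i \<in> {1..q}" "j \<in> {1..q}" "i \<le> j" for i j
    using spec that by (cases "i = j") (auto simp: has_lyapunov_spectrum_def intro: less_imp_le)
  \<comment> \<open>Sums over basis indices are regrouped by level; level \<open>j\<close> occurs
    \<open>m j\<close> times.\<close>
  have group: "(\<Sum>i\<in>{i. lev i \<le> k}. f (lev i)) = (\<Sum>j=1..k. real (m j) * f j)" if k: "k \<le> q" for f k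
  proof -
    have "(\<Sum>i\<in>{i. lev i \<le> k}. f (lev i)) = (\<Sum>j=1..k. \<Sum>i\<in>{i \<in> {i. lev i \<le> k}. lev i = j}. f (lev i))"
      using lev by (intro sum.group[symmetric]) auto
    also have "\<dots> = (\<Sum>j=1..k. real (m j) * f j)"
    proof (rule sum.cong[OF refl])
      fix j assume j: "j \<in> {1..k}"
      then have "{i \<in> {i. lev i \<le> k}. lev i = j} = {i. lev i = j}" by auto
      then show "(\<Sum>i\<in>{i \<in> {i. lev i \<le> k}. lev i = j}. f (lev i)) = real (m j) * f j"
        using card[of j] j k by simp
    qed
    finally show ?thesis .
  qed
  have "real (card {i. lev i \<le> l}) = real L"
    using group[of l "\<lambda>_. 1"] l by (simp add: L)
  then have cardT: "card {i. lev i \<le> l} = L" by simp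
  then show Lle: "L \<le> CARD('n)" by (metis card_mono finite subset_UNIV)
  have "{i. lev i \<le> l} = initial_segment L"
    unfolding cardT[symmetric] using mono
    by (intro lower_set_eq_initial_segment) (auto intro: order_trans)
  then have S': "S = {i. lev i \<le> l}" by (simp add: S)
  have sumS: "(\<Sum>i\<in>S. lam (lev i)) = \<Lambda>" using group[of l lam] l by (simp add: S' \<Lambda>)
  have "{i. lev i \<le> q} = UNIV" using lev by auto
  then have sumU: "(\<Sum>i\<in>UNIV. lam (lev i)) = (\<Sum>j=1..q. real (m j) * lam j)" using group[of q lam] by simp
  have sumC: "(\<Sum>i\<in>UNIV. lam (lev i)) = (\<Sum>i\<in>-S. lam (lev i)) + \<Lambda>"
    unfolding sumS[symmetric] by (subst sum.union_disjoint[symmetric]) (auto simp: Compl_partition2)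
  have low: "\<forall>i\<in>S. \<forall>j\<le>i. j \<in> S" unfolding S by (rule initial_segment_lower)
  obtain K where K: "\<And>x. norm x \<le> 1 \<Longrightarrow> \<exists>c. x = (\<Sum>a\<in>UNIV. c a *\<^sub>R b a) \<and> (\<forall>a. \<bar>c a\<bar> \<le> K)"
    and det: "det (\<chi> i. b i) \<noteq> 0" by (rule basis_coefficients_bounded[OF b]) (rule that; assumption)
  have K0: "0 \<le> K" using K[of 0] by (auto intro: order_trans[OF abs_ge_zero])
  let ?N = "real CARD('n)"
  have all: "eventually (\<lambda>t. \<forall>i. norm (X t *v b i) \<le> exp ((lam (lev i) + e) * t)) at_top" if "0 < e" for e
    using eventually_ball_finite[of UNIV "\<lambda>t i. norm (X t *v b i) \<le> exp ((lam (lev i) + e) * t)" at_top]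
      growth[OF that] by simp
  have cardle: "real (card T) \<le> ?N" for T :: "'n set" by (simp add: card_mono)
  show "eventually (\<lambda>t. ext_norm S (X t) \<le> exp ((\<Lambda> + e) * t)) at_top" if e: "0 < e" for e
  proof -
    \<comment> \<open>Each of the at most \<open>?N\<close> slots loses a rate \<open>d\<close>, and
      the denominator keeps the total strictly below \<open>e\<close>.\<close>
    define d where "d = e / (?N + 1)"
    have d: "0 < d" using e by (simp add: d_def add_pos_nonneg)
    have "?N * d < e" using e by (simp add: d_def field_simps)
    then have lt: "\<Lambda> + real (card S) * d < \<Lambda> + e"
      using mult_right_mono[OF cardle[of S], of d] d by linarith
    let ?P = "real (card (S \<rightarrow>\<^sub>E (UNIV::'n set)))"
    from all[OF d] eventually_exp_absorbs[OF lt, of "K ^ card S * ?P"] eventually_ge_at_top[of 0]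
    show ?thesis
    proof eventually_elim
      case (elim t)
      let ?s = "\<lambda>i. exp ((lam (lev i) + d) * t)"
      have "ext_norm S (X t) \<le> K ^ card S * (\<Sum>f\<in>S \<rightarrow>\<^sub>E UNIV. wedge_norm S (\<lambda>i. X t *v b (f i)))"
        by (rule ext_norm_le_sum[OF K])
      also have "\<dots> \<le> K ^ card S * (\<Sum>f\<in>S \<rightarrow>\<^sub>E (UNIV::'n set). \<Prod>i\<in>S. ?s i)"
      proof (intro mult_left_mono sum_mono)
        fix f :: "'n \<Rightarrow> 'n"
        show "wedge_norm S (\<lambda>i. X t *v b (f i)) \<le> (\<Prod>i\<in>S. ?s i)"
        proof (cases "inj_on f S")
          case True
          have "wedge_norm S (\<lambda>i. X t *v b (f i)) \<le> (\<Prod>i\<in>S. norm (X t *v b (f i)))"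
            by (rule wedge_norm_le_prod_norm)
          also have "\<dots> \<le> (\<Prod>i\<in>S. ?s (f i))" using elim(1) by (intro prod_mono) auto
          also have "\<dots> \<le> (\<Prod>i\<in>S. ?s i)"
          proof (rule prod_image_le_prod_antimono[OF _ _ low True])
            fix i j :: 'n assume "i \<le> j"
            then show "?s j \<le> ?s i" using mono lam lev elim(3) by (intro exp_mono_arg) auto
          qed simp
          finally show ?thesis .
        next
          case False
          then have "\<not> inj_on (\<lambda>i. X t *v b (f i)) S" unfolding inj_on_def by metis
          then show ?thesis by (simp add: wedge_norm_eq_0 prod_nonneg)
        qed
      qed (use K0 in auto)
      also have "\<dots> = (K ^ card S * ?P) * exp ((\<Lambda> + real (card S) * d) * t)"
        by (simp only: sum_constant prod_exp_growth sumS mult.assoc)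
      also have "\<dots> \<le> exp ((\<Lambda> + e) * t)" by (rule elim(2))
      finally show ?case .
    qed
  qed
  show "eventually (\<lambda>t. exp ((\<Lambda> - e) * t) \<le> ext_norm S (X t)) at_top" if e: "0 < e" for e
  proof -
    \<comment> \<open>Besides the slots outside \<open>S\<close>, the determinant itself loses one
      more \<open>d\<close>, since the limit inferior gives only a rate just below
      \<open>?U\<close>.\<close>
    define d where "d = e / (?N + 2)"
    have d: "0 < d" using e by (simp add: d_def add_pos_nonneg)
    have "(?N + 1) * d < e" using e by (simp add: d_def field_simps)
    then have lt: "\<Lambda> - e < \<Lambda> - d - real (card (-S)) * d"
      using mult_right_mono[OF cardle[of "-S"], of d] d distrib_right[of ?N 1 d] by linarith
    let ?U = "\<Sum>i\<in>UNIV. lam (lev i)"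
    have "eventually (\<lambda>t. ereal (?U - d) < ereal (1 / t * ln \<bar>det (X t)\<bar>)) at_top"
    proof -
      have "ereal ?U \<le> Liminf at_top (\<lambda>t. ereal (1 / t * ln \<bar>det (X t)\<bar>))"
        using reg by (simp add: regular_system_def sumU)
      moreover have "ereal (?U - d) < ereal ?U" using d by simp
      ultimately show ?thesis unfolding le_Liminf_iff by blast
    qed
    define P where "P = fact CARD('n) * (\<Prod>i\<in>S. norm (b i))"
    have P0: "0 \<le> P" by (simp add: P_def prod_nonneg)
    have det': "0 < \<bar>det (\<chi> i. b i)\<bar>" using det by simp
    from \<open>eventually (\<lambda>t. ereal (?U - d) < ereal (1 / t * ln \<bar>det (X t)\<bar>)) at_top\<close> all[OF d]
      eventually_exp_absorbs[OF lt, of "P / \<bar>det (\<chi> i. b i)\<bar>"] eventually_gt_at_top[of 0]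
    show ?thesis
    proof eventually_elim
      case (elim t)
      let ?D = "\<bar>det (\<chi> i. b i)\<bar>"
      let ?g = "ext_norm S (X t)"
      have detX: "0 < \<bar>det (X t)\<bar>" using X_invertible[of t] elim(4) by (simp add: invertible_det_nz)
      have "?U - d < ln \<bar>det (X t)\<bar> / t" using elim(1) by simp
      then have "(?U - d) * t \<le> ln \<bar>det (X t)\<bar>" using elim(4) by (simp add: field_simps)
      then have "exp ((?U - d) * t) \<le> \<bar>det (X t)\<bar>" using detX by (simp add: ln_ge_iff)
      then have "exp ((?U - d) * t) * ?D \<le> \<bar>det (X t)\<bar> * ?D" by (intro mult_right_mono) auto
      also have "\<dots> = \<bar>det (\<chi> i. X t *v b i)\<bar>" by (simp add: det_image_family abs_mult)
      also have "\<dots> \<le> fact CARD('n) * (\<Prod>i\<in>-S. norm (X t *v b i)) * (?g * (\<Prod>i\<in>S. norm (b i)))"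
        by (rule det_le_ext_norm)
      also have "\<dots> = (\<Prod>i\<in>-S. norm (X t *v b i)) * (P * ?g)" by (simp add: P_def)
      also have "\<dots> \<le> (\<Prod>i\<in>-S. exp ((lam (lev i) + d) * t)) * (P * ?g)"
        using elim(2) P0 ext_norm_nonneg by (intro mult_right_mono prod_mono mult_nonneg_nonneg) auto
      also have "\<dots> = exp (((\<Sum>i\<in>-S. lam (lev i)) + real (card (-S)) * d) * t) * (P * ?g)"
        by (simp only: prod_exp_growth)
      finally have le: "exp ((?U - d) * t) * ?D \<le> exp (((\<Sum>i\<in>-S. lam (lev i)) + real (card (-S)) * d) * t) * (P * ?g)" .
      have split: "exp ((?U - d) * t) = exp ((\<Lambda> - d - real (card (-S)) * d) * t) *
          exp (((\<Sum>i\<in>-S. lam (lev i)) + real (card (-S)) * d) * t)"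
        unfolding sumC by (simp add: algebra_simps flip: exp_add)
      have main: "exp ((\<Lambda> - d - real (card (-S)) * d) * t) * ?D \<le> P * ?g"
        using le unfolding split by (simp add: mult_ac)
      \<comment> \<open>The left side of \<open>main\<close> is positive, so the nonnegative factor
        \<open>P\<close> cannot be zero.\<close>
      have "P > 0"
        using main det' mult_pos_pos[OF exp_gt_zero det', of "(\<Lambda> - d - real (card (-S)) * d) * t"] P0
        by (cases "P = 0") auto
      moreover have "P * exp ((\<Lambda> - e) * t) \<le> exp ((\<Lambda> - d - real (card (-S)) * d) * t) * ?D"
        using elim(3) det' by (simp add: field_simps)
      then have "P * exp ((\<Lambda> - e) * t) \<le> P * ?g" using main by (rule order_trans)
      ultimately show ?case by (simp add: mult_le_cancel_left_pos)
    qed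
  qed
qed

section \<open>Exterior powers of the numerical cocycle\<close>

lemma step_product_shift:
  "step_product F (N + n) = step_product (\<lambda>k. F (N + k)) n ** step_product F N"
  by (induction n) (simp_all add: matrix_mul_assoc)

lemma step_product_invertible:
  fixes F :: "nat \<Rightarrow> real^'n^'n"
  assumes "\<And>n. invertible (F (Suc n))"
  shows "invertible (step_product F n)"
  using assms by (induction n) (auto intro: invertible_mult simp: invertible_def[of "mat 1"])

lemma prod_le_exp_sum:
  fixes x :: "'a \<Rightarrow> real"
  assumes "\<And>i. i \<in> A \<Longrightarrow> 0 \<le> x i"
  shows "(\<Prod>i\<in>A. 1 + x i) \<le> exp (\<Sum>i\<in>A. x i)"
proof (cases "finite A")
  case True
  have "(\<Prod>i\<in>A. 1 + x i) \<le> (\<Prod>i\<in>A. exp (x i))" using assms by (intro prod_mono) (auto simp: exp_ge_add_one_self)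
  then show ?thesis using True by (simp add: exp_sum)
qed simp

text \<open>Rewrites the hypothesis on singular values as a converse to submultiplicativity of
  \<open>ext_norm\<close> along the trajectory. Two factors \<open>c\<close> come from the upper
  comparison on the left side, the factorial from the lower comparison on the right.\<close>

lemma strongly_fast_invertible_ext_norm:
  fixes A X :: "real \<Rightarrow> 'n::{finite,linorder} sqmat"
  assumes sys: "bounded_linear_system A X a" and sfi: "strongly_fast_invertible X L" and L: "L \<le> CARD('n)"
    and S: "S = (initial_segment L :: 'n set)"
  obtains C where "0 \<le> C" "\<And>t s u. s \<le> t \<Longrightarrow> u \<le> s \<Longrightarrow> 0 \<le> u \<Longrightarrow>
    ext_norm S (cauchy_matrix X t s) * ext_norm S (cauchy_matrix X s u) \<le> C * ext_norm S (cauchy_matrix X t u)"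
proof -
  interpret bounded_linear_system A X a by (rule sys)
  let ?\<pi> = "\<lambda>M. \<Prod>k=1..L. \<sigma> k M"
  let ?G = "\<lambda>t s. ext_norm S (cauchy_matrix X t s)"
  define c where "c = real (card (S \<rightarrow>\<^sub>E (UNIV :: 'n set)))"
  obtain B0 where B0: "\<And>t s u. s \<le> t \<Longrightarrow> u \<le> s \<Longrightarrow> 0 \<le> u \<Longrightarrow>
     (\<Prod>k=1..L. \<sigma> k (cauchy_matrix X t s) * \<sigma> k (cauchy_matrix X s u) / \<sigma> k (cauchy_matrix X t u)) \<le> B0"
    using sfi unfolding strongly_fast_invertible_def bdd_above_def by blast
  define B where "B = max 0 B0"
  have B: "?\<pi> (cauchy_matrix X t s) * ?\<pi> (cauchy_matrix X s u) \<le> B * ?\<pi> (cauchy_matrix X t u)"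
    if "s \<le> t" "u \<le> s" "0 \<le> u" for t s u
  proof -
    have inv: "invertible (cauchy_matrix X t u)" using that by (intro cauchy_invertible) auto
    have "?\<pi> (cauchy_matrix X t s) * ?\<pi> (cauchy_matrix X s u) / ?\<pi> (cauchy_matrix X t u) \<le> B"
      using B0[OF that] by (simp add: B_def prod_dividef prod.distrib)
    then show ?thesis using prod_singular_values_ext_norm(1)[OF inv L] by (simp add: pos_divide_le_eq)
  qed
  show ?thesis
  proof (rule that[of "c * c * B * fact CARD('n)"])
    show "0 \<le> c * c * B * fact CARD('n)" by (simp add: B_def c_def)
    fix t s u :: real assume *: "s \<le> t" "u \<le> s" "0 \<le> u"
    have inv: "invertible (cauchy_matrix X t s)" "invertible (cauchy_matrix X s u)" "invertible (cauchy_matrix X t u)"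
      using * by (auto intro!: cauchy_invertible)
    have c0: "0 \<le> c" by (simp add: c_def)
    have "?G t s * ?G s u \<le> (c * ?\<pi> (cauchy_matrix X t s)) * (c * ?\<pi> (cauchy_matrix X s u))"
      using prod_singular_values_ext_norm(3)[OF inv(1) L, folded S] prod_singular_values_ext_norm(3)[OF inv(2) L, folded S]
        prod_singular_values_ext_norm(1)[OF inv(1) L, folded S] c0 unfolding c_def[symmetric]
      by (intro mult_mono ext_norm_nonneg) (auto intro: less_imp_le)
    also have "\<dots> = c * c * (?\<pi> (cauchy_matrix X t s) * ?\<pi> (cauchy_matrix X s u))" by simp
    also have "\<dots> \<le> c * c * (B * (fact CARD('n) * ?G t u))"
    proof (intro mult_left_mono)
      show "?\<pi> (cauchy_matrix X t s) * ?\<pi> (cauchy_matrix X s u) \<le> B * (fact CARD('n) * ?G t u)"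
        by (rule order_trans[OF B[OF *]], rule mult_left_mono[OF prod_singular_values_ext_norm(2)[OF inv(3) L, folded S]])
          (simp add: B_def)
    qed (simp add: c0)
    finally show "?G t s * ?G s u \<le> c * c * B * fact CARD('n) * ?G t u" by (simp add: mult_ac)
  qed
qed

text \<open>The upper bound compares all steps with the exact cocycle, where an error factor
  \<open>exp (suminf e)\<close> is harmless. The lower bound starts at a step \<open>N\<close> from
  which the total error is below one half.\<close>

lemma ext_norm_step_product:
  fixes A X :: "real \<Rightarrow> real^'n^'n" and S :: "'i::finite set" and F :: "nat \<Rightarrow> real^'n^'n" and \<tau> \<epsilon> :: "nat \<Rightarrow> real"
  assumes sys: "bounded_linear_system A X a" and a: "0 \<le> a"
    and \<tau>0: "\<tau> 0 = 0" and \<tau>: "\<And>n. \<tau> n \<le> \<tau> (Suc n)" "\<And>n. \<tau> (Suc n) - \<tau> n \<le> H"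
    and F: "\<And>n. invertible (F (Suc n))"
    and diff: "\<And>n. onorm ((*v) (F (Suc n) - cauchy_matrix X (\<tau> (Suc n)) (\<tau> n))) \<le> \<epsilon> (Suc n)"
    and sum: "summable (\<lambda>n. \<epsilon> (Suc n))"
    and C0: "0 \<le> C" and C: "\<And>t s u. s \<le> t \<Longrightarrow> u \<le> s \<Longrightarrow> 0 \<le> u \<Longrightarrow>
      ext_norm S (cauchy_matrix X t s) * ext_norm S (cauchy_matrix X s u) \<le> C * ext_norm S (cauchy_matrix X t u)"
  obtains K where "eventually (\<lambda>n. ext_norm S (step_product F n) \<le> K * ext_norm S (X (\<tau> n))) sequentially"
    and "eventually (\<lambda>n. ext_norm S (X (\<tau> n)) \<le> K * ext_norm S (step_product F n)) sequentially"
proof -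
  interpret bounded_linear_system A X a by (rule sys)
  have mono: "\<tau> m \<le> \<tau> n" if "m \<le> n" for m n using that \<tau>(1) by (rule lift_Suc_mono_le[rotated])
  have \<tau>nn: "0 \<le> \<tau> n" for n using mono[of 0 n] \<tau>0 by simp
  let ?c = "\<lambda>n k. cauchy_matrix X (\<tau> n) (\<tau> k)"
  have \<epsilon>0: "0 \<le> \<epsilon> (Suc n)" for n using diff[of n] onorm_matrix_nonneg order_trans by blast
  obtain E where E: "\<And>n. \<epsilon> (Suc n) \<le> E"
  proof -
    have "bounded (range (\<lambda>n. \<epsilon> (Suc n)))" by (rule summable_imp_bounded[OF sum])
    then obtain E where "\<And>n. norm (\<epsilon> (Suc n)) \<le> E" unfolding bounded_iff by auto
    then show ?thesis using that[of E] by (auto simp: abs_le_iff)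
  qed
  \<comment> \<open>One bound for the exact and the computed one-step matrices; the extra 1 secures
    \<open>1 \<le> \<alpha>\<close>, as required for exchanging slots.\<close>
  define \<alpha> where "\<alpha> = exp (a * H) + 1 + E"
  have E0: "0 \<le> E" using E[of 0] \<epsilon>0[of 0] by simp
  have H0: "0 \<le> H" using \<tau>(1)[of 0] \<tau>(2)[of 0] by linarith
  have \<alpha>: "1 \<le> \<alpha>" using E0 by (simp add: \<alpha>_def)
  have P: "onorm ((*v) (?c (Suc n) n)) \<le> exp (a * H)" "onorm ((*v) (?c n (Suc n))) \<le> exp (a * H)" for n
  proof -
    have "\<bar>\<tau> (Suc n) - \<tau> n\<bar> \<le> H" using \<tau>(1)[of n] \<tau>(2)[of n] by simp
    then have le: "a * \<bar>\<tau> (Suc n) - \<tau> n\<bar> \<le> a * H" using a by (rule mult_left_mono)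
    show "onorm ((*v) (?c (Suc n) n)) \<le> exp (a * H)"
      using onorm_cauchy_le[OF \<tau>nn[of n] \<tau>nn[of "Suc n"]] le by (meson exp_le_cancel_iff order_trans)
    show "onorm ((*v) (?c n (Suc n))) \<le> exp (a * H)"
      using onorm_cauchy_le[OF \<tau>nn[of "Suc n"] \<tau>nn[of n]] le
      by (subst (asm) abs_minus_commute) (meson exp_le_cancel_iff order_trans)
  qed
  have T: "onorm ((*v) (F (Suc n))) \<le> \<alpha>" for n
  proof -
    have "onorm ((*v) (F (Suc n))) = onorm (\<lambda>x. (F (Suc n) - ?c (Suc n) n) *v x + ?c (Suc n) n *v x)"
      by (simp add: matrix_vector_mult_diff_rdistrib)
    also have "\<dots> \<le> onorm ((*v) (F (Suc n) - ?c (Suc n) n)) + onorm ((*v) (?c (Suc n) n))"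
      by (rule onorm_triangle) (rule matrix_vector_mul_bounded_linear)+
    finally show ?thesis using diff[of n] E[of n] P(1)[of n] by (simp add: \<alpha>_def)
  qed
  define g where "g = real (card S) * \<alpha> ^ card S"
  have g0: "0 \<le> g" using \<alpha> by (simp add: g_def)
  \<comment> \<open>The perturbation lemma multiplies norms over intervals that leave out step
    \<open>k\<close>. The exact inverse of that step bridges the gap at a cost of
    \<open>exp (a * H) ^ card S\<close>.\<close>
  define C' where "C' = C * exp (a * H) ^ card S"
  have C'0: "0 \<le> C'" using C0 by (simp add: C'_def)
  define e where "e n = C' * (g * \<epsilon> (Suc n))" for n
  have e0: "0 \<le> e n" for n using C'0 g0 \<epsilon>0 by (simp add: e_def)
  have sume: "summable e" unfolding e_def by (intro summable_mult sum)
  have step: "\<bar>\<omega> (\<lambda>i. step_product (\<lambda>k. F (N + k)) n *v v i) - \<omega> (\<lambda>i. ?c (N + n) N *v v i)\<bar>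
     \<le> (exp (\<Sum>k<n. e (N + k)) - 1) * ext_norm S (?c (N + n) N)"
    if w: "\<omega> \<in> unit_forms S" and v: "\<And>i. norm (v i) \<le> 1" for N n \<omega> v
  proof -
    have "\<bar>\<omega> (\<lambda>i. step_product (\<lambda>k. F (N + k)) n *v v i) - \<omega> (\<lambda>i. ?c (N + n) (N + 0) *v v i)\<bar>
      \<le> ((\<Prod>k<n. 1 + C' * (g * \<epsilon> (N + Suc k))) - 1) * ext_norm S (?c (N + n) (N + 0))"
    \<comment> \<open>The lemma demands \<open>0 \<le> e k\<close> at every index. For
      \<open>N = 0\<close> and \<open>k = 0\<close> this would concern \<open>\<epsilon> 0\<close>,
      whose sign is unknown, so a substitute value is inserted at an index that the product never
      reaches.\<close>
    proof (rule form_perturbed_product_le[where U = "\<lambda>n k. ?c (N + n) (N + k)" and T = "\<lambda>k. F (N + k)"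
          and P = "\<lambda>k. ?c (N + k) (N + k - 1)" and e = "\<lambda>k. g * \<epsilon> (if k = 0 then Suc 0 else N + k)" and C = C',
          THEN order_trans[OF _ eq_refl]])
      show "?c (N + n) (N + n) = mat 1" for n by (simp add: cauchy_self \<tau>nn)
      show "?c (N + n) (N + k) = ?c (N + n) (N + Suc k) ** ?c (N + Suc k) (N + Suc k - 1)" for n k
        by (simp add: cauchy_cocycle \<tau>nn)
      show "\<bar>\<omega> (\<lambda>i. F (N + Suc k) *v u i) - \<omega> (\<lambda>i. ?c (N + Suc k) (N + Suc k - 1) *v u i)\<bar>
         \<le> g * \<epsilon> (if Suc k = 0 then Suc 0 else N + Suc k) * (\<Prod>i\<in>S. norm (u i))" if "\<omega> \<in> unit_forms S" for \<omega> k u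
        using abs_form_image_diff_le[OF that T _ diff \<alpha>, of "N + k" u] P(1)[of "N + k"] E0
        by (simp add: g_def \<alpha>_def mult_ac)
      show "0 \<le> g * \<epsilon> (if k = 0 then Suc 0 else N + k)" for k
        using g0 \<epsilon>0 by (cases k) auto
      show "ext_norm S (?c (N + n) (N + Suc k)) * ext_norm S (?c (N + k) (N + 0)) \<le> C' * ext_norm S (?c (N + n) (N + 0))"
        if "k < n" for n k
      proof -
        have "ext_norm S (?c (N + n) (N + Suc k)) = ext_norm S (?c (N + n) (N + k) ** ?c (N + k) (Suc (N + k)))"
          by (simp add: cauchy_cocycle \<tau>nn)
        also have "\<dots> \<le> ext_norm S (?c (N + n) (N + k)) * ext_norm S (?c (N + k) (Suc (N + k)))"
          by (rule ext_norm_mult)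
        also have "\<dots> \<le> ext_norm S (?c (N + n) (N + k)) * exp (a * H) ^ card S"
          by (intro mult_left_mono ext_norm_nonneg order_trans[OF ext_norm_le_onorm] power_mono P(2) onorm_matrix_nonneg)
        finally have "ext_norm S (?c (N + n) (N + Suc k)) * ext_norm S (?c (N + k) (N + 0))
           \<le> ext_norm S (?c (N + n) (N + k)) * exp (a * H) ^ card S * ext_norm S (?c (N + k) (N + 0))"
          by (intro mult_right_mono ext_norm_nonneg)
        also have "\<dots> = exp (a * H) ^ card S * (ext_norm S (?c (N + n) (N + k)) * ext_norm S (?c (N + k) (N + 0)))"
          by simp
        also have "\<dots> \<le> exp (a * H) ^ card S * (C * ext_norm S (?c (N + n) (N + 0)))"
          using that by (intro mult_left_mono C mono \<tau>nn) auto
        finally show ?thesis by (simp add: C'_def mult_ac)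
      qed
    qed (use w v C'0 in auto)
    also have "(\<Prod>k<n. 1 + C' * (g * \<epsilon> (N + Suc k))) \<le> exp (\<Sum>k<n. e (N + k))"
      using prod_le_exp_sum[of "{..<n}" "\<lambda>k. e (N + k)"] e0 by (simp add: e_def)
    finally show ?thesis by (simp add: ext_norm_nonneg mult_right_mono)
  qed
  \<comment> \<open>With \<open>ln (3 / 2)\<close> the relative error
    \<open>exp (\<dots>) - 1\<close> is at most one half and can be moved to the other side of the
    inequality.\<close>
  obtain N where N: "\<And>n. (\<Sum>k<n. e (N + k)) \<le> ln (3 / 2)"
  proof -
    have "eventually (\<lambda>N. norm (\<Sum>k. e (k + N)) < ln (3 / 2)) sequentially"
      using suminf_exist_split[OF _ sume, of "ln (3/2)"] unfolding eventually_sequentially by simp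
    then obtain N where N: "norm (\<Sum>k. e (k + N)) < ln (3 / 2)" unfolding eventually_sequentially by blast
    have "(\<Sum>k<n. e (N + k)) \<le> ln (3 / 2)" for n
    proof -
      have "(\<Sum>k<n. e (k + N)) \<le> (\<Sum>k. e (k + N))"
        using sume e0 by (intro sum_le_suminf) (auto simp: summable_iff_shift)
      then show ?thesis using N by (simp add: add.commute)
    qed
    then show ?thesis by (rule that)
  qed
  let ?G = "\<lambda>M. ext_norm S M"
  let ?Y = "step_product F"
  have upper: "?G (?Y n) \<le> exp (suminf e) * ?G (matrix_inv (X 0)) * ?G (X (\<tau> n))" for n
  proof -
    have "?G (?Y n) \<le> exp (suminf e) * ?G (?c n 0)"
    proof (rule ext_norm_leI)
      fix \<omega> :: "('i \<Rightarrow> real^'n) \<Rightarrow> real" and v :: "'i \<Rightarrow> real^'n"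
      assume w: "\<omega> \<in> unit_forms S" and v: "\<And>i. norm (v i) \<le> 1"
      have "\<bar>\<omega> (\<lambda>i. ?c n 0 *v v i)\<bar> \<le> ?G (?c n 0)"
        by (rule order_trans[OF unit_form_le_wedge_norm[OF w] wedge_norm_image_unit_le_ext_norm[OF v]])
      moreover have "exp (\<Sum>k<n. e k) \<le> exp (suminf e)"
        using sum_le_suminf[OF sume, of "{..<n}"] e0 by simp
      then have "(exp (\<Sum>k<n. e k) - 1) * ?G (?c n 0) \<le> (exp (suminf e) - 1) * ?G (?c n 0)"
        by (intro mult_right_mono ext_norm_nonneg) simp
      ultimately show "\<bar>\<omega> (\<lambda>i. ?Y n *v v i)\<bar> \<le> exp (suminf e) * ?G (?c n 0)"
        using step[where v = v and N = 0 and n = n, OF w v] by (simp add: left_diff_distrib)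
    qed
    also have "\<dots> \<le> exp (suminf e) * (?G (X (\<tau> n)) * ?G (matrix_inv (X 0)))"
      unfolding cauchy_matrix_def \<tau>0 by (intro mult_left_mono ext_norm_mult) simp
    finally show ?thesis by (simp add: mult_ac)
  qed
  \<comment> \<open>An inverse of the first \<open>N\<close> numerical steps turns the product
    started at \<open>N\<close> into the full product.\<close>
  obtain Z where Z: "?Y N ** Z = mat 1" using step_product_invertible[of F N, OF F] unfolding invertible_def by blast
  have lower: "?G (X (\<tau> (N + n))) \<le> (2 * ?G Z * ?G (X (\<tau> N))) * ?G (?Y (N + n))" for n
  proof -
    have Y': "step_product (\<lambda>k. F (N + k)) n = ?Y (N + n) ** Z"
      unfolding step_product_shift by (simp add: matrix_mul_assoc[symmetric] Z)
    have "?G (?c (N + n) N) \<le> ?G (?Y (N + n) ** Z) + 1 / 2 * ?G (?c (N + n) N)"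
    proof (rule ext_norm_leI)
      fix \<omega> :: "('i \<Rightarrow> real^'n) \<Rightarrow> real" and v :: "'i \<Rightarrow> real^'n"
      assume w: "\<omega> \<in> unit_forms S" and v: "\<And>i. norm (v i) \<le> 1"
      have "\<bar>\<omega> (\<lambda>i. (?Y (N + n) ** Z) *v v i)\<bar> \<le> ?G (?Y (N + n) ** Z)"
        by (rule order_trans[OF unit_form_le_wedge_norm[OF w] wedge_norm_image_unit_le_ext_norm[OF v]])
      moreover have "exp (\<Sum>k<n. e (N + k)) \<le> 3 / 2" using N[of n] by (simp add: ln_ge_iff)
      then have "(exp (\<Sum>k<n. e (N + k)) - 1) * ?G (?c (N + n) N) \<le> 1 / 2 * ?G (?c (N + n) N)"
        by (intro mult_right_mono ext_norm_nonneg) simp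
      ultimately show "\<bar>\<omega> (\<lambda>i. ?c (N + n) N *v v i)\<bar> \<le> ?G (?Y (N + n) ** Z) + 1 / 2 * ?G (?c (N + n) N)"
        using step[where v = v and N = N and n = n, OF w v] unfolding Y' by linarith
    qed
    then have le: "?G (?c (N + n) N) \<le> 2 * (?G (?Y (N + n)) * ?G Z)" using ext_norm_mult[of S "?Y (N + n)" Z] by linarith
    have "X (\<tau> (N + n)) = ?c (N + n) N ** X (\<tau> N)"
      by (simp add: cauchy_matrix_def matrix_mul_assoc[symmetric] matrix_inv_X \<tau>nn)
    then have "?G (X (\<tau> (N + n))) \<le> ?G (?c (N + n) N) * ?G (X (\<tau> N))" using ext_norm_mult by metis
    also have "\<dots> \<le> 2 * (?G (?Y (N + n)) * ?G Z) * ?G (X (\<tau> N))" by (intro mult_right_mono le ext_norm_nonneg)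
    finally show ?thesis by (simp add: mult_ac)
  qed
  define K where "K = max (exp (suminf e) * ?G (matrix_inv (X 0))) (2 * ?G Z * ?G (X (\<tau> N)))"
  show ?thesis
  proof (rule that[of K])
    have "?G (?Y n) \<le> K * ?G (X (\<tau> n))" for n
      by (rule order_trans[OF upper]) (intro mult_right_mono ext_norm_nonneg, simp add: K_def)
    then show "eventually (\<lambda>n. ?G (?Y n) \<le> K * ?G (X (\<tau> n))) sequentially" by simp
    have "?G (X (\<tau> (N + n))) \<le> K * ?G (?Y (N + n))" for n
      by (rule order_trans[OF lower]) (intro mult_right_mono ext_norm_nonneg, simp add: K_def)
    then show "eventually (\<lambda>n. ?G (X (\<tau> n)) \<le> K * ?G (?Y n)) sequentially"
      unfolding eventually_sequentially by (metis le_add_diff_inverse)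
  qed
qed

section \<open>Almost every tuple of initial vectors\<close>

text \<open>Expanded in the standard basis, the value is a polynomial in the entries of
  \<open>v\<close>. This yields measurability of the sets of slow tuples.\<close>

lemma alternating_form_continuous:
  fixes M :: "real^'n^'n" and S :: "'m::finite set"
  assumes w: "\<omega> \<in> alternating_forms S"
  shows "continuous_on UNIV (\<lambda>v :: real^'n^'m. \<omega> (\<lambda>j. M *v v $ j))"
proof -
  have "\<omega> (\<lambda>j. M *v v $ j) = (\<Sum>f\<in>S \<rightarrow>\<^sub>E UNIV. (\<Prod>i\<in>S. (M *v v $ i) $ f i) * \<omega> (\<lambda>i. axis (f i) 1))"
    for v :: "real^'n^'m"
  proof -
    have "(\<lambda>j. M *v v $ j) = (\<lambda>j. \<Sum>a\<in>UNIV. (M *v v $ j) $ a *\<^sub>R axis a 1)"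
      by (simp add: fun_eq_iff basis_expansion flip: scalar_mult_eq_scaleR)
    then show ?thesis by (simp only: alternating_forms_expand[OF w finite])
  qed
  moreover have "continuous_on UNIV (\<lambda>v :: real^'n^'m. (M *v v $ i) $ k)" for i k
    by (intro continuous_intros linear_continuous_on_compose[of _ "\<lambda>v. v $ i" "(*v) M"] matrix_vector_mul_linear)
  ultimately show ?thesis by (simp add: continuous_intros)
qed

lemma negligible_singular: "negligible {v :: real^'n^'n. det v = 0}"
proof (rule negligible_slotwise_subspace)
  have "continuous_on UNIV (\<lambda>v :: real^'n^'n. det v)"
    unfolding det_def by (intro continuous_intros)
  then have "closed ((\<lambda>v :: real^'n^'n. det v) -` {0})" by (intro closed_vimage) auto
  then show "{v :: real^'n^'n. det v = 0} \<in> sets borel" by (simp add: vimage_def)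
next
  fix v :: "real^'n^'n" and k
  have lin: "linear (\<lambda>x. det (\<chi> j. if j = k then x else v $ j))"
    using linear_det_upd[of "($) v" k] by (simp add: fun_upd_def)
  show "subspace {x. (\<chi> j. if j = k then x else v $ j) \<in> {v. det v = 0}}"
    using linear_subspace_kernel[OF lin] by simp
next
  show "mat 1 \<notin> {v :: real^'n^'n. det v = 0}" by simp
qed

text \<open>The bound with one \<open>K\<close> for all \<open>n\<close> survives sums and multiples
  in a single slot, which gives the slotwise subspaces. Not all tuples can be slow, since tuples of
  standard basis vectors already control \<open>ext_norm\<close>.\<close>

lemma negligible_slow_tuples:
  fixes Y :: "nat \<Rightarrow> real^'n^'n" and S :: "'m::finite set" and \<tau> :: "nat \<Rightarrow> real"
  assumes \<tau>: "filterlim \<tau> at_top sequentially" and r: "r < \<rho>"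
    and growth: "eventually (\<lambda>n. exp (\<rho> * \<tau> n) \<le> ext_norm S (Y n)) sequentially"
  shows "negligible {v :: real^'n^'m. \<exists>K. \<forall>n. wedge_norm S (\<lambda>j. Y n *v v $ j) \<le> K * exp (r * \<tau> n)}"
    (is "negligible ?B")
proof -
  have exp0: "0 \<le> exp (r * \<tau> n)" for n by simp
  have mem: "v \<in> ?B" if "\<And>n. wedge_norm S (\<lambda>j. Y n *v v $ j) \<le> K * exp (r * \<tau> n)" for v :: "real^'n^'m" and K
    using that by blast
  have borel: "?B \<in> sets borel"
  proof -
    \<comment> \<open>A volume bound is an intersection of closed conditions over all unit forms, so
      the uncountable intersection stays closed; only the union over the integer bounds
      \<open>K\<close> has to be countable.\<close>
    define T where "T K = (\<Inter>n. \<Inter>\<omega>\<in>unit_forms S.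
      (\<lambda>v :: real^'n^'m. \<bar>\<omega> (\<lambda>j. Y n *v v $ j)\<bar>) -` {..real K * exp (r * \<tau> n)})" for K :: nat
    have T: "v \<in> T K \<longleftrightarrow> (\<forall>n. wedge_norm S (\<lambda>j. Y n *v v $ j) \<le> real K * exp (r * \<tau> n))" for v K
      unfolding T_def wedge_norm_le_iff by auto
    have eq: "?B = (\<Union>K. T K)"
    proof (intro set_eqI iffI)
      fix v assume "v \<in> ?B"
      then obtain K where K: "\<And>n. wedge_norm S (\<lambda>j. Y n *v v $ j) \<le> K * exp (r * \<tau> n)" by blast
      obtain k :: nat where k: "K \<le> real k" using real_arch_simple by blast
      have "wedge_norm S (\<lambda>j. Y n *v v $ j) \<le> real k * exp (r * \<tau> n)" for n
        by (rule order_trans[OF K mult_right_mono[OF k exp0]])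
      then show "v \<in> (\<Union>K. T K)" using T by blast
    next
      fix v assume "v \<in> (\<Union>K. T K)"
      then show "v \<in> ?B" using T by blast
    qed
    have "closed (T K)" for K
      unfolding T_def
      by (intro closed_INT ballI closed_vimage continuous_on_rabs alternating_form_continuous unit_formsD(1)) auto
    then show ?thesis unfolding eq by (intro sets.countable_UN) (auto intro: borel_closed)
  qed
  have "\<exists>w. w \<notin> ?B"
  proof (rule ccontr)
    assume "\<not> ?thesis"
    then have "\<forall>w. \<exists>K. \<forall>n. wedge_norm S (\<lambda>j. Y n *v w $ j) \<le> K * exp (r * \<tau> n)" by blast
    then obtain K where K: "\<And>w :: real^'n^'m. \<And>n. wedge_norm S (\<lambda>j. Y n *v w $ j) \<le> K w * exp (r * \<tau> n)"
      by metis
    \<comment> \<open>Finitely many tuples of standard basis vectors suffice, so their individual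
      constants add up to a single one.\<close>
    let ?K = "\<Sum>f\<in>S \<rightarrow>\<^sub>E (UNIV::'n set). K (\<chi> i. axis (f i) 1)"
    have G: "ext_norm S (Y n) \<le> ?K * exp (r * \<tau> n)" for n
    proof -
      have "ext_norm S (Y n) \<le> 1 ^ card S * (\<Sum>f\<in>S \<rightarrow>\<^sub>E UNIV. wedge_norm S (\<lambda>i. Y n *v axis (f i) 1))"
      proof (rule ext_norm_le_sum)
        fix x :: "real^'n" assume "norm x \<le> 1"
        then have "\<bar>x $ a\<bar> \<le> 1" for a using component_le_norm_cart[of x a] by linarith
        moreover have "x = (\<Sum>a\<in>UNIV. x $ a *\<^sub>R axis a 1)"
          using basis_expansion[of x] by (simp add: scalar_mult_eq_scaleR)
        ultimately show "\<exists>c. x = (\<Sum>a\<in>UNIV. c a *\<^sub>R axis a 1) \<and> (\<forall>a. \<bar>c a\<bar> \<le> 1)" by blast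
      qed
      also have "\<dots> \<le> (\<Sum>f\<in>S \<rightarrow>\<^sub>E (UNIV::'n set). K (\<chi> i. axis (f i) 1) * exp (r * \<tau> n))"
        using K[of n "\<chi> i. axis (f i) 1" for f] by (simp only: power_one mult_1) (intro sum_mono, simp)
      finally show ?thesis by (simp add: sum_distrib_right)
    qed
    \<comment> \<open>The added 1 makes the comparison with the bound
      \<open>?K * exp (r * \<tau> n)\<close> strict.\<close>
    have "eventually (\<lambda>n. (?K + 1) * exp (r * \<tau> n) \<le> exp (\<rho> * \<tau> n)) sequentially"
      using eventually_compose_filterlim[OF eventually_exp_absorbs[OF r] \<tau>] .
    with growth have "eventually (\<lambda>n. False) sequentially"
    proof eventually_elim
      case (elim n)
      then have "(?K + 1) * exp (r * \<tau> n) \<le> ?K * exp (r * \<tau> n)" using G[of n] by linarith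
      then show False by (simp add: distrib_right)
    qed
    then show False by simp
  qed
  then obtain w where w: "w \<notin> ?B" by blast
  show ?thesis
  proof (rule negligible_slotwise_subspace[OF borel _ w])
    fix v :: "real^'n^'m" and k assume v: "v \<in> ?B"
    show "subspace {x. (\<chi> j. if j = k then x else v $ j) \<in> ?B}"
    proof (cases "k \<in> S")
      case False
      have "wedge_norm S (\<lambda>j. Y n *v (\<chi> j. if j = k then x else v $ j) $ j) = wedge_norm S (\<lambda>j. Y n *v v $ j)" for n x
        using False by (intro wedge_norm_cong) auto
      then have "{x. (\<chi> j. if j = k then x else v $ j) \<in> ?B} = UNIV" using v by auto
      then show ?thesis by simp
    next
      case True
      let ?f = "\<lambda>n. (\<lambda>j. Y n *v v $ j)"
      have upd: "(\<lambda>j. Y n *v (\<chi> j. if j = k then x else v $ j) $ j) = (?f n)(k := Y n *v x)" for n x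
        by (auto simp: fun_eq_iff)
      have iff: "(\<chi> j. if j = k then x else v $ j) \<in> ?B \<longleftrightarrow>
          (\<exists>K. \<forall>n. wedge_norm S ((?f n)(k := Y n *v x)) \<le> K * exp (r * \<tau> n))" for x
        by (simp only: mem_Collect_eq upd)
      have zero: "wedge_norm S ((?f n)(k := 0)) \<le> 0 * exp (r * \<tau> n)" for n
        using wedge_norm_upd_scaleR[OF True, of "?f n" 0 0] by simp
      have add: "wedge_norm S ((?f n)(k := Y n *v (x + y))) \<le> (K + K') * exp (r * \<tau> n)"
        if "wedge_norm S ((?f n)(k := Y n *v x)) \<le> K * exp (r * \<tau> n)"
          "wedge_norm S ((?f n)(k := Y n *v y)) \<le> K' * exp (r * \<tau> n)" for n x y K K'
        using wedge_norm_upd_add[OF True, of "?f n" "Y n *v x" "Y n *v y"] that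
        by (simp add: matrix_vector_right_distrib distrib_right)
      have scale: "wedge_norm S ((?f n)(k := Y n *v (c *\<^sub>R x))) \<le> (\<bar>c\<bar> * K) * exp (r * \<tau> n)"
        if "wedge_norm S ((?f n)(k := Y n *v x)) \<le> K * exp (r * \<tau> n)" for n x c K
        using wedge_norm_upd_scaleR[OF True, of "?f n" c "Y n *v x"] mult_left_mono[OF that, of "\<bar>c\<bar>"]
        by (simp add: matrix_vector_mult_scaleR mult.assoc)
      show ?thesis
        unfolding iff
      proof (rule subspaceI)
        show "0 \<in> {x. \<exists>K. \<forall>n. wedge_norm S ((?f n)(k := Y n *v x)) \<le> K * exp (r * \<tau> n)}"
          using zero by (auto intro: exI[of _ 0])
      next
        fix x y
        assume "x \<in> {x. \<exists>K. \<forall>n. wedge_norm S ((?f n)(k := Y n *v x)) \<le> K * exp (r * \<tau> n)}"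
          "y \<in> {x. \<exists>K. \<forall>n. wedge_norm S ((?f n)(k := Y n *v x)) \<le> K * exp (r * \<tau> n)}"
        then show "x + y \<in> {x. \<exists>K. \<forall>n. wedge_norm S ((?f n)(k := Y n *v x)) \<le> K * exp (r * \<tau> n)}"
          using add by (simp only: mem_Collect_eq) metis
      next
        fix c :: real and x
        assume "x \<in> {x. \<exists>K. \<forall>n. wedge_norm S ((?f n)(k := Y n *v x)) \<le> K * exp (r * \<tau> n)}"
        then show "c *\<^sub>R x \<in> {x. \<exists>K. \<forall>n. wedge_norm S ((?f n)(k := Y n *v x)) \<le> K * exp (r * \<tau> n)}"
          using scale by (simp only: mem_Collect_eq) metis
      qed
    qed
  qed
qed

text \<open>The upper bound holds for each invertible tuple. If the lower one fails, the volume is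
  eventually below a strictly slower exponential, and the tuple lies in one of countably many null
  sets.\<close>

lemma limsup_log_volume:
  fixes F :: "nat \<Rightarrow> 'n::{finite,linorder} sqmat" and \<tau> :: "nat \<Rightarrow> real"
  assumes F: "\<And>n. invertible (F (Suc n))" and low: "\<forall>i\<in>S. \<forall>j\<le>i. j \<in> S"
    and \<tau>: "filterlim \<tau> at_top sequentially"
    and upper: "\<And>e. 0 < e \<Longrightarrow> eventually (\<lambda>n. ext_norm S (step_product F n) \<le> exp ((\<Lambda> + e) * \<tau> n)) sequentially"
    and lower: "\<And>e. 0 < e \<Longrightarrow> eventually (\<lambda>n. exp ((\<Lambda> - e) * \<tau> n) \<le> ext_norm S (step_product F n)) sequentially"
  shows "AE v in lebesgue.
    limsup (\<lambda>n. ereal (1 / \<tau> n * (\<Sum>k<n. \<Sum>i\<in>S. ln (benettin_R F v (Suc k) $ i $ i)))) = ereal \<Lambda>"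
proof -
  define B where "B j = {v :: 'n tuple. \<exists>K. \<forall>n. wedge_norm S (\<lambda>i. step_product F n *v v $ i)
     \<le> K * exp ((\<Lambda> - 1 / real (Suc j)) * \<tau> n)}" for j :: nat
  let ?N = "(\<Union>j. B j) \<union> {v. det v = 0}"
  have "negligible (B j)" for j
  proof -
    \<comment> \<open>The slow rate must lie strictly below some rate guaranteed by
      \<open>lower\<close>; halving the deficit provides one.\<close>
    have "\<Lambda> - 1 / real (Suc j) < \<Lambda> - 1 / (2 * real (Suc j))" by (simp add: field_simps)
    then show ?thesis
      unfolding B_def by (rule negligible_slow_tuples[OF \<tau> _ lower]) simp
  qed
  then have "negligible ?N" by (intro negligible_Un negligible_countable_Union negligible_singular) auto
  then have null: "?N \<in> null_sets lebesgue" by (simp add: negligible_iff_null_sets)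
  have "limsup (\<lambda>n. ereal (1 / \<tau> n * (\<Sum>k<n. \<Sum>i\<in>S. ln (benettin_R F v (Suc k) $ i $ i)))) = ereal \<Lambda>"
    if v: "v \<notin> ?N" for v
  proof -
    have inv: "invertible v" using v by (simp add: invertible_det_nz)
    define \<rho> where "\<rho> n = (\<Prod>k<n. \<Prod>i\<in>S. benettin_R F v (Suc k) $ i $ i)" for n
    let ?w = "\<lambda>n. wedge_norm S (\<lambda>j. step_product F n *v v $ j)"
    have Rpos: "0 < benettin_R F v (Suc k) $ i $ i" for k i by (rule benettin_R_pos[of F, OF F inv])
    have Rnz: "benettin_R F v (Suc k) $ i $ i \<noteq> 0" for k i using Rpos[of k i] by simp
    have \<rho>pos: "0 < \<rho> n" for n unfolding \<rho>_def using Rpos by (intro prod_pos ballI)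
    have ln\<rho>: "ln (\<rho> n) = (\<Sum>k<n. \<Sum>i\<in>S. ln (benettin_R F v (Suc k) $ i $ i))" for n
    proof -
      have "ln (\<rho> n) = (\<Sum>k<n. ln (\<Prod>i\<in>S. benettin_R F v (Suc k) $ i $ i))"
        unfolding \<rho>_def by (rule ln_prod) (auto simp: Rnz)
      also have "\<dots> = (\<Sum>k<n. \<Sum>i\<in>S. ln (benettin_R F v (Suc k) $ i $ i))"
        by (intro sum.cong refl ln_prod) (auto simp: Rnz)
      finally show ?thesis .
    qed
    \<comment> \<open>The two-sided comparison starts at \<open>n = 1\<close>, after the first
      orthonormalisation.\<close>
    have volume: "?w n \<le> \<rho> n \<and> \<rho> n \<le> fact CARD('n) * ?w n" if "0 < n" for n
    proof -
      obtain k where k: "n = Suc k" using \<open>0 < n\<close> gr0_implies_Suc by blast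
      show ?thesis unfolding k by (intro conjI wedge_norm_step_product[OF F inv low \<rho>_def])
    qed
    have w_le: "eventually (\<lambda>n. ?w n \<le> \<rho> n) sequentially"
      and le_w: "eventually (\<lambda>n. \<rho> n \<le> fact CARD('n) * ?w n) sequentially"
      by (rule eventually_mono[OF eventually_gt_at_top[of 0]], use volume in blast)+
    let ?x = "\<lambda>n. ereal (1 / \<tau> n * ln (\<rho> n))"
    have \<tau>pos: "eventually (\<lambda>n. 0 < \<tau> n) sequentially"
      using \<tau> by (simp add: filterlim_at_top_dense)
    have "limsup ?x \<le> ereal \<Lambda>"
      unfolding Limsup_le_iff
    proof (intro allI impI)
      fix y assume "ereal \<Lambda> < y"
      then obtain s where s: "ereal \<Lambda> < ereal s" "ereal s < y" using ereal_dense2 by blast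
      define e where "e = (s - \<Lambda>) / 2"
      have e: "0 < e" "\<Lambda> + e < s" using s(1) by (auto simp: e_def field_simps)
      let ?C = "fact CARD('n) * (\<Prod>i\<in>S. norm (v $ i))"
      have "eventually (\<lambda>n. ?C * exp ((\<Lambda> + e) * \<tau> n) \<le> exp (s * \<tau> n)) sequentially"
        using eventually_compose_filterlim[OF eventually_exp_absorbs[OF e(2)] \<tau>] .
      with upper[OF e(1)] le_w \<tau>pos show "eventually (\<lambda>n. ?x n < y) sequentially"
      proof eventually_elim
        case (elim n)
        have "\<rho> n \<le> fact CARD('n) * ?w n" by (rule elim(2))
        also have "\<dots> \<le> fact CARD('n) * (ext_norm S (step_product F n) * (\<Prod>i\<in>S. norm (v $ i)))"
          by (intro mult_left_mono wedge_norm_image_le_prod) simp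
        also have "\<dots> \<le> fact CARD('n) * (exp ((\<Lambda> + e) * \<tau> n) * (\<Prod>i\<in>S. norm (v $ i)))"
          using elim(1) by (intro mult_left_mono mult_right_mono prod_nonneg) auto
        also have "\<dots> \<le> exp (s * \<tau> n)" using elim(4) by (simp add: mult_ac)
        finally have "ln (\<rho> n) \<le> ln (exp (s * \<tau> n))" using \<rho>pos[of n] by (subst ln_le_cancel_iff) auto
        then have "1 / \<tau> n * ln (\<rho> n) \<le> s" using elim(3) by (simp add: field_simps)
        then have "?x n \<le> ereal s" by simp
        then show ?case using s(2) by (rule order_le_less_trans)
      qed
    qed
    moreover have "ereal \<Lambda> \<le> limsup ?x"
    proof (rule ccontr)
      assume "\<not> ?thesis"
      then have "limsup ?x < ereal \<Lambda>" by simp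
      then obtain s where s: "limsup ?x < ereal s" "ereal s < ereal \<Lambda>" using ereal_dense2 by blast
      then have "0 < \<Lambda> - s" by simp
      then obtain j where j: "1 / real (Suc j) < \<Lambda> - s" using nat_approx_posE by metis
      let ?r = "\<Lambda> - 1 / real (Suc j)"
      have sr: "s \<le> ?r" using j by linarith
      have "eventually (\<lambda>n. ?x n < ereal s) sequentially" by (rule Limsup_lessD[OF s(1)])
      with w_le \<tau>pos have "eventually (\<lambda>n. ?w n \<le> exp (?r * \<tau> n)) sequentially"
      proof eventually_elim
        case (elim n)
        have "1 / \<tau> n * ln (\<rho> n) < s" using elim(3) by simp
        then have "ln (\<rho> n) \<le> s * \<tau> n" using elim(2) by (simp add: field_simps)
        then have "\<rho> n \<le> exp (s * \<tau> n)" using \<rho>pos[of n] by (metis exp_le_cancel_iff exp_ln)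
        also have "\<dots> \<le> exp (?r * \<tau> n)" using sr elim(2) by (intro exp_mono_arg) auto
        finally show ?case using elim(1) by linarith
      qed
      then obtain n0 where n0: "\<And>n. n0 \<le> n \<Longrightarrow> ?w n \<le> exp (?r * \<tau> n)"
        unfolding eventually_sequentially by blast
      \<comment> \<open>Membership in \<open>B j\<close> asks for one bound at all \<open>n\<close>;
        the sum takes care of the finitely many indices below \<open>n0\<close>.\<close>
      define K where "K = 1 + (\<Sum>n<n0. ?w n / exp (?r * \<tau> n))"
      have w0: "0 \<le> ?w n / exp (?r * \<tau> n)" for n by (simp add: wedge_norm_nonneg)
      have "?w n \<le> K * exp (?r * \<tau> n)" for n
      proof -
        have "?w n / exp (?r * \<tau> n) \<le> K"
        proof (cases "n0 \<le> n")
          case True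
          then have "?w n / exp (?r * \<tau> n) \<le> 1" using n0 by (subst divide_le_eq_1_pos) auto
          moreover have "0 \<le> (\<Sum>n<n0. ?w n / exp (?r * \<tau> n))" by (intro sum_nonneg w0)
          ultimately show ?thesis unfolding K_def by linarith
        next
          case False
          then have "?w n / exp (?r * \<tau> n) \<le> (\<Sum>n<n0. ?w n / exp (?r * \<tau> n))"
            using w0 by (intro member_le_sum) auto
          then show ?thesis by (simp add: K_def)
        qed
        then show ?thesis by (simp add: divide_le_eq)
      qed
      then have "v \<in> B j" unfolding B_def by blast
      then show False using v by blast
    qed
    ultimately show ?thesis unfolding ln\<rho> by (rule antisym)
  qed
  then have "{v. limsup (\<lambda>n. ereal (1 / \<tau> n * (\<Sum>k<n. \<Sum>i\<in>S. ln (benettin_R F v (Suc k) $ i $ i)))) \<noteq> ereal \<Lambda>} \<subseteq> ?N"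
    by blast
  then show ?thesis using null by (intro AE_I'[OF null]) auto
qed

lemma sum_benettin_output:
  fixes \<Phi> :: "real \<Rightarrow> real \<Rightarrow> 'n::{finite,linorder} sqmat"
  assumes "L \<le> CARD('n)"
  shows "(\<Sum>j=1..L. benettin_output \<Phi> h v j n) =
    1 / grid h n * (\<Sum>k<n. \<Sum>i\<in>initial_segment L. ln (benettin_R (step_matrix \<Phi> h) v (Suc k) $ i $ i))"
proof -
  let ?r = "\<lambda>k i. ln (benettin_R (step_matrix \<Phi> h) v k $ i $ i)"
  have "(\<Sum>j=1..L. benettin_output \<Phi> h v j n) = 1 / grid h n * (\<Sum>k=1..n. \<Sum>j=1..L. ?r k (nth_index j))"
    unfolding benettin_output_def sum_distrib_left[symmetric] by (subst sum.swap) (rule refl)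
  also have "(\<Sum>k=1..n. \<Sum>j=1..L. ?r k (nth_index j)) = (\<Sum>k=1..n. \<Sum>i\<in>initial_segment L. ?r k i)"
    by (intro sum.cong refl sum.reindex_bij_betw bij_betw_nth_index assms)
  also have "\<dots> = (\<Sum>k<n. \<Sum>i\<in>initial_segment L. ?r (Suc k) i)"
    by (rule sum.reindex_bij_witness[of _ Suc "\<lambda>k. k - 1"]) auto
  finally show ?thesis .
qed

lemma benettin_limsup:
  fixes A X :: "real \<Rightarrow> 'n::{finite,linorder} sqmat"
    and \<Phi> :: "real \<Rightarrow> real \<Rightarrow> 'n sqmat"
  assumes A: "bounded (A ` {0..})" and fund: "is_fundamental_matrix A X"
    and spec: "has_lyapunov_spectrum A q lam m" and reg: "regular_system X q lam m"
    and l: "l \<in> {1..q}" and L: "L = (\<Sum>j=1..l. m j)" and sfi: "strongly_fast_invertible X L"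
    and one: "one_step_method hmax \<Phi>" and cons: "consistent_of_order X hmax \<Phi> p"
    and h: "\<forall>n\<ge>1. 0 < h n \<and> h n \<le> hmax" and grid: "filterlim (grid h) at_top sequentially"
    and sum: "summable (\<lambda>n. h (Suc n) powr (p + 1))"
  shows "AE v in lebesgue. limsup (\<lambda>n. ereal (\<Sum>j = 1..L. benettin_output \<Phi> h v j n))
    = ereal (\<Sum>j=1..l. real (m j) * lam j)"
proof -
  obtain a where a: "0 \<le> a" and sys: "bounded_linear_system A X a"
  proof -
    obtain K where K: "\<And>t. 0 \<le> t \<Longrightarrow> norm (A t) \<le> K" using A unfolding bounded_iff by auto
    \<comment> \<open>The boundedness assumption uses the Frobenius norm. Bounding the entries costs
      the factor \<open>?d * ?d\<close> when passing to the operator norm.\<close>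
    let ?d = "real CARD('n)"
    have "norm (A t *v x) \<le> (?d * ?d * K) * norm x" if t: "0 \<le> t" for t x
    proof -
      have "\<bar>A t $ i $ j\<bar> \<le> K" for i j
        by (rule order_trans[OF component_le_norm_cart order_trans[OF Finite_Cartesian_Product.norm_nth_le K[OF t]]])
      then have "onorm ((*v) (A t)) \<le> ?d * ?d * K" by (rule onorm_le_matrix_component)
      then have "onorm ((*v) (A t)) * norm x \<le> (?d * ?d * K) * norm x" by (intro mult_right_mono) auto
      then show ?thesis using norm_matrix_le_onorm[of "A t" x] by linarith
    qed
    moreover have "0 \<le> ?d * ?d * K" using order_trans[OF norm_ge_zero K[OF order_refl]] by (intro mult_nonneg_nonneg) auto
    ultimately show ?thesis using that fund by (simp add: bounded_linear_system_def)
  qed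
  interpret bounded_linear_system A X a by (rule sys)
  define S where "S = (initial_segment L :: 'n set)"
  define \<Lambda> where "\<Lambda> = (\<Sum>j=1..l. real (m j) * lam j)"
  note growth = ext_norm_growth[OF sys spec reg l L \<Lambda>_def S_def]
  obtain C where C: "0 \<le> C" "\<And>t s u. s \<le> t \<Longrightarrow> u \<le> s \<Longrightarrow> 0 \<le> u \<Longrightarrow>
      ext_norm S (cauchy_matrix X t s) * ext_norm S (cauchy_matrix X s u) \<le> C * ext_norm S (cauchy_matrix X t u)"
    by (rule strongly_fast_invertible_ext_norm[OF sys sfi growth(1) S_def]) (rule that; assumption)
  let ?F = "step_matrix \<Phi> h"
  have grid_Suc: "grid h (Suc n) = grid h n + h (Suc n)" for n by (simp add: grid_def)
  have hS: "0 < h (Suc n)" "h (Suc n) \<le> hmax" for n using h by auto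
  have grid0: "0 \<le> grid h n" for n unfolding grid_def using h by (intro sum_nonneg) (auto intro: less_imp_le)
  have F: "?F (Suc n) = \<Phi> (grid h n) (h (Suc n))" for n by (simp add: step_matrix_def)
  have Finv: "invertible (?F (Suc n))" for n
    using one grid0[of n] hS[of n] unfolding F by (auto simp: one_step_method_def)
  obtain c where c: "\<And>t \<eta>. 0 \<le> t \<Longrightarrow> \<eta> \<in> {0..hmax} \<Longrightarrow>
      opnorm (\<Phi> t \<eta> - cauchy_matrix X (t + \<eta>) t) \<le> c * \<eta> powr (p + 1)"
    using cons unfolding consistent_of_order_def by blast
  have diff: "onorm ((*v) (?F (Suc n) - cauchy_matrix X (grid h (Suc n)) (grid h n))) \<le> c * h (Suc n) powr (p + 1)" for n
    using c[OF grid0[of n], of "h (Suc n)"] hS[of n] unfolding F grid_Suc opnorm_def by simp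
  obtain K where K: "eventually (\<lambda>n. ext_norm S (step_product ?F n) \<le> K * ext_norm S (X (grid h n))) sequentially"
      "eventually (\<lambda>n. ext_norm S (X (grid h n)) \<le> K * ext_norm S (step_product ?F n)) sequentially"
  proof (rule ext_norm_step_product[OF sys a, where \<tau> = "grid h" and F = ?F and H = hmax and C = C
        and \<epsilon> = "\<lambda>n. c * h n powr (p + 1)"])
    show "grid h 0 = 0" by (simp add: grid_def)
    show "grid h n \<le> grid h (Suc n)" "grid h (Suc n) - grid h n \<le> hmax" for n
      using hS[of n] by (auto simp: grid_Suc)
    show "summable (\<lambda>n. c * h (Suc n) powr (p + 1))" by (rule summable_mult[OF sum])
  qed (use Finv diff C that in auto)
  \<comment> \<open>A positive constant is needed in order to cancel it in the lower bound.\<close>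
  define K' where "K' = max 1 K"
  have absorb: "eventually (\<lambda>n. K' * exp (\<mu> * grid h n) \<le> exp (\<nu> * grid h n)) sequentially" if "\<mu> < \<nu>" for \<mu> \<nu>
    using eventually_compose_filterlim[OF eventually_exp_absorbs[OF that] grid] .
  have K'K: "K * ext_norm S M \<le> K' * ext_norm S M" for M :: "'n sqmat"
    by (intro mult_right_mono ext_norm_nonneg) (simp add: K'_def)
  have K'pos: "0 < K'" by (simp add: K'_def)
  have "AE v in lebesgue. limsup (\<lambda>n. ereal (1 / grid h n *
      (\<Sum>k<n. \<Sum>i\<in>S. ln (benettin_R ?F v (Suc k) $ i $ i)))) = ereal \<Lambda>"
  proof (rule limsup_log_volume[where F = ?F and \<tau> = "grid h", OF Finv _ grid])
    show "\<forall>i\<in>S. \<forall>j\<le>i. j \<in> S" unfolding S_def by (rule initial_segment_lower)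
    fix e :: real assume e: "0 < e"
    then have e2: "0 < e / 2" by simp
    have "\<Lambda> + e / 2 < \<Lambda> + e" "\<Lambda> - e < \<Lambda> - e / 2" using e by auto
    note absorb = this[THEN absorb]
    show "eventually (\<lambda>n. ext_norm S (step_product ?F n) \<le> exp ((\<Lambda> + e) * grid h n)) sequentially"
      using K(1) eventually_compose_filterlim[OF growth(2)[OF e2] grid] absorb(1)
    proof eventually_elim
      case (elim n)
      have "ext_norm S (step_product ?F n) \<le> K' * ext_norm S (X (grid h n))" using elim(1) K'K order_trans by blast
      also have "\<dots> \<le> K' * exp ((\<Lambda> + e / 2) * grid h n)" using elim(2) K'pos by (intro mult_left_mono) auto
      also have "\<dots> \<le> exp ((\<Lambda> + e) * grid h n)" by (rule elim(3))
      finally show ?case .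
    qed
    show "eventually (\<lambda>n. exp ((\<Lambda> - e) * grid h n) \<le> ext_norm S (step_product ?F n)) sequentially"
      using K(2) eventually_compose_filterlim[OF growth(3)[OF e2] grid] absorb(2)
    proof eventually_elim
      case (elim n)
      have "K' * exp ((\<Lambda> - e) * grid h n) \<le> exp ((\<Lambda> - e / 2) * grid h n)" by (rule elim(3))
      also have "\<dots> \<le> ext_norm S (X (grid h n))" by (rule elim(2))
      also have "\<dots> \<le> K' * ext_norm S (step_product ?F n)" using elim(1) K'K by (rule order_trans)
      finally show ?case using K'pos by (simp add: mult_le_cancel_left_pos)
    qed
  qed
  then show ?thesis
    unfolding sum_benettin_output[OF growth(1)] S_def \<Lambda>_def .
qed

theorem corollary4p13:
  fixes A X :: "real \<Rightarrow> 'n::{finite,linorder} sqmat"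
    and \<Phi> :: "real \<Rightarrow> real \<Rightarrow> 'n sqmat"
    and h :: "nat \<Rightarrow> real"
    and hmax p :: real
    and q :: nat and lam :: "nat \<Rightarrow> real" and m :: "nat \<Rightarrow> nat"
  assumes "continuous_on {0..} A" and "bounded (A ` {0..})"
    and "is_fundamental_matrix A X"
    and "has_lyapunov_spectrum A q lam m"
    and "regular_system X q lam m"
    and "\<forall>l\<in>{1..q}. strongly_fast_invertible X (\<Sum>j=1..l. m j)"
    and "0 < hmax"
    and "one_step_method hmax \<Phi>"
    and "p > 0" and "consistent_of_order X hmax \<Phi> p"
    and "\<forall>n\<ge>1. 0 < h n \<and> h n \<le> hmax"
    and "filterlim (grid h) at_top sequentially"
    and "summable (\<lambda>n. h (Suc n) powr (p + 1))"
  shows "(AE v in (lebesgue :: 'n tuple measure). \<forall>i\<in>{1..q}.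
            ereal (real (m i) * lam i) =
              limsup (\<lambda>n. ereal (\<Sum>j = 1..(\<Sum>l=1..i. m l). benettin_output \<Phi> h v j n)) -
              limsup (\<lambda>n. ereal (\<Sum>j = 1..(\<Sum>l=1..i-1. m l). benettin_output \<Phi> h v j n)))
       \<and> ((\<forall>i\<in>{1..q}. m i = 1) \<longrightarrow>
           (AE v in (lebesgue :: 'n tuple measure). \<forall>i\<in>{1..q}.
            ereal (lam i) =
              limsup (\<lambda>n. ereal (\<Sum>j = 1..i. benettin_output \<Phi> h v j n)) -
              limsup (\<lambda>n. ereal (\<Sum>j = 1..i-1. benettin_output \<Phi> h v j n))))"
proof -
  let ?s = "\<lambda>v l. limsup (\<lambda>n. ereal (\<Sum>j = 1..(\<Sum>k=1..l. m k). benettin_output \<Phi> h v j n))"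
  let ?\<Lambda> = "\<lambda>l. \<Sum>j=1..l. real (m j) * lam j"
  \<comment> \<open>The index \<open>l = 0\<close> is included so that the empty partial sum at
    \<open>i = 1\<close> needs no separate treatment; its limit superior is 0.\<close>
  have "AE v in (lebesgue :: 'n tuple measure). ?s v l = ereal (?\<Lambda> l)" if "l \<in> {0..q}" for l
  proof (cases "l = 0")
    case True
    then show ?thesis by (simp add: Limsup_const zero_ereal_def)
  next
    case False
    then have l: "l \<in> {1..q}" using that by simp
    show ?thesis
      by (rule benettin_limsup[OF assms(2-5) l refl _ assms(8,10-13)]) (use assms(6) l in blast)
  qed
  then have "AE v in (lebesgue :: 'n tuple measure). \<forall>l\<in>{0..q}. ?s v l = ereal (?\<Lambda> l)"
    by (intro AE_finite_allI) auto
  then have main: "AE v in (lebesgue :: 'n tuple measure). \<forall>i\<in>{1..q}.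
      ereal (real (m i) * lam i) = ?s v i - ?s v (i - 1)"
  proof eventually_elim
    case (elim v)
    show ?case
    proof
      fix i assume i: "i \<in> {1..q}"
      \<comment> \<open>Both limits are finite, so the extended-real difference is the ordinary
        one.\<close>
      then have eq: "?s v i = ereal (?\<Lambda> i)" "?s v (i - 1) = ereal (?\<Lambda> (i - 1))" using elim by auto
      have "?\<Lambda> i = ?\<Lambda> (i - 1) + real (m i) * lam i"
        using i by (cases i) auto
      then show "ereal (real (m i) * lam i) = ?s v i - ?s v (i - 1)" unfolding eq by simp
    qed
  qed
  have "AE v in (lebesgue :: 'n tuple measure). \<forall>i\<in>{1..q}.
            ereal (lam i) =
              limsup (\<lambda>n. ereal (\<Sum>j = 1..i. benettin_output \<Phi> h v j n)) -
              limsup (\<lambda>n. ereal (\<Sum>j = 1..i-1. benettin_output \<Phi> h v j n))"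
    if simple: "\<forall>i\<in>{1..q}. m i = 1"
    using main
  proof eventually_elim
    case (elim v)
    \<comment> \<open>With unit multiplicities the sums of multiplicities in the output ranges
      collapse to \<open>i\<close> and \<open>i - 1\<close>.\<close>
    have "(\<Sum>k=1..i. m k) = i" if "i \<le> q" for i
    proof -
      have "(\<Sum>k=1..i. m k) = (\<Sum>k=1..i. 1)" using simple that by (intro sum.cong) auto
      then show ?thesis by simp
    qed
    then have "(\<Sum>k=1..i. m k) = i" "(\<Sum>k=1..i-1. m k) = i - 1" if "i \<in> {1..q}" for i
      using that by auto
    then show ?case using elim simple by simp
  qed
  then show ?thesis using main by blast
qed

end
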